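(* Let $n,m\in\mathbb{N}$. For all $\xi,y,v\in\mathbb{R}^n$ let $$L_{\xi,y}(v)=\frac{1}{(2\pi)^{n/2}}\int_{\mathbb{R}^n}K^{\mathcal{H}_m}_{0,y}(u,v)\,e^{-i\langle u,\xi\rangle}\,d\mu_n(u),$$ where $K^{\mathcal{H}_m}$ is the reproducing kernel of $\mathcal{H}_m$. Then for every $\xi,y,v\in\mathbb{R}^n$, $$L_{\xi,y}(v)=\sum_{k\in J_{n,m}}\overline{q_{k,\xi}(y)}\,q_{k,\xi}(v)=\sum_{k\in J_{n,m}}q_{k,\xi}(y)\,q_{k,\xi}(v),$$ where $$q_{k,\xi}(v)=2^{n/2}\pi^{n/4}\prod_{r=1}^n\psi_{k_r}\left(\frac{\xi_r+2v_r}{\sqrt2}\right).$$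
   Context: Notation: $\mathbb{N}=\{1,2,\ldots\}$, $\mathbb{N}_0=\{0,1,2,\ldots\}$; $|k|=k_1+\cdots+k_n$ for $k\in\mathbb{N}_0^n$; $J_{n,m}=\{k\in\mathbb{N}_0^n\colon|k|\le m-1\}$; $\langle z,w\rangle=\sum_{r=1}^n z_r\overline{w_r}$ and $|z|=\sqrt{\langle z,z\rangle}$ on $\mathbb{C}^n$; $\mu_n$ is Lebesgue measure on $\mathbb{R}^n$, $\mu_{2n}$ is Lebesgue measure on $\mathbb{C}^n\cong\mathbb{R}^{2n}$, $\widetilde\mu_{2n}=(2\pi)^{-n}\mu_{2n}$. Hermite functions: $\psi_j(t)=(2^j j!\sqrt\pi)^{-1/2}e^{-t^2/2}H_j(t)$, $j\in\mathbb{N}_0$, with $H_j$ the physicists' Hermite polynomial. A smooth function $f\colon\mathbb{C}^n\to\mathbb{C}$ is $m$-analytic if $\overline{D}^k f=0$ for every $k\in\mathbb{N}_0^n$ with $|k|=m$, where $\overline{D}^k=\partial_{\overline{z}_1}^{k_1}\cdots\partial_{\overline{z}_n}^{k_n}$ (Wirtinger derivatives). For $\alpha>0$, $\mathcal{F}_{\alpha,m}$ is the Hilbert space of all $m$-analytic functions $f\colon\mathbb{C}^n\to\mathbb{C}$ with $\|f\|^2=\frac{\alpha^n}{\pi^n}\int_{\mathbb{C}^n}|f(z)|^2e^{-\alpha|z|^2}\,d\mu_{2n}(z)<\infty$. The space $\mathcal{H}_m$ consists of all functions on $\mathbb{R}^{2n}=\mathbb{R}^n\times\mathbb{R}^n$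 of the form $$(x,y)\mapsto 2^{n/2}e^{-\frac12|x|^2-\frac12|y|^2-i\langle x,y\rangle}f\Bigl(\frac{x+iy}{\sqrt\alpha}\Bigr),\qquad f\in\mathcal{F}_{\alpha,m},$$ with the inner product of $L^2(\mathbb{R}^{2n},\widetilde\mu_{2n})$; it does not depend on $\alpha$ and is a reproducing kernel Hilbert space. Its reproducing kernel is denoted by $K^{\mathcal{H}_m}_{x,y}(u,v)$, i.e. $K^{\mathcal{H}_m}_{x,y}\in\mathcal{H}_m$ and $g(x,y)=\langle g,K^{\mathcal{H}_m}_{x,y}\rangle_{\mathcal{H}_m}$ for all $g\in\mathcal{H}_m$. *)

theory Defs
  imports "HOL-Analysis.Analysis"
begin

text \<open>The dimension \<open>n\<close> is \<open>CARD('n)\<close>. The real inner product that the library puts on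
  \<open>complex ^ 'n\<close> is the real part of the Hermitian one, so \<open>norm\<close> is the usual
  norm and \<^const>\<open>lborel\<close> is Lebesgue measure under the identification with
  \<open>2n\<close>-dimensional real space.\<close>

definition mi_size :: "nat ^ 'n \<Rightarrow> nat" where
  "mi_size k = (\<Sum>r\<in>UNIV. k $ r)"

definition J :: "nat \<Rightarrow> (nat ^ 'n) set" where
  "J m = {k. mi_size k \<le> m - 1}"

primrec Ck :: "nat \<Rightarrow> ('a::real_normed_vector \<Rightarrow> 'b::real_normed_vector) \<Rightarrow> bool" where
  "Ck 0 f \<longleftrightarrow> continuous_on UNIV f"
| "Ck (Suc j) f \<longleftrightarrow> (\<forall>x. f differentiable (at x)) \<and>
     (\<forall>h. Ck j (\<lambda>x. frechet_derivative f (at x) h))"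

definition smooth :: "('a::real_normed_vector \<Rightarrow> 'b::real_normed_vector) \<Rightarrow> bool" where
  "smooth f \<longleftrightarrow> (\<forall>j. Ck j f)"

text \<open>The Wirtinger derivative with respect to the conjugate of the \<open>r\<close>-th variable: half the
  partial derivative along the real axis plus \<open>\<i>\<close> times the one along the imaginary axis.\<close>

definition dbar :: "'n \<Rightarrow> (complex ^ 'n \<Rightarrow> complex) \<Rightarrow> complex ^ 'n \<Rightarrow> complex" where
  "dbar r f z = (frechet_derivative f (at z) (axis r 1)
                 + \<i> * frechet_derivative f (at z) (axis r \<i>)) / 2"

text \<open>The index type carries no order, so the composition defining the mixed derivative is taken
  along an arbitrary fixed enumeration of it. On smooth functions the order is irrelevant.\<close>

definition index_list :: "'n::finite list" where
  "index_list = (SOME rs. distinct rs \<and> set rs = UNIV)"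

definition Dbar :: "nat ^ 'n \<Rightarrow> (complex ^ 'n \<Rightarrow> complex) \<Rightarrow> complex ^ 'n \<Rightarrow> complex" where
  "Dbar k f = foldr (\<lambda>r. dbar r ^^ (k $ r)) index_list f"

definition m_analytic :: "nat \<Rightarrow> (complex ^ 'n \<Rightarrow> complex) \<Rightarrow> bool" where
  "m_analytic m f \<longleftrightarrow> smooth f \<and> (\<forall>k. mi_size k = m \<longrightarrow> (\<forall>z. Dbar k f z = 0))"

definition Fock :: "real \<Rightarrow> nat \<Rightarrow> (complex ^ 'n \<Rightarrow> complex) set" where
  "Fock \<alpha> m = {f. m_analytic m f \<and>
     integrable lborel (\<lambda>z. (cmod (f z))\<^sup>2 * exp (- \<alpha> * (norm z)\<^sup>2))}"

definition Hm_embed :: "real \<Rightarrow> (complex ^ 'n \<Rightarrow> complex) \<Rightarrow> (real ^ 'n) \<times> (real ^ 'n) \<Rightarrow> complex" where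
  "Hm_embed \<alpha> f = (\<lambda>(x, y).
     complex_of_real (2 powr (real CARD('n) / 2))
     * exp (complex_of_real (- (norm x)\<^sup>2 / 2 - (norm y)\<^sup>2 / 2) - \<i> * complex_of_real (x \<bullet> y))
     * f (\<chi> r. (complex_of_real (x $ r) + \<i> * complex_of_real (y $ r)) / complex_of_real (sqrt \<alpha>)))"

definition Hm :: "real \<Rightarrow> nat \<Rightarrow> ((real ^ 'n) \<times> (real ^ 'n) \<Rightarrow> complex) set" where
  "Hm \<alpha> m = Hm_embed \<alpha> ` Fock \<alpha> m"

definition Hm_inner ::
  "((real ^ 'n) \<times> (real ^ 'n) \<Rightarrow> complex) \<Rightarrow> ((real ^ 'n) \<times> (real ^ 'n) \<Rightarrow> complex) \<Rightarrow> complex" where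
  "Hm_inner g h =
     complex_of_real (1 / (2 * pi) ^ CARD('n)) * (LINT p|lborel. g p * cnj (h p))"

definition Hm_kernel ::
  "real \<Rightarrow> nat \<Rightarrow> (real ^ 'n) \<times> (real ^ 'n) \<Rightarrow> (real ^ 'n) \<times> (real ^ 'n) \<Rightarrow> complex" where
  "Hm_kernel \<alpha> m p = (THE h. h \<in> Hm \<alpha> m \<and> (\<forall>g\<in>Hm \<alpha> m. g p = Hm_inner g h))"

definition L :: "real \<Rightarrow> nat \<Rightarrow> real ^ 'n \<Rightarrow> real ^ 'n \<Rightarrow> real ^ 'n \<Rightarrow> complex" where
  "L \<alpha> m \<xi> y v =
     complex_of_real (1 / (2 * pi) powr (real CARD('n) / 2))
     * (LINT u|lborel. Hm_kernel \<alpha> m (0, y) (u, v) * exp (- \<i> * complex_of_real (u \<bullet> \<xi>)))"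

text \<open>Physicists' Hermite polynomials, by Rodrigues' formula.\<close>

definition Hermite :: "nat \<Rightarrow> real \<Rightarrow> real" where
  "Hermite j t = (- 1) ^ j * exp (t\<^sup>2) * (deriv ^^ j) (\<lambda>s. exp (- s\<^sup>2)) t"

definition hermite_fun :: "nat \<Rightarrow> real \<Rightarrow> real" where
  "hermite_fun j t = (2 ^ j * fact j * sqrt pi) powr (- 1 / 2) * exp (- t\<^sup>2 / 2) * Hermite j t"

definition q :: "nat ^ 'n \<Rightarrow> real ^ 'n \<Rightarrow> real ^ 'n \<Rightarrow> complex" where
  "q k \<xi> v = complex_of_real (2 powr (real CARD('n) / 2) * pi powr (real CARD('n) / 4)
     * (\<Prod>r\<in>UNIV. hermite_fun (k $ r) ((\<xi> $ r + 2 * v $ r) / sqrt 2)))"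

end

theory Submission
  imports Defs "HOL-Probability.Probability" "HOL-Complex_Analysis.Complex_Analysis"
    "HOL-Real_Asymp.Real_Asymp"
begin

text \<open>Write \<open>z = x + iy\<close> and \<open>w = u + iv\<close>. The kernel is
  \<open>2\<^sup>n exp (- |z|\<^sup>2/2 - |w|\<^sup>2/2 + i x\<cdot>y - i u\<cdot>v + \<langle>w, z\<rangle>) Q(|w - z|\<^sup>2)\<close>,
  where \<open>Q\<close> is the Laguerre polynomial of degree \<open>m - 1\<close> and parameter \<open>n\<close>.
  Weyl translations reduce its reproducing property to the origin. There, averaging
  over the circle action \<open>w \<mapsto> e\<^sup>i\<^sup>t w\<close> turns a polyanalytic function into a sum of real-homogeneous
  functions of degrees \<open>0, 2, \<dots>, 2(m - 1)\<close>, because its restriction to a complex line is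
  \<open>\<Sum>k<m. cnj \<zeta>\<^sup>k a\<^sub>k(\<zeta>)\<close> with entire \<open>a\<^sub>k\<close>; Gaussian moments of homogeneous functions are
  determined by scaling, and Vandermonde's identity shows that \<open>Q\<close> annihilates all
  degrees but \<open>0\<close>. By the addition theorem \<open>Q(\<Sum>r. t\<^sub>r)\<close> is the sum over \<open>k \<in> J m\<close> of the
  products of the Laguerre polynomials of degrees \<open>k\<^sub>r\<close> and parameter \<open>0\<close>, so the Fourier transform splits
  into one-dimensional integrals, which Gaussian integration by parts evaluates as products of two
  Hermite functions.\<close>

text \<open>\<open>Hm_kernel\<close> is a \<open>THE\<close>, so an explicit candidate has to lie in
  \<open>Hm\<close>, to reproduce, and to be the only function doing so; uniqueness comes from
  Hermitian symmetry. \<alpha> only rescales the argument, hence the candidate is free of it. The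
  obstacle at the origin is that a polyanalytic function has no mean value property: its average
  over a circle still contains powers of the radius. For a component homogeneous of degree 2k, the
  p-th Gaussian moment is the 0-th one times the rising factorial (n + k)(n + k + 1)...(n + k + p -
  1). A polynomial weight in |w|^2 with coefficients b_p therefore singles out the component of
  degree 0 as soon as the sum over p of b_p times this factorial is 1 for k = 0 and 0 for 0 < k < m.
  These m linear equations are where Q comes from. On the Fourier side the kernel has Laguerre
  parameter n, while the one-dimensional factors have parameter 0. One additional factor 1/(1 - X)
  in the generating function bridges the gap, and it is also the source of the inequality |k| \<le>
  m - 1 in \<open>J\<close>.\<close>

no_notation fps_nth (infixl "$" 75)

section \<open>Lebesgue measure on real and complex coordinate spaces\<close>

text \<open>Preimages of boxes are boxes with the same side lengths, and boxes determine
  \<open>lborel\<close>. The map may go between different types, which is what identifies R^n x R^n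
  with C^n.\<close>

lemma lborel_distr_Basis_bij:
  fixes \<phi> :: "'a::euclidean_space \<Rightarrow> 'b::euclidean_space"
  assumes lin: "linear \<phi>" and bij: "bij_betw \<phi> Basis Basis"
    and iso: "\<And>x b. b \<in> Basis \<Longrightarrow> \<phi> x \<bullet> \<phi> b = x \<bullet> b"
  shows "distr lborel lborel \<phi> = lborel"
proof (rule lborel_eqI[symmetric])
  have cont: "continuous_on UNIV \<phi>" using lin by (simp add: linear_continuous_on linear_linear)
  have meas [measurable]: "\<phi> \<in> borel_measurable borel" using cont by (rule borel_measurable_continuous_onI)
  let ?g = "\<lambda>x. (\<Sum>b\<in>Basis. (x \<bullet> \<phi> b) *\<^sub>R b) :: 'a"
  have g: "?g x \<bullet> b = x \<bullet> \<phi> b" if "b \<in> Basis" for x b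
    using that by simp
  fix l u :: 'b assume le: "\<And>b. b \<in> Basis \<Longrightarrow> l \<bullet> b \<le> u \<bullet> b"
  have im: "Basis = \<phi> ` Basis" using bij by (simp add: bij_betw_def)
  have pre: "\<phi> -` box l u = box (?g l) (?g u)"
    unfolding box_def vimage_def
    by (subst im) (simp add: iso)
  have "emeasure (distr lborel lborel \<phi>) (box l u) = emeasure lborel (\<phi> -` box l u)"
    by (subst emeasure_distr) auto
  also have "\<dots> = emeasure lborel (box (?g l) (?g u))" by (simp add: pre)
  also have "\<dots> = (\<Prod>b\<in>Basis. (?g u - ?g l) \<bullet> b)"
  proof (rule emeasure_lborel_box)
    fix b :: 'a assume "b \<in> Basis"
    moreover have "\<phi> b \<in> Basis" using calculation im by blast
    ultimately show "?g l \<bullet> b \<le> ?g u \<bullet> b" using le by simp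
  qed
  also have "(\<Prod>b\<in>Basis. (?g u - ?g l) \<bullet> b) = (\<Prod>b\<in>Basis. (u - l) \<bullet> \<phi> b)"
    by (intro prod.cong) (simp_all add: inner_diff_left)
  also have "\<dots> = (\<Prod>b\<in>Basis. (u - l) \<bullet> b)"
    using prod.reindex_bij_betw[OF bij, of "\<lambda>b. (u - l) \<bullet> b"] by simp
  finally show "emeasure (distr lborel lborel \<phi>) (box l u) = (\<Prod>b\<in>Basis. (u - l) \<bullet> b)" .
qed simp

lemma lborel_integral_Basis_bij:
  fixes \<phi> :: "'a::euclidean_space \<Rightarrow> 'b::euclidean_space" and f :: "'b \<Rightarrow> 'c::{banach, second_countable_topology}"
  assumes lin: "linear \<phi>" and "bij_betw \<phi> Basis Basis"
    and "\<And>x b. b \<in> Basis \<Longrightarrow> \<phi> x \<bullet> \<phi> b = x \<bullet> b" and f: "f \<in> borel_measurable borel"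
  shows "(LINT x|lborel. f (\<phi> x)) = (LINT y|lborel. f y)"
    and "integrable lborel (\<lambda>x. f (\<phi> x)) \<longleftrightarrow> integrable lborel f"
proof -
  have [measurable]: "\<phi> \<in> borel_measurable borel"
    using linear_continuous_on[of \<phi> UNIV] lin by (simp add: borel_measurable_continuous_onI linear_linear)
  note D = lborel_distr_Basis_bij[OF assms(1-3)]
  have "(LINT x|lborel. f (\<phi> x)) = (LINT y|distr lborel lborel \<phi>. f y)"
    by (rule integral_distr[symmetric]) (use f in \<open>auto simp:\<close>)
  then show "(LINT x|lborel. f (\<phi> x)) = (LINT y|lborel. f y)" by (simp only: D)
  have "integrable lborel (\<lambda>x. f (\<phi> x)) \<longleftrightarrow> integrable (distr lborel lborel \<phi>) f"
    by (rule integrable_distr_eq[symmetric]) (use f in auto)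
  then show "integrable lborel (\<lambda>x. f (\<phi> x)) \<longleftrightarrow> integrable lborel f" by (simp only: D)
qed

lemma lborel_integral_affine:
  fixes f :: "'a::euclidean_space \<Rightarrow> 'b::{banach, second_countable_topology}"
  assumes f: "f \<in> borel_measurable borel" and c: "c \<noteq> 0"
  shows "(LINT x|lborel. f (t + c *\<^sub>R x)) = (1 / \<bar>c\<bar> ^ DIM('a)) *\<^sub>R (LINT x|lborel. f x)"
    and "integrable lborel (\<lambda>x. f (t + c *\<^sub>R x)) \<longleftrightarrow> integrable lborel f"
proof -
  note D = lborel_affine[OF c, of t]
  have "(LINT x|lborel. f x) = \<bar>c\<bar> ^ DIM('a) *\<^sub>R (LINT x|lborel. f (t + c *\<^sub>R x))"
    by (subst D, subst integral_density) (use f in \<open>auto simp: integral_distr\<close>)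
  then show "(LINT x|lborel. f (t + c *\<^sub>R x)) = (1 / \<bar>c\<bar> ^ DIM('a)) *\<^sub>R (LINT x|lborel. f x)"
    using c by simp
  have "integrable lborel f \<longleftrightarrow> integrable lborel (\<lambda>x. \<bar>c\<bar> ^ DIM('a) *\<^sub>R f (t + c *\<^sub>R x))"
    by (subst D, subst integrable_density) (use f in \<open>auto simp: integrable_distr_eq\<close>)
  also have "\<dots> \<longleftrightarrow> integrable lborel (\<lambda>x. f (t + c *\<^sub>R x))"
  proof
    assume "integrable lborel (\<lambda>x. \<bar>c\<bar> ^ DIM('a) *\<^sub>R f (t + c *\<^sub>R x))"
    from integrable_scaleR_right[OF this, of "1 / \<bar>c\<bar> ^ DIM('a)"]
    show "integrable lborel (\<lambda>x. f (t + c *\<^sub>R x))" using c by simp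
  qed (rule integrable_scaleR_right)
  finally show "integrable lborel (\<lambda>x. f (t + c *\<^sub>R x)) \<longleftrightarrow> integrable lborel f" ..
qed

lemma lborel_integral_prod_Basis:
  fixes f :: "'a::euclidean_space \<Rightarrow> real \<Rightarrow> complex"
  assumes f: "\<And>b. b \<in> Basis \<Longrightarrow> integrable lborel (f b)"
  shows "integrable lborel (\<lambda>x::'a. \<Prod>b\<in>Basis. f b (x \<bullet> b))"
    and "(LINT x|lborel. (\<Prod>b\<in>Basis. f b (x \<bullet> b))) = (\<Prod>b\<in>(Basis::'a set). LINT t|lborel. f b t)"
proof -
  interpret product_sigma_finite "\<lambda>_::'a. lborel :: real measure" by standard
  have [measurable]: "\<And>b. b \<in> Basis \<Longrightarrow> f b \<in> borel_measurable borel"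
    using borel_measurable_integrable[OF f] by simp
  have L: "(lborel :: 'a measure) = distr (Pi\<^sub>M Basis (\<lambda>_. lborel)) borel (\<lambda>f. \<Sum>b\<in>Basis. f b *\<^sub>R b)"
    by (rule lborel_eq)
  have e: "(\<Prod>b\<in>(Basis::'a set). f b ((\<Sum>b\<in>Basis. x b *\<^sub>R b) \<bullet> b)) = (\<Prod>b\<in>Basis. f b (x b))" for x
    by (intro prod.cong) auto
  have m: "(\<lambda>x::'a. \<Prod>b\<in>Basis. f b (x \<bullet> b)) \<in> borel_measurable borel"
    by (intro borel_measurable_prod) measurable
  have s: "(\<lambda>f. \<Sum>b\<in>Basis. f b *\<^sub>R b) \<in> Pi\<^sub>M Basis (\<lambda>_. lborel) \<rightarrow>\<^sub>M (borel :: 'a measure)"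
    by measurable
  have "integrable (Pi\<^sub>M (Basis::'a set) (\<lambda>_. lborel)) (\<lambda>x. \<Prod>b\<in>Basis. f b (x b))"
    by (rule product_integrable_prod) (simp_all add: f)
  then show "integrable lborel (\<lambda>x::'a. \<Prod>b\<in>Basis. f b (x \<bullet> b))"
    by (subst L, subst integrable_distr_eq[OF s m]) (simp only: e)
  have "(LINT x|lborel. (\<Prod>b\<in>Basis. f b (x \<bullet> b))) =
      (LINT x|Pi\<^sub>M (Basis::'a set) (\<lambda>_. lborel). (\<Prod>b\<in>Basis. f b (x b)))"
    by (subst L, subst integral_distr[OF s m]) (simp only: e)
  also have "\<dots> = (\<Prod>b\<in>(Basis::'a set). LINT t|lborel. f b t)"
    by (rule product_integral_prod) (simp_all add: f)
  finally show "(LINT x|lborel. (\<Prod>b\<in>Basis. f b (x \<bullet> b))) = (\<Prod>b\<in>(Basis::'a set). LINT t|lborel. f b t)" .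
qed

lemma Basis_real_vec: "(Basis :: (real^'n) set) = range (\<lambda>r. axis r 1)"
  by (auto simp: Basis_vec_def)

lemma lborel_integral_prod_vec:
  fixes f :: "'n::finite \<Rightarrow> real \<Rightarrow> complex"
  assumes f: "\<And>r. integrable lborel (f r)"
  shows "integrable lborel (\<lambda>x::real^'n. \<Prod>r\<in>UNIV. f r (x $ r))"
    and "(LINT x|lborel. (\<Prod>r\<in>UNIV. f r ((x::real^'n) $ r))) = (\<Prod>r\<in>UNIV. LINT t|lborel. f r t)"
proof -
  have inj: "inj (\<lambda>r::'n. axis r (1::real))" by (auto simp: inj_on_def axis_eq_axis)
  define g where "g b = f (inv (\<lambda>r. axis r (1::real)) b)" for b
  have g: "g (axis r 1) = f r" for r
    unfolding g_def using inv_f_f[OF inj, of r] by simp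
  have e: "(\<Prod>b\<in>Basis. h b) = (\<Prod>r\<in>UNIV. h (axis r 1))" for h :: "real^'n \<Rightarrow> complex"
    unfolding Basis_real_vec using inj by (subst prod.reindex) auto
  have gi: "integrable lborel (g b)" for b using f by (simp add: g_def)
  show "integrable lborel (\<lambda>x::real^'n. \<Prod>r\<in>UNIV. f r (x $ r))"
    using lborel_integral_prod_Basis(1)[of g, OF gi] by (simp add: e g inner_axis)
  show "(LINT x|lborel. (\<Prod>r\<in>UNIV. f r ((x::real^'n) $ r))) = (\<Prod>r\<in>UNIV. LINT t|lborel. f r t)"
    using lborel_integral_prod_Basis(2)[of g, OF gi] by (simp add: e g inner_axis)
qed

lemma linear_cvec_of_pair: "linear (\<lambda>p. (\<chi> r. Complex (fst p $ r) (snd p $ r)) :: complex^'n)"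
  by (rule linearI) (auto simp: vec_eq_iff complex_eq_iff)

lemma bij_Basis_cvec_of_pair:
  "bij_betw (\<lambda>p. (\<chi> r. Complex (fst p $ r) (snd p $ r)) :: complex^'n) Basis Basis"
proof -
  have a: "(\<chi> r. Complex ((axis s 1 :: real^'n) $ r) 0) = axis s 1"
     "(\<chi> r. Complex 0 ((axis s 1 :: real^'n) $ r)) = axis s \<i>" for s
    by (auto simp: vec_eq_iff axis_def complex_eq_iff)
  have b: "Basis = range (\<lambda>s::'n. axis s (1::complex)) \<union> range (\<lambda>s. axis s \<i>)"
    by (auto simp: Basis_vec_def Basis_complex_def)
  show ?thesis
    unfolding bij_betw_def b Basis_prod_def Basis_real_vec
    by (intro conjI inj_onI) (auto simp: vec_eq_iff complex_eq_iff prod_eq_iff image_Un image_image a)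
qed

lemma cvec_inner: "(x :: complex^'n) \<bullet> y = (\<Sum>r\<in>UNIV. Re (x$r) * Re (y$r) + Im (x$r) * Im (y$r))"
  by (simp add: inner_vec_def inner_complex_def)

lemma lborel_integral_cvec_of_pair:
  fixes f :: "complex^'n \<Rightarrow> 'c::{banach, second_countable_topology}"
  assumes "f \<in> borel_measurable borel"
  shows "(LINT p|lborel. f (\<chi> r. Complex (fst p $ r) (snd p $ r))) = (LINT w|lborel. f w)"
    and "integrable lborel (\<lambda>p. f (\<chi> r. Complex (fst p $ r) (snd p $ r))) \<longleftrightarrow> integrable lborel f"
proof -
  have "(\<chi> r. Complex (fst x $ r) (snd x $ r)) \<bullet> ((\<chi> r. Complex (fst b $ r) (snd b $ r)) :: complex^'n)
      = x \<bullet> b" for x b :: "(real^'n) \<times> (real^'n)"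
    by (simp add: cvec_inner inner_prod_def inner_vec_def sum.distrib)
  note * = lborel_integral_Basis_bij[OF linear_cvec_of_pair bij_Basis_cvec_of_pair this assms]
  show "(LINT p|lborel. f (\<chi> r. Complex (fst p $ r) (snd p $ r))) = (LINT w|lborel. f w)"
    by (rule *(1))
  show "integrable lborel (\<lambda>p. f (\<chi> r. Complex (fst p $ r) (snd p $ r))) \<longleftrightarrow> integrable lborel f"
    by (rule *(2))
qed

section \<open>Invariance under shears, rotations and unimodular scalars\<close>

lemma lborel_distr_swap:
  "distr lborel borel (\<lambda>(x, y). (y, x)) = (lborel :: ('a::euclidean_space \<times> 'a) measure)"
proof -
  have "distr lborel borel (\<lambda>(x, y). (y, x)) = distr (lborel :: ('a \<times> 'a) measure) lborel (\<lambda>(x, y). (y, x))"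
    by (rule distr_cong) auto
  then show ?thesis using lborel_pair.distr_pair_swap[where 'a='a and 'b='a]
    by (simp add: lborel_prod borel_prod)
qed

text \<open>On each slice with fixed y the shear is a translation, so Tonelli reduces the claim to
  translation invariance.\<close>

lemma lborel_distr_shear:
  "distr lborel borel (\<lambda>(x, y). (x + a *\<^sub>R y, y)) = (lborel :: ('a::euclidean_space \<times> 'a) measure)"
proof (rule measure_eqI)
  let ?S = "\<lambda>p::'a \<times> 'a. (fst p + a *\<^sub>R snd p, snd p)"
  have S [measurable]: "?S \<in> borel_measurable borel"
    by (intro borel_measurable_continuous_onI continuous_intros)
  fix A :: "('a \<times> 'a) set" assume "A \<in> sets (distr lborel borel (\<lambda>(x, y). (x + a *\<^sub>R y, y)))"
  then have A [measurable]: "A \<in> sets borel" by simp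
  have A' [measurable]: "A \<in> sets (borel \<Otimes>\<^sub>M borel)" using A unfolding borel_prod .
  have m1: "(\<lambda>p. indicator A (?S p) :: ennreal) \<in> borel_measurable (lborel \<Otimes>\<^sub>M lborel)"
    by (simp add: lborel_prod)
  have m2: "(indicator A :: _ \<Rightarrow> ennreal) \<in> borel_measurable (lborel \<Otimes>\<^sub>M lborel)"
    by (simp add: lborel_prod)
  have "emeasure (distr lborel borel ?S) A = (\<integral>\<^sup>+p. indicator A p \<partial>distr lborel borel ?S)"
    by simp
  also have "\<dots> = (\<integral>\<^sup>+p. indicator A (?S p) \<partial>lborel)"
    by (subst nn_integral_distr) auto
  also have "\<dots> = (\<integral>\<^sup>+y. \<integral>\<^sup>+x. indicator A (x + a *\<^sub>R y, y) \<partial>lborel \<partial>lborel)"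
    using lborel_pair.nn_integral_snd[OF m1] by (simp add: lborel_prod)
  also have "\<dots> = (\<integral>\<^sup>+y. \<integral>\<^sup>+x. indicator A (x, y) \<partial>lborel \<partial>lborel)"
  proof (rule nn_integral_cong)
    fix y :: 'a
    have [measurable]: "(\<lambda>x. indicator A (x, y) :: ennreal) \<in> borel_measurable borel"
      by measurable
    have "(\<integral>\<^sup>+x. indicator A (x, y) \<partial>lborel) = (\<integral>\<^sup>+x. indicator A (x, y) \<partial>distr lborel borel ((+) (a *\<^sub>R y)))"
      by (simp only: lborel_distr_plus)
    also have "\<dots> = (\<integral>\<^sup>+x. indicator A (x + a *\<^sub>R y, y) \<partial>lborel)"
      by (subst nn_integral_distr) (auto simp: add.commute)
    finally show "(\<integral>\<^sup>+x. indicator A (x + a *\<^sub>R y, y) \<partial>lborel) = (\<integral>\<^sup>+x. indicator A (x, y) \<partial>lborel)" ..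
  qed
  also have "\<dots> = emeasure lborel A"
    using lborel_pair.nn_integral_snd[OF m2] by (simp add: lborel_prod)
  finally show "emeasure (distr lborel borel (\<lambda>(x, y). (x + a *\<^sub>R y, y))) A = emeasure lborel A"
    by (simp add: case_prod_unfold)
qed simp

text \<open>Away from angle \<open>\<pi>\<close> a plane rotation is a product of three shears.\<close>

lemma lborel_distr_rotation:
  assumes "a\<^sup>2 + b\<^sup>2 = 1" and "a \<noteq> -1"
  shows "distr lborel borel (\<lambda>(x, y). (a *\<^sub>R x - b *\<^sub>R y, b *\<^sub>R x + a *\<^sub>R y))
    = (lborel :: ('a::euclidean_space \<times> 'a) measure)"
proof -
  define S where "S c = (\<lambda>(x, y). (x + c *\<^sub>R y, y :: 'a))" for c :: real
  define W where "W = (\<lambda>(x, y). (y :: 'a, x :: 'a))"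
  have S [measurable]: "S c \<in> borel_measurable borel" and W [measurable]: "W \<in> borel_measurable borel" for c
    by (auto simp: S_def W_def case_prod_beta intro!: borel_measurable_continuous_onI continuous_intros)
  have dS: "distr lborel borel (S c) = lborel" and dW: "distr lborel borel W = lborel" for c
    using lborel_distr_shear[of c] lborel_distr_swap by (simp_all add: S_def W_def)
  have comp: "distr lborel borel (\<lambda>p. F (G p)) = lborel"
    if "distr lborel borel F = lborel" "distr lborel borel G = lborel"
      and [measurable]: "F \<in> borel_measurable borel" "G \<in> borel_measurable borel"
    for F G :: "'a \<times> 'a \<Rightarrow> 'a \<times> 'a"
  proof -
    have "distr lborel borel (\<lambda>p. F (G p)) = distr (distr lborel borel G) borel F"
      by (subst distr_distr) (auto simp: comp_def)
    then show ?thesis using that by simp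
  qed
  \<comment> \<open>The tangent of half the angle with cosine a and sine b. The outer shears have
    slope -t; the middle one, of slope b, acts on the other coordinate, hence the swaps
    \<open>W\<close> around it.\<close>
  define t where "t = b / (1 + a)"
  have nz: "1 + a \<noteq> 0" using assms(2) by linarith
  have t1: "1 - b * t = a"
  proof -
    have "b * b = (1 + a) * (1 - a)" using assms(1) by (simp add: algebra_simps power2_eq_square)
    then show ?thesis using nz by (simp add: t_def field_simps)
  qed
  have t2: "t * (1 + a) = b" using nz by (simp add: t_def)
  have "S (-t) (W (S b (W (S (-t) p)))) = (case p of (x, y) \<Rightarrow> (a *\<^sub>R x - b *\<^sub>R y, b *\<^sub>R x + a *\<^sub>R y))" for p
  proof (cases p)
    case (Pair x y)
    have "y + b *\<^sub>R (x + - t *\<^sub>R y) = b *\<^sub>R x + a *\<^sub>R y"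
      unfolding t1[symmetric] by (simp add: algebra_simps)
    moreover have "x + - t *\<^sub>R y + - t *\<^sub>R (b *\<^sub>R x + a *\<^sub>R y) = (1 - b * t) *\<^sub>R x - (t * (1 + a)) *\<^sub>R y"
      by (simp add: algebra_simps)
    ultimately show ?thesis unfolding Pair by (simp add: S_def W_def t1 t2)
  qed
  moreover have "distr lborel borel (\<lambda>p. S (-t) (W (S b (W (S (-t) p))))) = lborel"
  proof -
    have 1: "distr lborel borel (\<lambda>p. W (S (-t) p)) = lborel"
      by (rule comp[OF dW dS W S])
    have 2: "distr lborel borel (\<lambda>p. S b (W (S (-t) p))) = lborel"
      by (rule comp[OF dS 1 S]) measurable
    have 3: "distr lborel borel (\<lambda>p. W (S b (W (S (-t) p)))) = lborel"
      by (rule comp[OF dW 2 W]) measurable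
    show ?thesis
      by (rule comp[OF dS 3 S]) measurable
  qed
  ultimately show ?thesis by simp
qed

text \<open>Multiplication by \<zeta> rotates the pair of real and imaginary parts. The excluded
  angle \<pi> is reached by applying twice the rotation by \<open>csqrt \<zeta>\<close>, whose real
  part is nonnegative.\<close>

lemma lborel_integral_rotation:
  fixes f :: "complex^'n \<Rightarrow> 'c::{banach, second_countable_topology}"
  assumes f [measurable]: "f \<in> borel_measurable borel" and \<zeta>: "cmod \<zeta> = 1"
  shows "(LINT w|lborel. f (\<chi> r. \<zeta> * w $ r)) = (LINT w|lborel. f w)"
    and "integrable lborel (\<lambda>w. f (\<chi> r. \<zeta> * w $ r)) \<longleftrightarrow> integrable lborel f"
proof -
  have cont: "(\<lambda>w::complex^'n. (\<chi> r. z * w $ r) :: complex^'n) \<in> borel_measurable borel" for z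
    by (intro borel_measurable_continuous_onI continuous_intros)
  have main: "(LINT w|lborel. f (\<chi> r. z * w $ r)) = (LINT w|lborel. f w) \<and>
     (integrable lborel (\<lambda>w. f (\<chi> r. z * w $ r)) \<longleftrightarrow> integrable lborel f)"
    if z: "cmod z = 1" "z \<noteq> -1" and f [measurable]: "f \<in> borel_measurable borel"
    for z and f :: "complex^'n \<Rightarrow> 'c"
  proof -
    have fz: "(\<lambda>w. f (\<chi> r. z * w $ r)) \<in> borel_measurable borel"
      using measurable_compose[OF cont f] by simp
    define R where "R = (\<lambda>(x, y). (Re z *\<^sub>R x - Im z *\<^sub>R y, Im z *\<^sub>R x + Re z *\<^sub>R (y :: real^'n)))"
    have 1: "(Re z)\<^sup>2 + (Im z)\<^sup>2 = 1" using z by (simp add: cmod_def)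
    have 2: "Re z \<noteq> -1"
    proof
      assume "Re z = -1"
      with 1 have "z = -1" by (simp add: complex_eq_iff)
      with z show False by simp
    qed
    have dR: "distr lborel borel R = lborel"
      unfolding R_def by (rule lborel_distr_rotation[OF 1 2])
    have R [measurable]: "R \<in> borel_measurable borel"
      by (auto simp: R_def case_prod_beta intro!: borel_measurable_continuous_onI continuous_intros)
    let ?P = "\<lambda>p. (\<chi> r. Complex (fst p $ r) (snd p $ r)) :: complex^'n"
    have [measurable]: "?P \<in> borel_measurable borel"
      using linear_cvec_of_pair
      by (intro borel_measurable_continuous_onI linear_continuous_on) (simp add: linear_linear)
    have PR: "?P (R p) = (\<chi> r. z * ?P p $ r)" for p
      by (auto simp: R_def vec_eq_iff complex_eq_iff case_prod_beta)
    have m: "(\<lambda>p. f (?P p)) \<in> borel_measurable borel" by measurable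
    have "(LINT w|lborel. f (\<chi> r. z * w $ r)) = (LINT p|lborel. f (?P (R p)))"
      using lborel_integral_cvec_of_pair(1)[OF fz] by (simp add: PR)
    also have "\<dots> = (LINT p|distr lborel borel R. f (?P p))"
      by (rule integral_distr[symmetric]) (use m in auto)
    also have "\<dots> = (LINT w|lborel. f w)"
      using lborel_integral_cvec_of_pair(1)[OF f] by (simp only: dR)
    finally have I: "(LINT w|lborel. f (\<chi> r. z * w $ r)) = (LINT w|lborel. f w)" .
    have "integrable lborel (\<lambda>w. f (\<chi> r. z * w $ r)) \<longleftrightarrow> integrable lborel (\<lambda>p. f (?P (R p)))"
      using lborel_integral_cvec_of_pair(2)[OF fz] by (simp add: PR)
    also have "\<dots> \<longleftrightarrow> integrable (distr lborel borel R) (\<lambda>p. f (?P p))"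
      by (rule integrable_distr_eq[symmetric]) (use m in auto)
    also have "\<dots> \<longleftrightarrow> integrable lborel f"
      using lborel_integral_cvec_of_pair(2)[OF f] by (simp only: dR)
    finally show ?thesis using I by blast
  qed
  have s: "cmod (csqrt \<zeta>) = 1" "csqrt \<zeta> \<noteq> -1" "csqrt \<zeta> * (csqrt \<zeta> * x) = \<zeta> * x" for x
  proof -
    show "cmod (csqrt \<zeta>) = 1" using \<zeta> by simp
    have "Re (csqrt \<zeta>) \<ge> 0" using csqrt_principal[of \<zeta>] by linarith
    then show "csqrt \<zeta> \<noteq> -1" by (metis Re_csqrt one_complex.simps(1) uminus_complex.simps(1) neg_0_le_iff_le not_one_le_zero)
    show "csqrt \<zeta> * (csqrt \<zeta> * x) = \<zeta> * x"
      using power2_csqrt[of \<zeta>] by (metis mult.assoc power2_eq_square)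
  qed
  have f2: "(\<lambda>w. f (\<chi> r. csqrt \<zeta> * w $ r)) \<in> borel_measurable borel"
    using measurable_compose[OF cont f] by simp
  show "(LINT w|lborel. f (\<chi> r. \<zeta> * w $ r)) = (LINT w|lborel. f w)"
    and "integrable lborel (\<lambda>w. f (\<chi> r. \<zeta> * w $ r)) \<longleftrightarrow> integrable lborel f"
    using main[OF s(1,2) f2] main[OF s(1,2) f] by (simp_all add: s)
qed

section \<open>Laguerre polynomials and their addition theorem\<close>

text \<open>The generalised Laguerre polynomial, with the parameter as first argument and the degree
  as second.\<close>

definition laguerre :: "nat \<Rightarrow> nat \<Rightarrow> real \<Rightarrow> real" where
  "laguerre a N x = (\<Sum>p\<le>N. real ((N + a) choose (N - p)) * (- x) ^ p / fact p)"

text \<open>The series (1 - X)^(-a) exp (-x X/(1 - X)), which for a > 0 generates the polynomials of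
  parameter a - 1. Shifting the parameter by one makes it multiplicative in the pair (a, x).\<close>

definition laguerre_fps :: "nat \<Rightarrow> real \<Rightarrow> real fps" where
  "laguerre_fps a x = inverse (1 - fps_X) ^ a * fps_compose (fps_exp (- x)) (fps_X * inverse (1 - fps_X))"

lemma fps_nth_geometric_power: "fps_nth (inverse (1 - fps_X :: real fps) ^ Suc a) k = real ((a + k) choose k)"
  using one_minus_const_fps_X_neg_power'[of "Suc a" "1 :: real"] by (simp add: fps_inverse_power del: power_Suc)

text \<open>With g = X/(1 - X), the product (1 - X)^(-a-1) g^i is X^i (1 - X)^(-a-1-i), and its
  coefficient at \<open>N\<close> is the binomial coefficient in the term of degree i.\<close>

lemma fps_nth_laguerre_fps: "fps_nth (laguerre_fps (Suc a) x) N = laguerre a N x"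
proof -
  define H :: "real fps" where "H = inverse (1 - fps_X)"
  define g where "g = fps_X * H"
  have g0: "fps_nth g 0 = 0" by (simp add: g_def)
  define A where "A = H ^ Suc a"
  define e where "e = fps_exp (- x)"
  \<comment> \<open>Since g^i starts at X^i, the coefficients up to order \<open>N\<close> may all
    be summed over the same range of i, and the two sums exchanged.\<close>
  have c: "fps_nth (fps_compose e g) j = (\<Sum>i=0..N. fps_nth e i * fps_nth (g ^ i) j)" if "j \<le> N" for j
    unfolding fps_compose_nth
    by (rule sum.mono_neutral_left) (use that startsby_zero_power_prefix[OF g0] in auto)
  have A: "fps_nth (A * g ^ i) N = real ((N + a) choose (N - i))" if "i \<le> N" for i
  proof -
    have "A * g ^ i = fps_X ^ i * H ^ Suc (a + i)"
      by (simp add: A_def g_def power_mult_distrib power_add mult_ac)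
    then show ?thesis
      using that fps_nth_geometric_power[of "a + i" "N - i"]
      by (simp add: fps_X_power_mult_nth H_def del: power_Suc) (simp add: add.commute)
  qed
  have "fps_nth (A * fps_compose e g) N = (\<Sum>j=0..N. fps_nth A j * (\<Sum>i=0..N. fps_nth e i * fps_nth (g ^ i) (N - j)))"
    unfolding fps_mult_nth by (intro sum.cong) (auto simp: c)
  also have "\<dots> = (\<Sum>i=0..N. fps_nth e i * (\<Sum>j=0..N. fps_nth A j * fps_nth (g ^ i) (N - j)))"
    unfolding sum_distrib_left by (subst sum.swap) (simp add: mult_ac)
  also have "\<dots> = (\<Sum>i=0..N. fps_nth e i * fps_nth (A * g ^ i) N)"
    by (simp add: fps_mult_nth)
  also have "\<dots> = laguerre a N x"
    unfolding laguerre_def atLeast0AtMost by (intro sum.cong) (auto simp: A e_def)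
  finally show ?thesis by (simp only: laguerre_fps_def A_def e_def g_def H_def)
qed

lemma laguerre_fps_add: "laguerre_fps a x * laguerre_fps b y = laguerre_fps (a + b) (x + y)"
proof -
  have "fps_nth (fps_X * inverse (1 - fps_X :: real fps)) 0 = 0" by simp
  from fps_compose_mult_distrib[OF this, of "fps_exp (- x)" "fps_exp (- y)"]
  show ?thesis
    by (simp add: laguerre_fps_def power_add mult_ac fps_exp_add_mult[symmetric])
qed

lemma laguerre_fps_0: "laguerre_fps 0 0 = 1" "laguerre_fps 1 0 = inverse (1 - fps_X)"
  by (simp_all add: laguerre_fps_def)

lemma prod_laguerre_fps:
  "finite S \<Longrightarrow> (\<Prod>r\<in>S. laguerre_fps 1 (t r)) = laguerre_fps (card S) (\<Sum>r\<in>S. t r)"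
  by (induction S rule: finite_induct) (simp_all add: laguerre_fps_0 laguerre_fps_add)

text \<open>Functions vanishing off \<open>S\<close> stand for multi-indices on \<open>S\<close>;
  this keeps the set finite and allows induction on \<open>S\<close>. For \<open>S = UNIV\<close>
  and \<open>N = m - 1\<close> it corresponds to \<open>J m\<close>.\<close>

definition bounded_indices :: "'i set \<Rightarrow> nat \<Rightarrow> ('i \<Rightarrow> nat) set" where
  "bounded_indices S N = {k. (\<forall>r. r \<notin> S \<longrightarrow> k r = 0) \<and> sum k S \<le> N}"

lemma bounded_indices_insert:
  assumes "finite S" "s \<notin> S"
  shows "bij_betw (\<lambda>(i, k). k(s := i)) (SIGMA i:{..N}. bounded_indices S (N - i)) (bounded_indices (insert s S) N)"
proof (rule bij_betw_byWitness[where f' = "\<lambda>k. (k s, k(s := 0))"])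
  have *: "sum (k(s := i)) S = sum k S" for k :: "'a \<Rightarrow> nat" and i
    using assms(2) by (intro sum.cong) auto
  show "(\<lambda>(i, k). k(s := i)) ` (SIGMA i:{..N}. bounded_indices S (N - i)) \<subseteq> bounded_indices (insert s S) N"
    using assms * by (auto simp: bounded_indices_def)
  show "(\<lambda>k. (k s, k(s := 0))) ` bounded_indices (insert s S) N \<subseteq> (SIGMA i:{..N}. bounded_indices S (N - i))"
    using assms * by (auto simp: bounded_indices_def)
  show "\<forall>a\<in>SIGMA i:{..N}. bounded_indices S (N - i). (\<lambda>k. (k s, k(s := 0))) ((\<lambda>(i, k). k(s := i)) a) = a"
    using assms(2) by (auto simp: bounded_indices_def fun_eq_iff)
qed auto

lemma finite_bounded_indices: "finite S \<Longrightarrow> finite (bounded_indices S N)"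
proof (induction S arbitrary: N rule: finite_induct)
  case empty
  have "bounded_indices {} N = {\<lambda>_::'a. 0}" by (auto simp: bounded_indices_def)
  then show ?case by simp
next
  case (insert s S)
  then show ?case using bij_betw_finite[OF bounded_indices_insert[OF insert.hyps, of N]] by auto
qed

text \<open>Multiplying by 1/(1 - X) takes partial sums of coefficients, so multi-indices of total
  at most \<open>N\<close> appear instead of exactly \<open>N\<close>.\<close>

lemma fps_nth_prod_bounded_indices:
  fixes F :: "'i \<Rightarrow> real fps"
  assumes "finite S"
  shows "fps_nth (inverse (1 - fps_X) * (\<Prod>r\<in>S. F r)) N
    = (\<Sum>k\<in>bounded_indices S N. \<Prod>r\<in>S. fps_nth (F r) (k r))"
  using assms
proof (induction S arbitrary: N rule: finite_induct)
  case empty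
  have "bounded_indices {} N = {\<lambda>_::'i. 0}" by (auto simp: bounded_indices_def)
  then show ?case using fps_nth_geometric_power[of 0 N] by simp
next
  case (insert s S)
  have p: "(\<Prod>r\<in>S. fps_nth (F r) ((k(s := i)) r)) = (\<Prod>r\<in>S. fps_nth (F r) (k r))" for k i
    using insert.hyps by (intro prod.cong) auto
  have "fps_nth (inverse (1 - fps_X) * (\<Prod>r\<in>insert s S. F r)) N
      = fps_nth (F s * (inverse (1 - fps_X) * (\<Prod>r\<in>S. F r))) N"
    using insert.hyps by (simp add: mult_ac)
  also have "\<dots> = (\<Sum>i\<le>N. \<Sum>k\<in>bounded_indices S (N - i). fps_nth (F s) i * (\<Prod>r\<in>S. fps_nth (F r) (k r)))"
    unfolding fps_mult_nth[of "F s"] atLeast0AtMost by (simp add: insert.IH sum_distrib_left)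
  also have "\<dots> = (\<Sum>x\<in>(SIGMA i:{..N}. bounded_indices S (N - i)).
      \<Prod>r\<in>insert s S. fps_nth (F r) ((case x of (i, k) \<Rightarrow> k(s := i)) r))"
    using insert.hyps finite_bounded_indices p by (subst sum.Sigma) (auto simp: case_prod_beta)
  also have "\<dots> = (\<Sum>k\<in>bounded_indices (insert s S) N. \<Prod>r\<in>insert s S. fps_nth (F r) (k r))"
    by (rule sum.reindex_bij_betw[OF bounded_indices_insert[OF insert.hyps]])
  finally show ?case .
qed

text \<open>The n factors of parameter 0 multiply to a series with exponent n, generating parameter
  n - 1. The additional 1/(1 - X) raises the parameter to n and turns |k| = m - 1 into |k| \<le> m -
  1.\<close>

lemma laguerre_addition:
  "laguerre CARD('n) (m - 1) (\<Sum>r\<in>UNIV. t r) = (\<Sum>k\<in>(J m :: (nat ^ 'n) set). \<Prod>r\<in>UNIV. laguerre 0 (k $ r) (t r))"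
proof -
  have "laguerre CARD('n) (m - 1) (\<Sum>r\<in>UNIV. t r)
      = fps_nth (inverse (1 - fps_X) * (\<Prod>r\<in>UNIV. laguerre_fps 1 (t r))) (m - 1)"
    by (simp only: prod_laguerre_fps[OF finite] laguerre_fps_0(2)[symmetric] laguerre_fps_add)
      (simp add: fps_nth_laguerre_fps)
  also have "\<dots> = (\<Sum>k\<in>bounded_indices UNIV (m - 1). \<Prod>r\<in>UNIV. laguerre 0 (k r) (t r))"
    by (subst fps_nth_prod_bounded_indices) (simp_all add: fps_nth_laguerre_fps)
  also have "\<dots> = (\<Sum>k\<in>(J m :: (nat ^ 'n) set). \<Prod>r\<in>UNIV. laguerre 0 (k $ r) (t r))"
    by (rule sum.reindex_bij_witness[where i = vec_nth and j = vec_lambda])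
      (auto simp: bounded_indices_def J_def mi_size_def)
  finally show ?thesis .
qed

section \<open>The reproducing property at the origin\<close>

lemma gaussian_1d:
  "integrable lborel (\<lambda>t::real. exp (- t\<^sup>2))" "(LINT t|lborel. exp (- (t::real)\<^sup>2)) = sqrt pi"
proof -
  have e: "exp (- t\<^sup>2) = sqrt pi * normal_density 0 (1 / sqrt 2) t" for t :: real
    by (simp add: normal_density_def power_divide real_sqrt_mult)
  show "integrable lborel (\<lambda>t::real. exp (- t\<^sup>2))"
    unfolding e by (intro integrable_mult_right integrable_normal_density) simp
  show "(LINT t|lborel. exp (- (t::real)\<^sup>2)) = sqrt pi"
    unfolding e by simp
qed

lemma gaussian_euclidean:
  "integrable lborel (\<lambda>x::'a::euclidean_space. exp (- (norm x)\<^sup>2))"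
  "(LINT x|lborel. exp (- (norm (x::'a::euclidean_space))\<^sup>2)) = sqrt pi ^ DIM('a)"
proof -
  have e: "(\<Prod>b\<in>Basis. complex_of_real (exp (- (x \<bullet> b)\<^sup>2))) = of_real (exp (- (norm x)\<^sup>2))" for x :: 'a
    by (simp add: norm_eq_sqrt_inner euclidean_inner[of x x] sum_nonneg exp_sum[symmetric]
      sum_negf power2_eq_square flip: of_real_prod)
  have i: "integrable lborel (\<lambda>t. complex_of_real (exp (- t\<^sup>2)))"
    by (intro integrable_of_real gaussian_1d)
  show "integrable lborel (\<lambda>x::'a. exp (- (norm x)\<^sup>2))"
    using lborel_integral_prod_Basis(1)[of "\<lambda>_::'a. \<lambda>t. complex_of_real (exp (- t\<^sup>2))", OF i]
    unfolding e complex_of_real_integrable_eq .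
  have "complex_of_real (LINT x|lborel. exp (- (norm (x::'a))\<^sup>2)) = of_real (sqrt pi ^ DIM('a))"
    using lborel_integral_prod_Basis(2)[of "\<lambda>_::'a. \<lambda>t. complex_of_real (exp (- t\<^sup>2))", OF i]
    unfolding e integral_complex_of_real gaussian_1d by simp
  then show "(LINT x|lborel. exp (- (norm (x::'a))\<^sup>2)) = sqrt pi ^ DIM('a)"
    unfolding of_real_eq_iff .
qed

lemma power_times_exp_minus_bounded: "\<exists>C. \<forall>x\<ge>0. x ^ p * exp (- x) \<le> (C::real)"
proof -
  have "x ^ p * exp (- x) \<le> fact p" if "x \<ge> 0" for x :: real
  proof -
    have s: "summable (\<lambda>n. x ^ n /\<^sub>R fact n)" by (rule summable_exp_generic)
    have "(\<Sum>n\<in>{p}. x ^ n /\<^sub>R fact n) \<le> exp x"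
      unfolding exp_def by (rule sum_le_suminf[OF s]) (use that in auto)
    then have "x ^ p \<le> fact p * exp x" by (simp add: field_simps)
    then show ?thesis by (simp add: exp_minus field_simps)
  qed
  then show ?thesis by blast
qed

lemma gaussian_moments:
  "integrable lborel (\<lambda>x::'a::euclidean_space. norm x ^ p * exp (- (norm x)\<^sup>2))"
proof -
  obtain C where C: "\<And>x::real. x \<ge> 0 \<Longrightarrow> x ^ p * exp (- x) \<le> C"
    using power_times_exp_minus_bounded by blast
  have b: "norm x ^ p * exp (- (norm x)\<^sup>2) \<le> C * exp 1 * exp (- (norm ((1/2) *\<^sub>R x))\<^sup>2)" for x :: 'a
  proof -
    \<comment> \<open>This amounts to r^2 \<ge> (r - 1) + (r/2)^2 with r the norm: the linear part
      absorbs the power r^p, and an integrable Gaussian remains.\<close>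
    have "0 \<le> (norm x / 2 - 1)\<^sup>2 + (norm x)\<^sup>2 / 2" by simp
    then have q: "- (norm x)\<^sup>2 \<le> - norm x + 1 - (norm x / 2)\<^sup>2"
      by (simp add: power2_eq_square algebra_simps)
    have "norm x ^ p * exp (- (norm x)\<^sup>2) \<le> norm x ^ p * exp (- norm x + 1 - (norm x / 2)\<^sup>2)"
      using q by (intro mult_left_mono) auto
    also have "\<dots> = (norm x ^ p * exp (- norm x)) * (exp 1 * exp (- (norm x / 2)\<^sup>2))"
      by (simp add: mult.assoc flip: exp_add)
    also have "\<dots> \<le> C * (exp 1 * exp (- (norm x / 2)\<^sup>2))"
      by (intro mult_right_mono C) auto
    finally show ?thesis by (simp add: mult.assoc)
  qed
  have "integrable lborel (\<lambda>x::'a. exp (- (norm ((1/2) *\<^sub>R x))\<^sup>2))"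
    using lborel_integral_affine(2)[of "\<lambda>x::'a. exp (- (norm x)\<^sup>2)" "1/2" 0] gaussian_euclidean(1)
    by simp
  then have "integrable lborel (\<lambda>x::'a. C * exp 1 * exp (- (norm ((1/2) *\<^sub>R x))\<^sup>2))"
    by (rule integrable_mult_right)
  then show ?thesis
    by (rule Bochner_Integration.integrable_bound) (use b in \<open>auto simp: abs_of_nonneg intro!: AE_I2 order.trans[OF b]\<close>)
qed

section \<open>Gaussian moments of homogeneous functions\<close>

text \<open>Even powers suffice, as the Laguerre weight is a polynomial in |w|^2. Measurability is
  included because it has to be carried over to components obtained by pointwise choice.\<close>

definition has_moments :: "(complex^'n \<Rightarrow> complex) \<Rightarrow> bool" where
  "has_moments c \<longleftrightarrow> c \<in> borel_measurable borel \<and>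
     (\<forall>p. integrable lborel (\<lambda>w. c w * of_real (norm w ^ (2 * p) * exp (- (norm w)\<^sup>2))))"

definition moment :: "nat \<Rightarrow> (complex^'n \<Rightarrow> complex) \<Rightarrow> complex" where
  "moment p c = (LINT w|lborel. c w * of_real (norm w ^ (2 * p) * exp (- (norm w)\<^sup>2)))"

text \<open>Integrability comes from |F| r^(2p) \<le> |F|^2 + r^(4p), where both terms on the right
  are integrable against the Gaussian.\<close>

lemma has_moments_square_integrable:
  fixes F :: "complex^'n \<Rightarrow> complex"
  assumes F [measurable]: "F \<in> borel_measurable borel"
    and int: "integrable lborel (\<lambda>w. (cmod (F w))\<^sup>2 * exp (- (norm w)\<^sup>2))"
  shows "has_moments F"
  unfolding has_moments_def
proof (intro conjI allI F)
  fix p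
  have "integrable lborel (\<lambda>w. (cmod (F w))\<^sup>2 * exp (- (norm w)\<^sup>2) + norm w ^ (4 * p) * exp (- (norm w)\<^sup>2))"
    by (intro Bochner_Integration.integrable_add int gaussian_moments)
  then show "integrable lborel (\<lambda>w. F w * of_real (norm w ^ (2 * p) * exp (- (norm w)\<^sup>2)))"
  proof (rule Bochner_Integration.integrable_bound)
    show "AE w in lborel. norm (F w * of_real (norm w ^ (2 * p) * exp (- (norm w)\<^sup>2)))
        \<le> norm ((cmod (F w))\<^sup>2 * exp (- (norm w)\<^sup>2) + norm w ^ (4 * p) * exp (- (norm w)\<^sup>2))"
    proof (rule AE_I2)
      fix w :: "complex^'n"
      have "0 \<le> (cmod (F w) - norm w ^ (2 * p))\<^sup>2 + ((cmod (F w))\<^sup>2 + (norm w ^ (2 * p))\<^sup>2)" by simp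
      then have "cmod (F w) * norm w ^ (2 * p) \<le> (cmod (F w))\<^sup>2 + norm w ^ (4 * p)"
        by (simp add: power2_eq_square algebra_simps flip: power_add)
      then have "cmod (F w) * norm w ^ (2 * p) * exp (- (norm w)\<^sup>2)
          \<le> ((cmod (F w))\<^sup>2 + norm w ^ (4 * p)) * exp (- (norm w)\<^sup>2)"
        by (rule mult_right_mono) simp
      then show "norm (F w * of_real (norm w ^ (2 * p) * exp (- (norm w)\<^sup>2)))
        \<le> norm ((cmod (F w))\<^sup>2 * exp (- (norm w)\<^sup>2) + norm w ^ (4 * p) * exp (- (norm w)\<^sup>2))"
        by (simp add: norm_mult algebra_simps norm_power abs_of_nonneg)
    qed
  qed measurable
qed

text \<open>This limit and the next are the difference quotients at \<epsilon> = 0 for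
  \<open>moment_Suc_homogeneous\<close>, taken along \<epsilon> = 1/(i + 1) because dominated
  convergence is applied to a sequence.\<close>

lemma lim_exp_quotient: "(\<lambda>i. (1 - exp (- (x / real (Suc i)))) * real (Suc i)) \<longlonglongrightarrow> x"
proof (cases "x = 0")
  case False
  have "((\<lambda>t. (exp t - 1) / t) \<longlongrightarrow> (1::real)) (at 0)" by real_asymp
  moreover have "filterlim (\<lambda>i. - (x / real (Suc i))) (at 0) sequentially"
  proof (rule filterlim_atI)
    show "(\<lambda>i. - (x / real (Suc i))) \<longlonglongrightarrow> 0"
      using tendsto_minus[OF LIMSEQ_Suc[OF lim_const_over_n[of x]]] by simp
    show "\<forall>\<^sub>F i in sequentially. - (x / real (Suc i)) \<noteq> 0" using False by simp
  qed
  ultimately have "(\<lambda>i. (exp (- (x / real (Suc i))) - 1) / (- (x / real (Suc i)))) \<longlonglongrightarrow> 1"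
    by (rule filterlim_compose)
  then have "(\<lambda>i. x * ((exp (- (x / real (Suc i))) - 1) / (- (x / real (Suc i))))) \<longlonglongrightarrow> x * 1"
    by (rule tendsto_mult_left)
  then show ?thesis using False
    by (rule_tac Lim_transform_eventually[rotated]) (auto simp: field_simps)
qed simp

lemma lim_power_quotient: "(\<lambda>i. (1 - 1 / (1 + 1 / real (Suc i)) ^ K) * real (Suc i)) \<longlonglongrightarrow> real K"
proof -
  have "((\<lambda>t. 1 / (1 + t) ^ K) has_real_derivative - real K) (at 0)"
    by (rule derivative_eq_intros refl | simp)+
  then have "((\<lambda>t. (1 / (1 + t) ^ K - 1) / t) \<longlongrightarrow> - real K) (at 0)"
    by (simp add: has_field_derivative_iff)
  moreover have "filterlim (\<lambda>i. 1 / real (Suc i)) (at 0) sequentially"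
  proof (rule filterlim_atI)
    show "(\<lambda>i. 1 / real (Suc i)) \<longlonglongrightarrow> 0" by (rule LIMSEQ_Suc[OF lim_1_over_n])
  qed simp
  ultimately have "(\<lambda>i. (1 / (1 + 1 / real (Suc i)) ^ K - 1) / (1 / real (Suc i))) \<longlonglongrightarrow> - real K"
    by (rule filterlim_compose)
  from tendsto_minus[OF this] show ?thesis
    by (rule_tac Lim_transform_eventually) (auto simp: field_simps)
qed

text \<open>Euler's relation for a homogeneous integrand, from scaling: replacing the Gaussian
  \<open>exp (- |w|\<^sup>2)\<close> by \<open>exp (- (1 + \<epsilon>) |w|\<^sup>2)\<close> multiplies the moment by
  \<open>(1 + \<epsilon>)\<^sup>-\<^sup>K\<close> with \<open>K = n + k + p\<close>; differentiate at \<open>\<epsilon> = 0\<close>.\<close>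

lemma moment_Suc_homogeneous:
  fixes c :: "complex^'n \<Rightarrow> complex"
  assumes c: "has_moments c" and hom: "\<And>s w. s > 0 \<Longrightarrow> c (s *\<^sub>R w) = of_real (s ^ (2 * k)) * c w"
  shows "moment (Suc p) c = of_nat (CARD('n) + k + p) * moment p c"
proof -
  define K where "K = CARD('n) + k + p"
  define f where "f w = c w * of_real (norm w ^ (2 * p) * exp (- (norm w)\<^sup>2))" for w
  have [measurable]: "c \<in> borel_measurable borel" and mom: "\<And>p. integrable lborel (\<lambda>w. c w * of_real (norm w ^ (2 * p) * exp (- (norm w)\<^sup>2)))"
    using c by (auto simp: has_moments_def)
  have f [measurable]: "f \<in> borel_measurable borel" unfolding f_def by measurable
  have fi: "integrable lborel f" using mom[of p] by (simp add: f_def[abs_def])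
  define e where "e i = 1 / real (Suc i)" for i
  have e: "e i > 0" for i by (simp add: e_def)
  define g where "g i w = c w * of_real (norm w ^ (2 * p) * exp (- ((1 + e i) * (norm w)\<^sup>2)))" for i w
  have g [measurable]: "g i \<in> borel_measurable borel" for i unfolding g_def by measurable
  have fg: "f (sqrt (1 + e i) *\<^sub>R w) = of_real ((1 + e i) ^ (k + p)) * g i w" for i w
  proof -
    have "sqrt (1 + e i) > 0" using e[of i] by simp
    then have "f (sqrt (1 + e i) *\<^sub>R w) = of_real (sqrt (1 + e i) ^ (2 * k)) * c w *
        of_real (sqrt (1 + e i) ^ (2 * p) * norm w ^ (2 * p) * exp (- (sqrt (1 + e i))\<^sup>2 * (norm w)\<^sup>2))"
      unfolding f_def by (simp add: hom power_mult_distrib abs_of_pos) (simp add: algebra_simps)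
    moreover have "(- 1 - e i) * (norm w)\<^sup>2 = - ((1 + e i) * (norm w)\<^sup>2)"
      by (simp add: algebra_simps)
    ultimately show ?thesis using e[of i] by (simp add: g_def power_add power_mult)
  qed
  have nz: "(1 + e i) ^ j \<noteq> 0" for i j using e[of i] by simp
  have inv: "of_real (1 / (1 + e i) ^ j) * (of_real ((1 + e i) ^ j) * x) = (x :: complex)" for i j x
    unfolding mult.assoc[symmetric] of_real_mult[symmetric]
      nonzero_eq_divide_eq[OF nz, THEN iffD1, OF refl] by simp
  have gi: "integrable lborel (g i)" for i
  proof -
    have "integrable lborel (\<lambda>w. f (0 + sqrt (1 + e i) *\<^sub>R w))"
      using e[of i] fi by (subst lborel_integral_affine(2)) auto
    then have "integrable lborel (\<lambda>w. of_real (1 / (1 + e i) ^ (k + p)) * (of_real ((1 + e i) ^ (k + p)) * g i w))"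
      unfolding add_0 fg by (rule integrable_mult_right)
    then show ?thesis unfolding inv .
  qed
  have Ig: "(LINT w|lborel. g i w) = of_real (1 / (1 + e i) ^ K) * moment p c" for i
  proof -
    have "of_real ((1 + e i) ^ (k + p)) * (LINT w|lborel. g i w) = (LINT w|lborel. f (0 + sqrt (1 + e i) *\<^sub>R w))"
      by (simp add: fg)
    \<comment> \<open>The real dimension is 2n, so dilation by sqrt (1 + \<epsilon>) contributes (1
      + \<epsilon>)^(-n); with the factor (1 + \<epsilon>)^(k + p) of the integrand this gives the
      exponent \<open>K\<close>.\<close>
    also have "\<dots> = (1 / sqrt (1 + e i) ^ (2 * CARD('n))) *\<^sub>R (LINT w|lborel. f w)"
      using e[of i] by (subst lborel_integral_affine(1)) auto
    also have "\<dots> = of_real (1 / (1 + e i) ^ CARD('n)) * moment p c"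
      using e[of i] by (simp add: power_mult moment_def f_def[abs_def] scaleR_conv_of_real)
    finally have *: "of_real ((1 + e i) ^ (k + p)) * (LINT w|lborel. g i w) = of_real (1 / (1 + e i) ^ CARD('n)) * moment p c" .
    have "(LINT w|lborel. g i w) = of_real (1 / (1 + e i) ^ (k + p)) * (of_real ((1 + e i) ^ (k + p)) * (LINT w|lborel. g i w))"
      unfolding inv ..
    also have "\<dots> = of_real (1 / (1 + e i) ^ K) * moment p c"
      unfolding * K_def mult.assoc[symmetric] of_real_mult[symmetric] by (simp add: power_add)
    finally show ?thesis .
  qed
  have "(\<lambda>i. LINT w|lborel. (f w - g i w) * of_real (real (Suc i)))
      \<longlonglongrightarrow> (LINT w|lborel. c w * of_real (norm w ^ (2 * Suc p) * exp (- (norm w)\<^sup>2)))"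
  proof (rule integral_dominated_convergence)
    show "integrable lborel (\<lambda>w. norm (c w * of_real (norm w ^ (2 * Suc p) * exp (- (norm w)\<^sup>2))))"
      by (intro integrable_norm mom)
    have d: "(f w - g i w) * of_real (real (Suc i)) = c w * of_real (norm w ^ (2 * p) * exp (- (norm w)\<^sup>2)) *
        of_real ((1 - exp (- ((norm w)\<^sup>2 / real (Suc i)))) * real (Suc i))" for i w
    proof -
      have "- ((1 + e i) * (norm w)\<^sup>2) = - (norm w)\<^sup>2 + - ((norm w)\<^sup>2 / real (Suc i))"
        by (simp add: e_def field_simps)
      then show ?thesis unfolding f_def g_def
        by (simp only: exp_add of_real_mult of_real_diff of_real_1) (simp add: algebra_simps)
    qed
    have pp: "norm w ^ (2 * Suc p) = norm w ^ (2 * p) * (norm w)\<^sup>2" for w :: "complex^'n"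
      by (simp add: power_add[symmetric])
    show "AE w in lborel. (\<lambda>i. (f w - g i w) * of_real (real (Suc i)))
        \<longlonglongrightarrow> c w * of_real (norm w ^ (2 * Suc p) * exp (- (norm w)\<^sup>2))"
    proof (rule AE_I2)
      fix w :: "complex^'n"
      have "(\<lambda>i. c w * of_real (norm w ^ (2 * p) * exp (- (norm w)\<^sup>2)) *
        of_real ((1 - exp (- ((norm w)\<^sup>2 / real (Suc i)))) * real (Suc i)))
        \<longlonglongrightarrow> c w * of_real (norm w ^ (2 * p) * exp (- (norm w)\<^sup>2)) * of_real ((norm w)\<^sup>2)"
        by (intro tendsto_mult_left tendsto_of_real lim_exp_quotient)
      then show "(\<lambda>i. (f w - g i w) * of_real (real (Suc i)))
        \<longlonglongrightarrow> c w * of_real (norm w ^ (2 * Suc p) * exp (- (norm w)\<^sup>2))"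
        unfolding d pp by (simp add: mult_ac)
    qed
    show "AE w in lborel. norm ((f w - g i w) * of_real (real (Suc i)))
        \<le> norm (c w * of_real (norm w ^ (2 * Suc p) * exp (- (norm w)\<^sup>2)))" for i
    proof (rule AE_I2)
      fix w :: "complex^'n"
      define x where "x = (norm w)\<^sup>2 / real (Suc i)"
      have x: "x \<ge> 0" by (simp add: x_def)
      \<comment> \<open>By 1 - exp (-x) \<le> x the difference quotient is bounded, uniformly in i,
        by the integrand of the next moment.\<close>
      have "(1 - exp (- x)) * real (Suc i) \<le> x * real (Suc i)"
        using exp_ge_add_one_self[of "- x"] by (intro mult_right_mono) auto
      also have "\<dots> = (norm w)\<^sup>2" by (simp add: x_def)
      finally have "\<bar>(1 - exp (- x)) * real (Suc i)\<bar> \<le> (norm w)\<^sup>2"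
        using x by (subst abs_of_nonneg) auto
      then have "norm (c w * of_real (norm w ^ (2 * p) * exp (- (norm w)\<^sup>2))) * \<bar>(1 - exp (- x)) * real (Suc i)\<bar>
         \<le> norm (c w * of_real (norm w ^ (2 * p) * exp (- (norm w)\<^sup>2))) * (norm w)\<^sup>2"
        by (rule mult_left_mono) simp
      then show "norm ((f w - g i w) * of_real (real (Suc i)))
        \<le> norm (c w * of_real (norm w ^ (2 * Suc p) * exp (- (norm w)\<^sup>2)))"
        unfolding d pp x_def[symmetric] norm_mult[of "_ * _" "of_real ((1 - _) * _)"] norm_of_real
        by (simp add: norm_mult norm_power mult_ac)
    qed
  qed measurable
  moreover have "(LINT w|lborel. (f w - g i w) * of_real (real (Suc i)))
      = of_real ((1 - 1 / (1 + 1 / real (Suc i)) ^ K) * real (Suc i)) * moment p c" for i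
  proof -
    have "(LINT w|lborel. (f w - g i w) * of_real (real (Suc i)))
        = ((LINT w|lborel. f w) - (LINT w|lborel. g i w)) * of_real (real (Suc i))"
      by (subst Bochner_Integration.integral_diff[OF fi gi, symmetric]) (rule integral_mult_left_zero)
    then show ?thesis unfolding Ig
      by (simp add: e_def moment_def f_def[abs_def] algebra_simps)
  qed
  moreover have "(\<lambda>i. of_real ((1 - 1 / (1 + 1 / real (Suc i)) ^ K) * real (Suc i)) * moment p c)
      \<longlonglongrightarrow> of_real (real K) * moment p c"
    by (intro tendsto_mult_right tendsto_of_real lim_power_quotient)
  ultimately have "(LINT w|lborel. c w * of_real (norm w ^ (2 * Suc p) * exp (- (norm w)\<^sup>2))) = of_real (real K) * moment p c"
    by (simp only: LIMSEQ_unique)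
  then show ?thesis by (simp add: moment_def K_def)
qed

lemma norm_vector_scalar_mult: "norm (z *s (w :: complex^'n)) = cmod z * norm w"
  by (simp add: norm_vec_def L2_set_def norm_mult power_mult_distrib real_sqrt_mult flip: sum_distrib_left)

section \<open>Averages over the circle action\<close>

definition circle_mean :: "(complex^'n \<Rightarrow> complex) \<Rightarrow> complex^'n \<Rightarrow> complex" where
  "circle_mean F w = (LINT t:{0..1}|lborel. F (cis (2 * pi * t) *s w))"

text \<open>Fubini over [0, 1] x C^n: every rotate of \<open>F\<close> has the same moments and the
  same absolute integral against the weight, so the double integral converges absolutely.\<close>

lemma circle_mean_moments:
  fixes F :: "complex^'n \<Rightarrow> complex"
  assumes cont: "continuous_on UNIV F" and F: "has_moments F"
  shows "has_moments (circle_mean F)" and "moment p (circle_mean F) = moment p F"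
proof -
  define g where "g p w = complex_of_real (norm w ^ (2 * p) * exp (- (norm w)\<^sup>2))" for p and w :: "complex^'n"
  have Fm [measurable]: "F \<in> borel_measurable borel" using F by (simp add: has_moments_def)
  have g_rot: "g p (cis t *s w) = g p w" for p t w
    by (simp add: g_def norm_vector_scalar_mult)
  have gm [measurable]: "g p \<in> borel_measurable borel" for p unfolding g_def by measurable
  define H where "H p t w = indicator {0..1::real} t *\<^sub>R (F (cis (2 * pi * t) *s w) * g p w)" for p t w
  have ct: "(\<lambda>x::real \<times> (complex^'n). F (cis (2 * pi * fst x) *s snd x)) \<in> borel_measurable borel"
  proof (intro borel_measurable_continuous_onI continuous_on_compose2[OF cont])
    show "continuous_on UNIV (\<lambda>x::real \<times> (complex^'n). cis (2 * pi * fst x) *s snd x)"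
      unfolding vector_scalar_mult_def by (intro continuous_intros)
  qed auto
  have Hm: "case_prod (H p) \<in> borel_measurable (lborel \<Otimes>\<^sub>M lborel)" for p
  proof -
    have [measurable]: "(\<lambda>x::real \<times> (complex^'n). F (cis (2 * pi * fst x) *s snd x)) \<in> borel_measurable (borel \<Otimes>\<^sub>M borel)"
      using ct by (simp add: borel_prod)
    show ?thesis unfolding H_def case_prod_beta by measurable
  qed
  have Fg: "integrable lborel (\<lambda>w. F w * g p w)" for p
    using F by (simp add: has_moments_def g_def)
  have rot: "integrable lborel (\<lambda>w. F (cis t *s w) * g p w)"
    "(LINT w|lborel. F (cis t *s w) * g p w) = moment p F"
    "(LINT w|lborel. norm (F (cis t *s w) * g p w)) = (LINT w|lborel. norm (F w * g p w))" for t p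
  proof -
    have m: "(\<lambda>w. F w * g p w) \<in> borel_measurable borel" by measurable
    have m2: "(\<lambda>w. norm (F w * g p w)) \<in> borel_measurable borel" by measurable
    note 1 = lborel_integral_rotation[OF m norm_cis, of t, folded vector_scalar_mult_def, unfolded g_rot]
    note 2 = lborel_integral_rotation[OF m2 norm_cis, of t, folded vector_scalar_mult_def, unfolded g_rot]
    show "integrable lborel (\<lambda>w. F (cis t *s w) * g p w)" using 1(2) Fg by blast
    show "(LINT w|lborel. F (cis t *s w) * g p w) = moment p F"
      using 1(1) by (simp add: moment_def g_def)
    show "(LINT w|lborel. norm (F (cis t *s w) * g p w)) = (LINT w|lborel. norm (F w * g p w))"
      by (rule 2(1))
  qed
  have Hint: "integrable (lborel \<Otimes>\<^sub>M lborel) (case_prod (H p))" for p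
  proof (rule lborel_pair.Fubini_integrable[OF Hm])
    have "(\<lambda>t. LINT w|lborel. norm (case_prod (H p) (t, w)))
        = (\<lambda>t. indicator {0..1} t *\<^sub>R (LINT w|lborel. norm (F w * g p w)))"
      by (simp add: H_def rot(3)[unfolded norm_mult] norm_mult)
    then show "integrable lborel (\<lambda>t. LINT w|lborel. norm (case_prod (H p) (t, w)))" by simp
    show "AE t in lborel. integrable lborel (\<lambda>w. case_prod (H p) (t, w))"
      unfolding H_def by (simp add: rot(1))
  qed
  have snd: "(LINT t|lborel. H p t w) = circle_mean F w * g p w" for p w
    unfolding H_def circle_mean_def set_lebesgue_integral_def
    by (subst integral_mult_left_zero[symmetric]) simp
  have int: "integrable lborel (\<lambda>w. circle_mean F w * g p w)" for p
    using lborel_pair.integrable_snd[OF Hint[of p]] by (simp add: snd)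
  \<comment> \<open>Fubini yields measurability of the mean times the Gaussian; the Gaussian
    vanishes nowhere and is divided out.\<close>
  have "circle_mean F \<in> borel_measurable borel"
  proof -
    have "(\<lambda>w. circle_mean F w * g 0 w * inverse (g 0 w)) \<in> borel_measurable borel"
      using borel_measurable_integrable[OF int[of 0]] by simp
    moreover have "g 0 w \<noteq> 0" for w by (simp add: g_def)
    ultimately show ?thesis by (simp add: mult.assoc)
  qed
  then show "has_moments (circle_mean F)" using int by (simp add: has_moments_def g_def)
  have "moment p (circle_mean F) = (LINT w|lborel. LINT t|lborel. H p t w)"
    unfolding snd by (simp add: moment_def g_def)
  also have "\<dots> = (LINT t|lborel. LINT w|lborel. H p t w)"
    by (rule lborel_pair.Fubini_integral[OF Hint])
  also have "\<dots> = (LINT t|lborel. indicator {0..1::real} t *\<^sub>R moment p F)"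
    by (simp add: H_def rot(2))
  also have "\<dots> = moment p F" by simp
  finally show "moment p (circle_mean F) = moment p F" .
qed

text \<open>On the circle of radius s the conjugate of \<zeta> is s^2/\<zeta>, so the mean is s^(2k)
  times that of a(\<zeta>)/\<zeta>^k, which Cauchy's formula evaluates as a Taylor
  coefficient.\<close>

lemma circle_integral_cnj_power:
  assumes a: "a holomorphic_on UNIV" and s: "s > 0"
  shows "((\<lambda>t. cnj (of_real s * cis (2 * pi * t)) ^ k * a (of_real s * cis (2 * pi * t))) has_integral
    (deriv ^^ k) a 0 / fact k * of_real (s ^ (2 * k))) {0..1}"
proof -
  have "((\<lambda>u. a u / (u - 0) ^ Suc k) has_contour_integral (2 * pi * \<i>) / fact k * (deriv ^^ k) a 0) (circlepath 0 s)"
    by (rule Cauchy_has_contour_integral_higher_derivative_circlepath)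
      (use a s in \<open>auto intro: holomorphic_on_subset holomorphic_on_imp_continuous_on\<close>)
  then have "((\<lambda>t. a (circlepath 0 s t) / circlepath 0 s t ^ Suc k * vector_derivative (circlepath 0 s) (at t within {0..1}))
     has_integral (2 * pi * \<i>) / fact k * (deriv ^^ k) a 0) {0..1}"
    by (simp add: has_contour_integral_def)
  from has_integral_mult_right[OF this, of "of_real (s ^ (2 * k)) / (2 * pi * \<i>)"]
  have "((\<lambda>t. of_real (s ^ (2 * k)) / (2 * pi * \<i>) * (a (circlepath 0 s t) / circlepath 0 s t ^ Suc k *
        vector_derivative (circlepath 0 s) (at t within {0..1})))
     has_integral (deriv ^^ k) a 0 / fact k * of_real (s ^ (2 * k))) {0..1}"
    by (simp add: field_simps)
  then show ?thesis
  proof (rule has_integral_eq[rotated])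
    fix t :: real assume t: "t \<in> {0..1}"
    define z where "z = of_real s * cis (2 * pi * t)"
    have c: "circlepath 0 s t = z" by (simp add: circlepath z_def cis_conv_exp mult_ac)
    have z0: "z \<noteq> 0" using s by (simp add: z_def)
    have d: "vector_derivative (circlepath 0 s) (at t within {0..1}) = 2 * pi * \<i> * z"
      using t by (subst vector_derivative_circlepath01) (auto simp: z_def cis_conv_exp mult_ac)
    have "z * cnj z = of_real (s\<^sup>2)"
      using s by (subst complex_norm_square[symmetric]) (simp add: z_def norm_mult)
    then have "(z * cnj z) ^ k = of_real (s\<^sup>2) ^ k" by (rule arg_cong)
    then have n: "of_real (s ^ (2 * k)) = z ^ k * cnj z ^ k"
      by (simp add: power_mult power_mult_distrib)
    show "of_real (s ^ (2 * k)) / (2 * pi * \<i>) * (a (circlepath 0 s t) / circlepath 0 s t ^ Suc k *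
        vector_derivative (circlepath 0 s) (at t within {0..1}))
      = cnj (of_real s * cis (2 * pi * t)) ^ k * a (of_real s * cis (2 * pi * t))"
      unfolding c d n z_def[symmetric] using z0 by (simp add: field_simps)
  qed
qed

text \<open>One complex line through 0 at a time: the coefficient functions may depend on
  \<open>w\<close> in any way. What is needed of this dependence is recovered from the circle
  mean.\<close>

definition polyanalytic_slices :: "nat \<Rightarrow> (complex^'n \<Rightarrow> complex) \<Rightarrow> bool" where
  "polyanalytic_slices m F \<longleftrightarrow> (\<forall>w. \<exists>a. (\<forall>k<m. a k holomorphic_on UNIV) \<and>
     (\<forall>\<zeta>. F (\<zeta> *s w) = (\<Sum>k<m. cnj \<zeta> ^ k * a k \<zeta>)))"

text \<open>The k-th summand contributes the k-th Taylor coefficient of \<open>a k\<close> times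
  s^(2k). For k = 0 this is the value of \<open>a 0\<close> at 0, which is F(0) on every
  line.\<close>

lemma circle_mean_slice:
  assumes "polyanalytic_slices m F" and "m \<ge> 1"
  shows "\<exists>c. c 0 = F 0 \<and> (\<forall>s>0. circle_mean F (s *\<^sub>R w) = (\<Sum>k<m. c k * of_real (s ^ (2 * k))))"
proof -
  obtain a where hol: "\<And>k. k < m \<Longrightarrow> a k holomorphic_on UNIV"
    and F: "\<And>\<zeta>. F (\<zeta> *s w) = (\<Sum>k<m. cnj \<zeta> ^ k * a k \<zeta>)"
    using assms(1) unfolding polyanalytic_slices_def by blast
  define c where "c k = (deriv ^^ k) (a k) 0 / fact k" for k
  have "F (0 *s w) = (\<Sum>k\<in>{0}. cnj 0 ^ k * a k 0)"
    unfolding F by (rule sum.mono_neutral_right) (use assms(2) in auto)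
  then have c0: "c 0 = F 0" by (simp add: c_def)
  have "circle_mean F (s *\<^sub>R w) = (\<Sum>k<m. c k * of_real (s ^ (2 * k)))" if s: "s > 0" for s
  proof -
    have e: "cis (2 * pi * t) *s (s *\<^sub>R w) = (of_real s * cis (2 * pi * t)) *s w" for t
      by (simp add: vec_eq_iff) (simp add: scaleR_conv_of_real)
    have ca: "continuous_on UNIV (a k)" if "k < m" for k
      using hol[OF that] by (rule holomorphic_on_imp_continuous_on)
    have ct: "continuous_on {0..1} (\<lambda>t. \<Sum>k<m. cnj (of_real s * cis (2 * pi * t)) ^ k * a k (of_real s * cis (2 * pi * t)))"
      by (intro continuous_intros continuous_on_compose2[OF ca]) auto
    have "circle_mean F (s *\<^sub>R w) = (LINT t:{0..1}|lborel. \<Sum>k<m. cnj (of_real s * cis (2 * pi * t)) ^ k * a k (of_real s * cis (2 * pi * t)))"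
      by (simp add: circle_mean_def e F)
    also have "\<dots> = integral {0..1} (\<lambda>t. \<Sum>k<m. cnj (of_real s * cis (2 * pi * t)) ^ k * a k (of_real s * cis (2 * pi * t)))"
      by (rule set_borel_integral_eq_integral(2)) (rule borel_integrable_atLeastAtMost'[OF ct])
    also have "\<dots> = (\<Sum>k<m. c k * of_real (s ^ (2 * k)))"
      unfolding c_def
      by (intro integral_unique has_integral_sum circle_integral_cnj_power hol s) auto
    finally show ?thesis .
  qed
  with c0 show ?thesis by blast
qed

section \<open>Splitting into homogeneous components\<close>

text \<open>Both sides are polynomials in s^2, and their difference has infinitely many zeros. This
  is what makes components chosen separately at each point homogeneous.\<close>

lemma homogeneous_components_unique:
  fixes c d :: "nat \<Rightarrow> complex"
  assumes "\<And>s::real. s > 0 \<Longrightarrow> (\<Sum>k<m. c k * of_real (s ^ (2 * k))) = (\<Sum>k<m. d k * of_real (s ^ (2 * k)))"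
    and k: "k < m"
  shows "c k = d k"
proof -
  define p where "p = (\<Sum>k<m. monom (c k - d k) k)"
  have "poly p (of_real (s\<^sup>2)) = 0" if "s > 0" for s
    using assms(1)[OF that] by (simp add: p_def poly_sum poly_monom left_diff_distrib sum_subtractf power_mult)
  then have "poly p (of_real t) = 0" if "t > 0" for t
    using that real_sqrt_pow2[of t] by (metis less_imp_le real_sqrt_gt_zero)
  then have "complex_of_real ` {0<..} \<subseteq> {x. poly p x = 0}" by auto
  moreover have "infinite (complex_of_real ` {0<..})"
    by (subst finite_image_iff) (auto simp: inj_on_def infinite_Ioi)
  ultimately have "p = 0" using poly_roots_finite finite_subset by blast
  then have "coeff p k = 0" by simp
  then show ?thesis using k by (simp add: p_def coeff_sum)
qed

lemma has_moments_cmult: "has_moments c \<Longrightarrow> has_moments (\<lambda>w. x * c w)"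
  by (auto simp: has_moments_def mult.assoc)

lemma has_moments_add: "has_moments c \<Longrightarrow> has_moments d \<Longrightarrow> has_moments (\<lambda>w. c w + d w)"
  by (auto simp: has_moments_def distrib_right)

lemma has_moments_diff: "has_moments c \<Longrightarrow> has_moments d \<Longrightarrow> has_moments (\<lambda>w. c w - d w)"
  by (auto simp: has_moments_def left_diff_distrib)

lemma has_moments_sum: "(\<And>i. i \<in> I \<Longrightarrow> has_moments (c i)) \<Longrightarrow> has_moments (\<lambda>w. \<Sum>i\<in>I. c i w)"
  by (induction I rule: infinite_finite_induct) (auto simp: has_moments_add has_moments_def[of "\<lambda>w. 0"])

text \<open>Substitution gives integrability against the wider Gaussian exp (-|w|^2/4), which
  dominates exp (-|w|^2); the factor 4^p compensates for the halved norm.\<close>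

lemma has_moments_half:
  fixes c :: "complex^'n \<Rightarrow> complex"
  assumes c: "has_moments c"
  shows "has_moments (\<lambda>w. c ((1/2) *\<^sub>R w))"
  unfolding has_moments_def
proof (intro conjI allI)
  have [measurable]: "c \<in> borel_measurable borel" using c by (simp add: has_moments_def)
  show "(\<lambda>w. c ((1/2) *\<^sub>R w)) \<in> borel_measurable borel" by measurable
  fix p
  let ?f = "\<lambda>w. c w * of_real (norm w ^ (2 * p) * exp (- (norm w)\<^sup>2))"
  have "integrable lborel ?f" using c by (simp add: has_moments_def)
  then have "integrable lborel (\<lambda>w. ?f (0 + (1/2) *\<^sub>R w))"
    by (subst lborel_integral_affine(2)) auto
  then have "integrable lborel (\<lambda>w. 4 ^ p * ?f ((1/2) *\<^sub>R w))"
    by (intro integrable_mult_right) simp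
  then show "integrable lborel (\<lambda>w. c ((1/2) *\<^sub>R w) * of_real (norm w ^ (2 * p) * exp (- (norm w)\<^sup>2)))"
  proof (rule Bochner_Integration.integrable_bound)
    show "AE w in lborel. norm (c ((1/2) *\<^sub>R w) * of_real (norm w ^ (2 * p) * exp (- (norm w)\<^sup>2)))
      \<le> norm (4 ^ p * ?f ((1/2) *\<^sub>R w))"
    proof (rule AE_I2)
      fix w :: "complex^'n"
      have n: "4 ^ p * norm ((1/2) *\<^sub>R w) ^ (2 * p) = norm w ^ (2 * p)"
      proof -
        have "4 ^ p * norm ((1/2) *\<^sub>R w) ^ (2 * p) = (4 * (norm ((1/2) *\<^sub>R w))\<^sup>2) ^ p"
          by (simp only: power_mult power_mult_distrib)
        also have "4 * (norm ((1/2) *\<^sub>R w))\<^sup>2 = (norm w)\<^sup>2" by (simp add: power_divide)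
        finally show ?thesis by (simp only: power_mult)
      qed
      have "norm (c ((1/2) *\<^sub>R w) * of_real (norm w ^ (2 * p) * exp (- (norm w)\<^sup>2)))
          = norm (c ((1/2) *\<^sub>R w)) * (norm w ^ (2 * p) * exp (- (norm w)\<^sup>2))"
        by (simp add: norm_mult norm_power)
      also have "\<dots> \<le> norm (c ((1/2) *\<^sub>R w)) * (norm w ^ (2 * p) * exp (- (norm ((1/2) *\<^sub>R w))\<^sup>2))"
        by (intro mult_left_mono) (auto simp: power_divide)
      also have "\<dots> = norm (4 ^ p * ?f ((1/2) *\<^sub>R w))"
        unfolding n[symmetric] norm_mult norm_power norm_of_real by simp
      finally show "norm (c ((1/2) *\<^sub>R w) * of_real (norm w ^ (2 * p) * exp (- (norm w)\<^sup>2)))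
        \<le> norm (4 ^ p * ?f ((1/2) *\<^sub>R w))" .
    qed
  qed measurable
qed

text \<open>The components arise from a pointwise choice, so even their measurability has to be
  proved. Let M be their sum, with top degree 2m. In 4^m M(w/2) - M(w) the top component cancels and
  the others are multiplied by 4^(m-k) - 1, which is not 0; induction on the number of components
  applies to this combination.\<close>

lemma has_moments_homogeneous_components:
  fixes c :: "nat \<Rightarrow> complex^'n \<Rightarrow> complex"
  assumes "has_moments (\<lambda>w. \<Sum>k<m. c k w)"
    and "\<And>k s w. k < m \<Longrightarrow> s > 0 \<Longrightarrow> c k (s *\<^sub>R w) = of_real (s ^ (2 * k)) * c k w" and "k < m"
  shows "has_moments (c k)"
  using assms
proof (induction m arbitrary: c k)
  case (Suc m)
  define d where "d k w = (4 ^ (m - k) - 1) * c k w" for k w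
  have cm: "c m ((1/2) *\<^sub>R w) = c m w / 4 ^ m" for w
    by (subst Suc.prems(2)) (auto simp: power_mult power_divide)
  have e: "(\<Sum>k<m. d k w) = 4 ^ m * (\<Sum>k<Suc m. c k ((1/2) *\<^sub>R w)) - (\<Sum>k<Suc m. c k w)" for w
  proof -
    have "4 ^ m * c k ((1/2) *\<^sub>R w) = 4 ^ (m - k) * c k w" if "k < m" for k
    proof -
      have "c k ((1/2) *\<^sub>R w) = c k w / 4 ^ k"
        using that by (subst Suc.prems(2)) (auto simp: power_mult power_divide)
      moreover have "(4::complex) ^ m = 4 ^ (m - k) * 4 ^ k" using that by (simp flip: power_add)
      ultimately show ?thesis by simp
    qed
    then show ?thesis
      by (simp add: d_def left_diff_distrib sum_subtractf distrib_left sum_distrib_left cm)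
  qed
  have dm: "has_moments (d k)" if "k < m" for k
  proof (rule Suc.IH[OF _ _ that])
    show "has_moments (\<lambda>w. \<Sum>k<m. d k w)"
      unfolding e by (intro has_moments_diff has_moments_cmult Suc.prems(1)
          has_moments_half[where c = "\<lambda>w. \<Sum>k<Suc m. c k w"])
    show "d k (s *\<^sub>R w) = of_real (s ^ (2 * k)) * d k w" if "k < m" "s > 0" for k s w
      using Suc.prems(2)[of k s w] that by (simp add: d_def)
  qed
  have less: "has_moments (c k)" if "k < m" for k
  proof -
    have "(4::complex) ^ (m - k) - 1 \<noteq> 0"
    proof
      assume "(4::complex) ^ (m - k) - 1 = 0"
      then have "(of_nat (4 ^ (m - k)) :: complex) = of_nat 1" by simp
      then have "(4::nat) ^ (m - k) = 1" by (simp only: of_nat_eq_iff)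
      with that show False by simp
    qed
    then have "c k = (\<lambda>w. inverse (4 ^ (m - k) - 1) * d k w)" by (auto simp: d_def)
    then show ?thesis using has_moments_cmult[OF dm[OF that]] by simp
  qed
  show ?case
  proof (cases "k = m")
    case True
    have "has_moments (\<lambda>w. (\<Sum>k<Suc m. c k w) - (\<Sum>k<m. c k w))"
      by (intro has_moments_diff has_moments_sum Suc.prems(1) less) simp
    then show ?thesis using True by simp
  qed (use less Suc.prems(3) in auto)
qed simp

text \<open>(-1)^p times the rising factorial over p! is the generalised binomial coefficient of -(n
  + k) over p, so Vandermonde gives N - k over N. This is 1 for k = 0 and 0 for 0 < k \<le>
  N.\<close>

lemma laguerre_moment_sum:
  assumes "k \<le> N"
  shows "(\<Sum>p\<le>N. real ((N + n) choose (N - p)) * (-1) ^ p / fact p * pochhammer (real (n + k)) p)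
    = (if k = 0 then 1 else 0)"
proof -
  have "(\<Sum>p\<le>N. real ((N + n) choose (N - p)) * (-1) ^ p / fact p * pochhammer (real (n + k)) p)
      = (\<Sum>p\<le>N. ((- real (n + k)) gchoose p) * (real (N + n) gchoose (N - p)))"
  proof (intro sum.cong refl)
    fix p
    have "(- real (n + k)) gchoose p = (-1) ^ p * pochhammer (real (n + k)) p / fact p"
      using gbinomial_pochhammer[of "- real (n + k)" p] by (simp only: minus_minus)
    then show "real ((N + n) choose (N - p)) * (-1) ^ p / fact p * pochhammer (real (n + k)) p
      = ((- real (n + k)) gchoose p) * (real (N + n) gchoose (N - p))"
      by (simp only: binomial_gbinomial) (simp add: mult_ac)
  qed
  also have "\<dots> = (- real (n + k) + real (N + n)) gchoose N"
    using gbinomial_Vandermonde[of "- real (n + k)" "real (N + n)" N] by (simp only: atLeast0AtMost)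
  also have "- real (n + k) + real (N + n) = real (N - k)" using assms by simp
  also have "real (N - k) gchoose N = real ((N - k) choose N)" by (simp add: binomial_gbinomial)
  also have "\<dots> = (if k = 0 then 1 else 0)" using assms by (auto simp: binomial_eq_0)
  finally show ?thesis .
qed

lemma moment_homogeneous:
  fixes c :: "complex^'n \<Rightarrow> complex"
  assumes "has_moments c" and "\<And>s w. s > 0 \<Longrightarrow> c (s *\<^sub>R w) = of_real (s ^ (2 * k)) * c w"
  shows "moment p c = of_real (pochhammer (real (CARD('n) + k)) p) * moment 0 c"
proof (induction p)
  case (Suc p)
  have "moment (Suc p) c = of_nat (CARD('n) + k + p) * moment p c"
    by (rule moment_Suc_homogeneous[OF assms])
  then show ?case by (simp add: Suc pochhammer_rec' mult.commute algebra_simps)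
qed simp

lemma laguerre_reproduces_at_0:
  fixes F :: "complex^'n \<Rightarrow> complex"
  assumes cont: "continuous_on UNIV F" and sl: "polyanalytic_slices m F" and m: "m \<ge> 1"
    and int: "integrable lborel (\<lambda>w. (cmod (F w))\<^sup>2 * exp (- (norm w)\<^sup>2))"
  shows "(LINT w|lborel. F w * of_real (laguerre CARD('n) (m - 1) ((norm w)\<^sup>2) * exp (- (norm w)\<^sup>2)))
    = of_real (pi ^ CARD('n)) * F 0"
proof -
  define b where "b p = real ((m - 1 + CARD('n)) choose (m - 1 - p)) * (-1) ^ p / fact p" for p
  have Fm: "has_moments F"
    using cont int by (intro has_moments_square_integrable borel_measurable_continuous_onI)
  have Mm: "has_moments (circle_mean F)" by (rule circle_mean_moments(1)[OF cont Fm])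
  \<comment> \<open>One choice for each \<open>w\<close>; homogeneity and integrability in
    \<open>w\<close> are established afterwards.\<close>
  obtain c where c0: "\<And>w. c w 0 = F 0"
    and c: "\<And>w s. s > 0 \<Longrightarrow> circle_mean F (s *\<^sub>R w) = (\<Sum>k<m. c w k * of_real (s ^ (2 * k)))"
    using circle_mean_slice[OF sl m] by metis
  have hom: "c (s *\<^sub>R w) k = of_real (s ^ (2 * k)) * c w k" if k: "k < m" and s: "s > 0" for k s w
  proof (rule homogeneous_components_unique[OF _ k])
    fix t :: real assume t: "t > 0"
    have "(\<Sum>k<m. c (s *\<^sub>R w) k * of_real (t ^ (2 * k))) = circle_mean F ((t * s) *\<^sub>R w)"
      using c[OF t, of "s *\<^sub>R w"] by simp
    also have "\<dots> = (\<Sum>k<m. of_real (s ^ (2 * k)) * c w k * of_real (t ^ (2 * k)))"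
      using s t by (subst c) (auto simp: power_mult_distrib mult_ac)
    finally show "(\<Sum>k<m. c (s *\<^sub>R w) k * of_real (t ^ (2 * k)))
      = (\<Sum>k<m. of_real (s ^ (2 * k)) * c w k * of_real (t ^ (2 * k)))" .
  qed
  have M: "circle_mean F w = (\<Sum>k<m. c w k)" for w using c[of 1 w] by simp
  have cm: "has_moments (\<lambda>w. c w k)" if "k < m" for k
    by (rule has_moments_homogeneous_components[where c = "\<lambda>k w. c w k", OF _ hom that])
      (use Mm M in \<open>simp_all cong: sum.cong add: fun_eq_iff flip: M\<close>)
  have mF: "moment p F = (\<Sum>k<m. of_real (pochhammer (real (CARD('n) + k)) p) * moment 0 (\<lambda>w. c w k))" for p
  proof -
    have "moment p F = moment p (circle_mean F)" by (rule circle_mean_moments(2)[OF cont Fm, symmetric])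
    also have "\<dots> = (\<Sum>k<m. moment p (\<lambda>w. c w k))"
      unfolding moment_def M sum_distrib_right
      by (rule Bochner_Integration.integral_sum) (use cm in \<open>simp add: has_moments_def\<close>)
    also have "\<dots> = (\<Sum>k<m. of_real (pochhammer (real (CARD('n) + k)) p) * moment 0 (\<lambda>w. c w k))"
      by (intro sum.cong moment_homogeneous cm hom) auto
    finally show ?thesis .
  qed
  have "(LINT w|lborel. F w * of_real (laguerre CARD('n) (m - 1) ((norm w)\<^sup>2) * exp (- (norm w)\<^sup>2)))
      = (LINT w|lborel. (\<Sum>p\<le>m - 1. of_real (b p) * (F w * of_real (norm w ^ (2 * p) * exp (- (norm w)\<^sup>2)))))"
  proof (intro Bochner_Integration.integral_cong refl)
    fix w :: "complex^'n"
    have "laguerre CARD('n) (m - 1) ((norm w)\<^sup>2) = (\<Sum>p\<le>m - 1. b p * norm w ^ (2 * p))"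
      unfolding laguerre_def b_def power_mult[of _ 2] by (subst power_minus) (simp add: field_simps)
    then show "F w * of_real (laguerre CARD('n) (m - 1) ((norm w)\<^sup>2) * exp (- (norm w)\<^sup>2))
      = (\<Sum>p\<le>m - 1. of_real (b p) * (F w * of_real (norm w ^ (2 * p) * exp (- (norm w)\<^sup>2))))"
      by (simp add: sum_distrib_left sum_distrib_right mult_ac)
  qed
  also have "\<dots> = (\<Sum>p\<le>m - 1. of_real (b p) * moment p F)"
    unfolding moment_def using Fm
    by (subst Bochner_Integration.integral_sum) (auto simp: has_moments_def)
  also have "\<dots> = (\<Sum>k<m. of_real (\<Sum>p\<le>m - 1. b p * pochhammer (real (CARD('n) + k)) p) * moment 0 (\<lambda>w. c w k))"
    unfolding mF sum_distrib_left of_real_sum sum_distrib_right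
    by (subst sum.swap) (simp add: mult.assoc)
  also have "\<dots> = (\<Sum>k<m. (if k = 0 then 1 else 0) * moment 0 (\<lambda>w. c w k))"
    unfolding b_def by (intro sum.cong arg_cong2[where f = "(*)"] refl, subst laguerre_moment_sum) auto
  also have "\<dots> = moment 0 (\<lambda>w. c w 0)"
    using m by (simp add: if_distrib[of "\<lambda>x. x * _"] sum.delta' cong: if_cong)
  \<comment> \<open>The component of degree 0 is the constant F(0), which leaves the Gaussian
    integral in real dimension 2n.\<close>
  also have "\<dots> = of_real (pi ^ CARD('n)) * F 0"
    using gaussian_euclidean(2)[where 'a="complex^'n"] power_mult[of "sqrt pi" "CARD('n)" 2]
      power_mult[of "sqrt pi" 2 "CARD('n)"]
    by (simp add: c0 moment_def power_mult mult.commute flip: of_real_power)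
  finally show ?thesis .
qed

section \<open>Polyanalytic functions\<close>

text \<open>The mean value theorem twice: first along h for the increment of f in direction k, then
  along k for the derivative in direction h.\<close>

lemma second_difference_mvt:
  fixes f :: "'a::real_normed_vector \<Rightarrow> real"
  assumes f: "\<And>x. (f has_derivative f' x) (at x)"
    and f1: "\<And>x. ((\<lambda>x. f' x h) has_derivative f1 x) (at x)" and s: "s > 0"
  shows "\<exists>\<sigma> \<tau>. 0 < \<sigma> \<and> \<sigma> < s \<and> 0 < \<tau> \<and> \<tau> < s \<and>
    f (x + s *\<^sub>R h + s *\<^sub>R k) - f (x + s *\<^sub>R h) - f (x + s *\<^sub>R k) + f x
      = s * s * f1 (x + \<sigma> *\<^sub>R h + \<tau> *\<^sub>R k) k"
proof -
  have line: "((\<lambda>t. g (a + t *\<^sub>R v)) has_real_derivative D v) (at t)"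
    if "(g has_derivative D) (at (a + t *\<^sub>R v))" for g :: "'a \<Rightarrow> real" and D a v t
  proof -
    have "((\<lambda>t. a + t *\<^sub>R v) has_derivative (\<lambda>e. e *\<^sub>R v)) (at t)"
      by (auto intro!: derivative_eq_intros)
    from diff_chain_at[OF this that]
    have "((\<lambda>t. g (a + t *\<^sub>R v)) has_derivative (\<lambda>e. D (e *\<^sub>R v))) (at t)" by (simp add: o_def)
    moreover have "D (e *\<^sub>R v) = e * D v" for e
      using has_derivative_linear[OF that] by (simp add: linear_cmul)
    ultimately show ?thesis by (simp add: has_field_derivative_def mult_commute_abs)
  qed
  have "((\<lambda>t. f (x + s *\<^sub>R k + t *\<^sub>R h) - f (x + t *\<^sub>R h)) has_real_derivative
      f' (x + s *\<^sub>R k + t *\<^sub>R h) h - f' (x + t *\<^sub>R h) h) (at t)" for t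
    by (intro DERIV_diff line f)
  then obtain \<sigma> where \<sigma>: "0 < \<sigma>" "\<sigma> < s"
    and 1: "(f (x + s *\<^sub>R k + s *\<^sub>R h) - f (x + s *\<^sub>R h)) - (f (x + s *\<^sub>R k + 0 *\<^sub>R h) - f (x + 0 *\<^sub>R h))
      = (s - 0) * (f' (x + s *\<^sub>R k + \<sigma> *\<^sub>R h) h - f' (x + \<sigma> *\<^sub>R h) h)"
    using MVT2[OF s, of "\<lambda>t. f (x + s *\<^sub>R k + t *\<^sub>R h) - f (x + t *\<^sub>R h)"
       "\<lambda>t. f' (x + s *\<^sub>R k + t *\<^sub>R h) h - f' (x + t *\<^sub>R h) h"] by blast
  have "((\<lambda>t. f' (x + \<sigma> *\<^sub>R h + t *\<^sub>R k) h) has_real_derivative f1 (x + \<sigma> *\<^sub>R h + t *\<^sub>R k) k) (at t)" for t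
    by (intro line f1)
  then obtain \<tau> where \<tau>: "0 < \<tau>" "\<tau> < s"
    and 2: "f' (x + \<sigma> *\<^sub>R h + s *\<^sub>R k) h - f' (x + \<sigma> *\<^sub>R h + 0 *\<^sub>R k) h = (s - 0) * f1 (x + \<sigma> *\<^sub>R h + \<tau> *\<^sub>R k) k"
    using MVT2[OF s, of "\<lambda>t. f' (x + \<sigma> *\<^sub>R h + t *\<^sub>R k) h" "\<lambda>t. f1 (x + \<sigma> *\<^sub>R h + t *\<^sub>R k) k"] by blast
  have "x + s *\<^sub>R k + \<sigma> *\<^sub>R h = x + \<sigma> *\<^sub>R h + s *\<^sub>R k" "x + s *\<^sub>R k + s *\<^sub>R h = x + s *\<^sub>R h + s *\<^sub>R k"
    by (simp_all add: add_ac)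
  with 1 2 \<sigma> \<tau> show ?thesis by (intro exI[of _ \<sigma>] exI[of _ \<tau>]) (simp add: algebra_simps)
qed

text \<open>The second difference is unchanged when h and k are exchanged. Divided by s^2 it equals
  either mixed derivative at points tending to x. This symmetry is what removes the arbitrary
  enumeration from \<open>Dbar\<close>.\<close>

lemma symmetric_second_derivative_real:
  fixes f :: "'a::real_normed_vector \<Rightarrow> real"
  assumes f: "\<And>x. (f has_derivative f' x) (at x)"
    and f1: "\<And>x. ((\<lambda>x. f' x h) has_derivative f1 x) (at x)"
    and f2: "\<And>x. ((\<lambda>x. f' x k) has_derivative f2 x) (at x)"
    and c1: "continuous_on UNIV (\<lambda>x. f1 x k)" and c2: "continuous_on UNIV (\<lambda>x. f2 x h)"
  shows "f1 x k = f2 x h"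
proof -
  define s where "s i = 1 / real (Suc i)" for i
  have s: "s i > 0" and s0: "s \<longlonglongrightarrow> 0" for i
    using LIMSEQ_Suc[OF lim_1_over_n] by (simp_all add: s_def[abs_def])
  have lim: "(\<lambda>i. g (x + \<sigma> i *\<^sub>R u + \<tau> i *\<^sub>R v)) \<longlonglongrightarrow> g x"
    if g: "continuous_on UNIV g" and "\<And>i. 0 < \<sigma> i \<and> \<sigma> i < s i" and "\<And>i. 0 < \<tau> i \<and> \<tau> i < s i"
    for g :: "'a \<Rightarrow> real" and \<sigma> \<tau> u v
  proof -
    have "\<sigma> \<longlonglongrightarrow> 0" "\<tau> \<longlonglongrightarrow> 0"
      by (rule tendsto_sandwich[OF _ _ tendsto_const s0]; use that in \<open>auto simp: less_imp_le\<close>)+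
    then have "(\<lambda>i. x + \<sigma> i *\<^sub>R u + \<tau> i *\<^sub>R v) \<longlonglongrightarrow> x + 0 *\<^sub>R u + 0 *\<^sub>R v"
      by (intro tendsto_intros)
    then have "(\<lambda>i. g (x + \<sigma> i *\<^sub>R u + \<tau> i *\<^sub>R v)) \<longlonglongrightarrow> g (x + 0 *\<^sub>R u + 0 *\<^sub>R v)"
      by (rule continuous_on_tendsto_compose[OF g]) auto
    then show ?thesis by simp
  qed
  define \<Delta> where "\<Delta> i = f (x + s i *\<^sub>R h + s i *\<^sub>R k) - f (x + s i *\<^sub>R h) - f (x + s i *\<^sub>R k) + f x" for i
  have "\<forall>i. \<exists>\<sigma> \<tau>. 0 < \<sigma> \<and> \<sigma> < s i \<and> 0 < \<tau> \<and> \<tau> < s i \<and> \<Delta> i = s i * s i * f1 (x + \<sigma> *\<^sub>R h + \<tau> *\<^sub>R k) k"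
    unfolding \<Delta>_def using second_difference_mvt[OF f f1 s] by blast
  then obtain \<sigma> \<tau> where 1: "\<And>i. 0 < \<sigma> i \<and> \<sigma> i < s i" "\<And>i. 0 < \<tau> i \<and> \<tau> i < s i"
    "\<And>i. \<Delta> i = s i * s i * f1 (x + \<sigma> i *\<^sub>R h + \<tau> i *\<^sub>R k) k"
    by metis
  have \<Delta>': "\<Delta> i = f (x + s i *\<^sub>R k + s i *\<^sub>R h) - f (x + s i *\<^sub>R k) - f (x + s i *\<^sub>R h) + f x" for i
    by (simp add: \<Delta>_def add_ac)
  have "\<forall>i. \<exists>\<sigma> \<tau>. 0 < \<sigma> \<and> \<sigma> < s i \<and> 0 < \<tau> \<and> \<tau> < s i \<and> \<Delta> i = s i * s i * f2 (x + \<sigma> *\<^sub>R k + \<tau> *\<^sub>R h) h"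
    unfolding \<Delta>' using second_difference_mvt[OF f f2 s] by blast
  then obtain \<sigma>' \<tau>' where 2: "\<And>i. 0 < \<sigma>' i \<and> \<sigma>' i < s i" "\<And>i. 0 < \<tau>' i \<and> \<tau>' i < s i"
    "\<And>i. \<Delta> i = s i * s i * f2 (x + \<sigma>' i *\<^sub>R k + \<tau>' i *\<^sub>R h) h"
    by metis
  have "(\<lambda>i. f1 (x + \<sigma> i *\<^sub>R h + \<tau> i *\<^sub>R k) k) \<longlonglongrightarrow> f1 x k"
    by (rule lim[OF c1 1(1,2)])
  moreover have "(\<lambda>i. f2 (x + \<sigma>' i *\<^sub>R k + \<tau>' i *\<^sub>R h) h) \<longlonglongrightarrow> f2 x h"
    by (rule lim[OF c2 2(1,2)])
  moreover have "f1 (x + \<sigma> i *\<^sub>R h + \<tau> i *\<^sub>R k) k = f2 (x + \<sigma>' i *\<^sub>R k + \<tau>' i *\<^sub>R h) h" for i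
    using 1(3)[of i] 2(3)[of i] s[of i] by simp
  ultimately show ?thesis using LIMSEQ_unique by simp
qed

lemma symmetric_second_derivative:
  fixes f :: "'a::real_normed_vector \<Rightarrow> complex"
  assumes f: "\<And>x. (f has_derivative f' x) (at x)"
    and f1: "\<And>x. ((\<lambda>x. f' x h) has_derivative f1 x) (at x)"
    and f2: "\<And>x. ((\<lambda>x. f' x k) has_derivative f2 x) (at x)"
    and c1: "continuous_on UNIV (\<lambda>x. f1 x k)" and c2: "continuous_on UNIV (\<lambda>x. f2 x h)"
  shows "f1 x k = f2 x h"
proof (rule complex_eqI)
  show "Re (f1 x k) = Re (f2 x h)"
    by (rule symmetric_second_derivative_real[where f = "\<lambda>x. Re (f x)" and f' = "\<lambda>x h. Re (f' x h)"
      and ?f1.0 = "\<lambda>x k. Re (f1 x k)" and ?f2.0 = "\<lambda>x k. Re (f2 x k)"])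
     (intro has_derivative_Re f f1 f2 continuous_on_Re c1 c2)+
  show "Im (f1 x k) = Im (f2 x h)"
    by (rule symmetric_second_derivative_real[where f = "\<lambda>x. Im (f x)" and f' = "\<lambda>x h. Im (f' x h)"
      and ?f1.0 = "\<lambda>x k. Im (f1 x k)" and ?f2.0 = "\<lambda>x k. Im (f2 x k)"])
     (intro has_derivative_Im f f1 f2 continuous_on_Im c1 c2)+
qed

section \<open>Smooth functions and the operators \<open>dbar\<close>\<close>

lemma smooth_has_derivative:
  assumes "smooth f" shows "(f has_derivative frechet_derivative f (at x)) (at x)"
proof -
  have "Ck (Suc 0) f" using assms unfolding smooth_def by blast
  then show ?thesis by (simp add: frechet_derivative_works[symmetric])
qed

lemma smooth_frechet_derivative:
  assumes "smooth f" shows "smooth (\<lambda>x. frechet_derivative f (at x) h)"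
proof -
  have "Ck (Suc j) f" for j using assms unfolding smooth_def by blast
  then show ?thesis by (simp add: smooth_def)
qed

lemma smooth_imp_continuous: "smooth f \<Longrightarrow> continuous_on UNIV f"
  unfolding smooth_def by (metis Ck.simps(1))

lemma Ck_add: "Ck j f \<Longrightarrow> Ck j g \<Longrightarrow> Ck j (\<lambda>x. f x + g x)"
proof (induction j arbitrary: f g)
  case (Suc j)
  have "((\<lambda>x. f x + g x) has_derivative (\<lambda>h. frechet_derivative f (at x) h + frechet_derivative g (at x) h)) (at x)" for x
    using Suc.prems by (intro has_derivative_add) (auto simp: frechet_derivative_works[symmetric])
  note D = this
  show ?case
    using Suc D by (auto simp: differentiable_def frechet_derivative_at[OF D, symmetric])
qed (auto intro: continuous_intros)

lemma Ck_cmult: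
  fixes f :: "'a::real_normed_vector \<Rightarrow> complex"
  shows "Ck j f \<Longrightarrow> Ck j (\<lambda>x. c * f x)"
proof (induction j arbitrary: f)
  case (Suc j)
  have "((\<lambda>x. c * f x) has_derivative (\<lambda>h. c * frechet_derivative f (at x) h)) (at x)" for x
    using Suc.prems by (intro has_derivative_mult_right) (auto simp: frechet_derivative_works[symmetric])
  note D = this
  show ?case
    using Suc D by (auto simp: differentiable_def frechet_derivative_at[OF D, symmetric])
qed (auto intro: continuous_intros)

lemma smooth_add: "smooth f \<Longrightarrow> smooth g \<Longrightarrow> smooth (\<lambda>x. f x + g x)"
  by (simp add: smooth_def Ck_add)

lemma smooth_cmult: "smooth f \<Longrightarrow> smooth (\<lambda>x. c * f x :: complex)"
  by (simp add: smooth_def Ck_cmult)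

lemma frechet_derivative_add:
  assumes "smooth f" "smooth g"
  shows "frechet_derivative (\<lambda>x. f x + g x) (at x) h = frechet_derivative f (at x) h + frechet_derivative g (at x) h"
  using frechet_derivative_at[OF has_derivative_add[OF assms[THEN smooth_has_derivative]]] by metis

lemma frechet_derivative_cmult:
  fixes f :: "'a::real_normed_vector \<Rightarrow> complex"
  assumes "smooth f"
  shows "frechet_derivative (\<lambda>x. c * f x) (at x) h = c * frechet_derivative f (at x) h"
  using frechet_derivative_at[OF has_derivative_mult_right[OF assms[THEN smooth_has_derivative]]] by metis

lemma frechet_derivative_commute:
  fixes f :: "'a::real_normed_vector \<Rightarrow> complex"
  assumes f: "smooth f"
  shows "frechet_derivative (\<lambda>x. frechet_derivative f (at x) h) (at x) k
    = frechet_derivative (\<lambda>x. frechet_derivative f (at x) k) (at x) h"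
  by (rule symmetric_second_derivative[where f = f and f' = "\<lambda>x. frechet_derivative f (at x)"])
    (intro smooth_has_derivative smooth_imp_continuous smooth_frechet_derivative f)+

lemma dbar_eq: "dbar r f = (\<lambda>z. (1/2) * frechet_derivative f (at z) (axis r 1)
    + (\<i>/2) * frechet_derivative f (at z) (axis r \<i>))"
  by (simp add: dbar_def fun_eq_iff add_divide_distrib)

lemma smooth_dbar: "smooth f \<Longrightarrow> smooth (dbar r f)"
  unfolding dbar_eq by (intro smooth_add smooth_cmult smooth_frechet_derivative)

lemma frechet_derivative_dbar:
  assumes "smooth f"
  shows "frechet_derivative (dbar r f) (at z) h
    = (1/2) * frechet_derivative (\<lambda>z. frechet_derivative f (at z) (axis r 1)) (at z) h
    + (\<i>/2) * frechet_derivative (\<lambda>z. frechet_derivative f (at z) (axis r \<i>)) (at z) h"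
  unfolding dbar_eq
  by (simp only: frechet_derivative_cmult[OF smooth_frechet_derivative[OF assms]]
    frechet_derivative_add[OF smooth_cmult[OF smooth_frechet_derivative[OF assms]]
      smooth_cmult[OF smooth_frechet_derivative[OF assms]]])

lemma dbar_commute:
  assumes "smooth f" shows "dbar r (dbar s f) = dbar s (dbar r f)"
proof
  fix z
  have d: "dbar r (dbar s f) z = (1/2) * frechet_derivative (dbar s f) (at z) (axis r 1)
    + (\<i>/2) * frechet_derivative (dbar s f) (at z) (axis r \<i>)" for r s
    by (simp add: dbar_def add_divide_distrib)
  show "dbar r (dbar s f) z = dbar s (dbar r f) z"
    unfolding d frechet_derivative_dbar[OF assms]
    using frechet_derivative_commute[OF assms, of "axis s 1" z "axis r 1"]
      frechet_derivative_commute[OF assms, of "axis s \<i>" z "axis r 1"]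
      frechet_derivative_commute[OF assms, of "axis s 1" z "axis r \<i>"]
      frechet_derivative_commute[OF assms, of "axis s \<i>" z "axis r \<i>"]
    by (simp add: algebra_simps)
qed

lemma dbar_add: "smooth f \<Longrightarrow> smooth g \<Longrightarrow> dbar r (\<lambda>z. f z + g z) = (\<lambda>z. dbar r f z + dbar r g z)"
  by (simp add: dbar_def frechet_derivative_add fun_eq_iff add_divide_distrib algebra_simps)

lemma dbar_cmult: "smooth f \<Longrightarrow> dbar r (\<lambda>z. c * f z) = (\<lambda>z. c * dbar r f z)"
  by (simp add: dbar_def frechet_derivative_cmult fun_eq_iff algebra_simps)

lemma smooth_zero: "smooth (\<lambda>_. 0 :: complex)"
proof -
  have "Ck j (\<lambda>_::'a. 0 :: complex)" for j by (induction j) simp_all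
  then show ?thesis by (simp add: smooth_def)
qed

section \<open>Mixed conjugate derivatives as words in \<open>dbar\<close>\<close>

lemma smooth_foldr_dbar: "smooth f \<Longrightarrow> smooth (foldr dbar rs f)"
  by (induction rs) (auto intro: smooth_dbar)

lemma dbar_foldr: "smooth f \<Longrightarrow> dbar r (foldr dbar (xs @ ys) f) = foldr dbar (xs @ r # ys) f"
  by (induction xs) (auto simp: dbar_commute[of _ r] smooth_foldr_dbar simp del: foldr_append)

lemma foldr_dbar_perm:
  "smooth f \<Longrightarrow> mset xs = mset ys \<Longrightarrow> foldr dbar xs f = foldr dbar ys f"
proof (induction xs arbitrary: ys)
  case (Cons x xs)
  then have "x \<in> set ys" by (metis list.set_intros(1) mset_eq_setD)
  then obtain us vs where ys: "ys = us @ x # vs" by (meson split_list)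
  with Cons.prems have "mset xs = mset (us @ vs)" by simp
  then have "foldr dbar xs f = foldr dbar (us @ vs) f" by (rule Cons.IH[OF Cons.prems(1)])
  then show ?case using dbar_foldr[OF Cons.prems(1), of x us vs] by (simp add: ys del: foldr_append)
qed simp

lemma index_list: "distinct (index_list :: 'n::finite list)" "set index_list = (UNIV :: 'n set)"
proof -
  have "\<exists>rs::'n list. distinct rs \<and> set rs = UNIV" using finite_distinct_list[of "UNIV :: 'n set"] by auto
  from someI_ex[OF this] show "distinct (index_list :: 'n list)" "set index_list = (UNIV :: 'n set)"
    by (simp_all add: index_list_def)
qed

lemma Dbar_foldr: "Dbar k f = foldr dbar (concat (map (\<lambda>r. replicate (k $ r) r) index_list)) f"
proof -
  have rep: "foldr dbar (replicate j r) g = (dbar r ^^ j) g" for j r and g :: "complex^'n \<Rightarrow> complex"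
    by (induction j) auto
  have "foldr (\<lambda>r. dbar r ^^ (k $ r)) rs f = foldr dbar (concat (map (\<lambda>r. replicate (k $ r) r) rs)) f" for rs
    by (induction rs) (auto simp: rep)
  then show ?thesis by (simp add: Dbar_def)
qed

text \<open>Lists of indices replace multi-indices, since one more \<open>dbar\<close> is then just
  one more entry. The multiplicities in \<open>rs\<close> form the multi-index, and
  \<open>foldr_dbar_perm\<close> takes care of the order.\<close>

lemma m_analytic_foldr_dbar:
  assumes f: "m_analytic m f" and rs: "length rs = m"
  shows "foldr dbar rs f = (\<lambda>_. 0)"
proof -
  define k :: "nat ^ 'a" where "k = (\<chi> r. count (mset rs) r)"
  have "mi_size k = sum (count (mset rs)) (set_mset (mset rs))"
    unfolding mi_size_def k_def by (simp, rule sum.mono_neutral_right) (auto simp: count_eq_zero_iff)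
  also have "\<dots> = size (mset rs)" by (simp only: size_multiset_overloaded_eq)
  finally have "mi_size k = m" using rs by simp
  then have "\<forall>z. Dbar k f z = 0" using f unfolding m_analytic_def by blast
  then have "Dbar k f = (\<lambda>_. 0)" by auto
  moreover have "mset (concat (map (\<lambda>r. replicate (k $ r) r) index_list)) = mset rs"
  proof (rule multiset_eqI)
    fix x
    have "count (mset (concat (map (\<lambda>r. replicate (k $ r) r) is))) x = (if x \<in> set is then k $ x else 0)"
      if "distinct is" for "is"
      using that by (induction "is") auto
    then show "count (mset (concat (map (\<lambda>r. replicate (k $ r) r) index_list))) x = count (mset rs) x"
      by (simp add: index_list) (simp add: k_def)
  qed
  ultimately show ?thesis
    using foldr_dbar_perm[of f] f unfolding Dbar_foldr m_analytic_def by metis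
qed

section \<open>Restriction to complex lines\<close>

text \<open>By \<open>dbar_slice\<close> and the chain rule, this corresponds to the conjugate
  derivative in \<zeta> of f(z + \<zeta> b).\<close>

definition dbar_along :: "complex^'n \<Rightarrow> (complex^'n \<Rightarrow> complex) \<Rightarrow> complex^'n \<Rightarrow> complex" where
  "dbar_along b f = (\<lambda>z. \<Sum>r\<in>UNIV. cnj (b $ r) * dbar r f z)"

lemma smooth_sum: "(\<And>i. i \<in> I \<Longrightarrow> smooth (f i)) \<Longrightarrow> smooth (\<lambda>z. \<Sum>i\<in>I. f i z :: complex)"
  by (induction I rule: infinite_finite_induct) (auto simp: smooth_zero intro: smooth_add)

lemma dbar_zero: "dbar r (\<lambda>_. 0) = (\<lambda>_. 0)"
  by (simp add: dbar_def fun_eq_iff)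

lemma dbar_sum:
  "(\<And>i. i \<in> I \<Longrightarrow> smooth (f i)) \<Longrightarrow> dbar r (\<lambda>z. \<Sum>i\<in>I. f i z) = (\<lambda>z. \<Sum>i\<in>I. dbar r (f i) z)"
  by (induction I rule: infinite_finite_induct)
    (simp_all add: dbar_zero dbar_add smooth_sum)

lemma smooth_dbar_along: "smooth f \<Longrightarrow> smooth (dbar_along b f)"
  unfolding dbar_along_def by (intro smooth_sum smooth_cmult smooth_dbar)

lemma foldr_dbar_along:
  assumes "smooth f"
  shows "foldr dbar rs (dbar_along b f) = (\<lambda>z. \<Sum>r\<in>UNIV. cnj (b $ r) * foldr dbar (rs @ [r]) f z)"
proof (induction rs)
  case (Cons s rs)
  have sm: "smooth (foldr dbar (rs @ [r]) f)" for r by (rule smooth_foldr_dbar[OF assms])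
  have "foldr dbar (s # rs) (dbar_along b f) = dbar s (\<lambda>z. \<Sum>r\<in>UNIV. cnj (b $ r) * foldr dbar (rs @ [r]) f z)"
    using Cons by simp
  also have "\<dots> = (\<lambda>z. \<Sum>r\<in>UNIV. cnj (b $ r) * dbar s (foldr dbar (rs @ [r]) f) z)"
    using sm by (subst dbar_sum) (auto simp: smooth_cmult dbar_cmult)
  finally show ?case by simp
qed (simp add: dbar_along_def)

text \<open>If all words of length m + 1 kill f, then all words of length m kill
  \<open>dbar_along b f\<close>; the induction therefore varies f.\<close>

lemma dbar_along_power_eq_0:
  "smooth f \<Longrightarrow> (\<And>rs. length rs = m \<Longrightarrow> foldr dbar rs f = (\<lambda>_. 0)) \<Longrightarrow> (dbar_along b ^^ m) f = (\<lambda>_. 0)"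
proof (induction m arbitrary: f)
  case (Suc m)
  have "foldr dbar rs (dbar_along b f) = (\<lambda>_. 0)" if "length rs = m" for rs
    using Suc.prems that by (simp add: foldr_dbar_along del: foldr_append)
  from Suc.IH[OF smooth_dbar_along[OF Suc.prems(1)] this]
  show ?case by (simp add: funpow_swap1)
qed simp

lemma smooth_dbar_along_power: "smooth f \<Longrightarrow> smooth ((dbar_along b ^^ j) f)"
  by (induction j) (auto intro: smooth_dbar_along)

text \<open>D is only real-linear, hence determined by its values on \<open>axis r 1\<close> and
  \<open>axis r \<i>\<close>. Expanding D at b and at \<i> b in this real basis, the coefficients
  combine to the conjugates of the entries of b.\<close>

lemma dbar_slice:
  fixes D :: "complex^'n \<Rightarrow> complex"
  assumes "linear D"
  shows "(D b + \<i> * D (\<i> *s b)) / 2 = (\<Sum>r\<in>UNIV. cnj (b $ r) * ((D (axis r 1) + \<i> * D (axis r \<i>)) / 2))"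
proof -
  have e: "v = (\<Sum>r\<in>UNIV. Re (v $ r) *\<^sub>R axis r 1 + Im (v $ r) *\<^sub>R axis r \<i>)" for v :: "complex^'n"
    by (simp add: vec_eq_iff axis_def complex_eq_iff if_distrib[of "\<lambda>x. _ * x"] if_distrib[of Re] if_distrib[of Im]
        sum.delta cong: if_cong)
  have D: "D v = (\<Sum>r\<in>UNIV. of_real (Re (v $ r)) * D (axis r 1) + of_real (Im (v $ r)) * D (axis r \<i>))" for v :: "complex^'n"
  proof -
    have "D v = D (\<Sum>r\<in>UNIV. Re (v $ r) *\<^sub>R axis r 1 + Im (v $ r) *\<^sub>R axis r \<i>)"
      by (simp only: e[of v, symmetric])
    then show ?thesis
      by (simp only: linear_sum[OF assms] linear_add[OF assms] linear_cmul[OF assms])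
        (simp add: scaleR_conv_of_real)
  qed
  have c: "cnj z = of_real (Re z) - \<i> * of_real (Im z)" for z by (simp add: complex_eq_iff)
  show ?thesis
    unfolding D[of b] D[of "\<i> *s b"] c
    by (simp add: sum_distrib_left sum_divide_distrib sum.distrib[symmetric] add_divide_distrib diff_divide_distrib algebra_simps)
qed

text \<open>Induction on the order. The conjugate derivative of \<open>g 0\<close> is known by
  induction as a polynomial in the conjugate of \<zeta>; its termwise antiderivative
  \<open>B\<close> is subtracted, and the difference satisfies the Cauchy-Riemann equation. The
  iterated conjugate derivatives are supplied as a family \<open>g j\<close>, so that the induction
  step only shifts the index.\<close>

lemma polyanalytic_1d:
  assumes "\<And>j \<zeta>. j < m \<Longrightarrow> (g j has_derivative g' j \<zeta>) (at \<zeta>)"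
    and "\<And>j \<zeta>. j < m \<Longrightarrow> (g' j \<zeta> 1 + \<i> * g' j \<zeta> \<i>) / 2 = g (Suc j) \<zeta>"
    and "\<And>\<zeta>. g m \<zeta> = 0"
  shows "\<exists>a. (\<forall>k<m. a k holomorphic_on UNIV) \<and> (\<forall>\<zeta>. g 0 \<zeta> = (\<Sum>k<m. cnj \<zeta> ^ k * a k \<zeta>))"
  using assms
proof (induction m arbitrary: g g')
  case (Suc m)
  have "\<exists>a. (\<forall>k<m. a k holomorphic_on UNIV) \<and> (\<forall>\<zeta>. g (Suc 0) \<zeta> = (\<Sum>k<m. cnj \<zeta> ^ k * a k \<zeta>))"
    by (rule Suc.IH[where g' = "\<lambda>j. g' (Suc j)"]) (use Suc.prems in auto)
  then obtain b where hol: "\<And>k. k < m \<Longrightarrow> b k holomorphic_on UNIV"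
    and b: "\<And>\<zeta>. g (Suc 0) \<zeta> = (\<Sum>k<m. cnj \<zeta> ^ k * b k \<zeta>)" by blast
  define B where "B \<zeta> = (\<Sum>k<m. cnj \<zeta> ^ Suc k * (b k \<zeta> / of_nat (Suc k)))" for \<zeta>
  define B' where "B' \<zeta> h = (\<Sum>k<m. cnj \<zeta> ^ Suc k * (deriv (b k) \<zeta> / of_nat (Suc k) * h)
      + of_nat (Suc k) * cnj h * cnj \<zeta> ^ k * (b k \<zeta> / of_nat (Suc k)))" for \<zeta> h
  have B: "(B has_derivative B' \<zeta>) (at \<zeta>)" for \<zeta>
    unfolding B_def B'_def
  proof (intro has_derivative_sum has_derivative_mult)
    fix k assume "k \<in> {..<m}"
    then have "(b k has_field_derivative deriv (b k) \<zeta>) (at \<zeta>)"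
      using holomorphic_derivI[OF hol open_UNIV, of k \<zeta>] by simp
    from DERIV_cdivide[OF this, of "of_nat (Suc k)"]
    show "((\<lambda>\<zeta>. b k \<zeta> / of_nat (Suc k)) has_derivative (\<lambda>h. deriv (b k) \<zeta> / of_nat (Suc k) * h)) (at \<zeta>)"
      unfolding has_field_derivative_def .
    show "((\<lambda>\<zeta>. cnj \<zeta> ^ Suc k) has_derivative (\<lambda>h. of_nat (Suc k) * cnj h * cnj \<zeta> ^ k)) (at \<zeta>)"
      using has_derivative_power[OF bounded_linear.has_derivative[OF bounded_linear_cnj has_derivative_ident],
          where n = "Suc k", unfolded diff_Suc_1] .
  qed
  define G where "G \<zeta> = g 0 \<zeta> - B \<zeta>" for \<zeta>
  have G: "(G has_derivative (\<lambda>h. g' 0 \<zeta> h - B' \<zeta> h)) (at \<zeta>)" for \<zeta>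
    unfolding G_def by (intro has_derivative_diff B Suc.prems(1)) simp
  have B2: "(B' \<zeta> 1 + \<i> * B' \<zeta> \<i>) / 2 = g (Suc 0) \<zeta>" for \<zeta>
    unfolding b B'_def sum_distrib_left sum.distrib[symmetric] sum_divide_distrib
  proof (intro sum.cong refl)
    fix k
    define N :: complex where "N = of_nat (Suc k)"
    define y where "y = b k \<zeta> / N"
    have "N \<noteq> 0" unfolding N_def by (simp del: of_nat_Suc)
    then have y: "b k \<zeta> = N * y" by (simp add: y_def)
    show "(cnj \<zeta> ^ Suc k * (deriv (b k) \<zeta> / of_nat (Suc k) * 1)
         + of_nat (Suc k) * cnj 1 * cnj \<zeta> ^ k * (b k \<zeta> / of_nat (Suc k))
         + \<i> * (cnj \<zeta> ^ Suc k * (deriv (b k) \<zeta> / of_nat (Suc k) * \<i>)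
         + of_nat (Suc k) * cnj \<i> * cnj \<zeta> ^ k * (b k \<zeta> / of_nat (Suc k)))) / 2
        = cnj \<zeta> ^ k * b k \<zeta>"
      unfolding N_def[symmetric] y_def[symmetric] y by (simp add: algebra_simps)
  qed
  have "(G has_field_derivative (g' 0 \<zeta> 1 - B' \<zeta> 1)) (at \<zeta>)" for \<zeta>
  proof -
    define D where "D h = g' 0 \<zeta> h - B' \<zeta> h" for h
    have lin: "linear D" unfolding D_def using has_derivative_linear[OF G] by blast
    have "(D 1 + \<i> * D \<i>) / 2 = 0"
      using B2[of \<zeta>] Suc.prems(2)[of 0 \<zeta>] by (simp add: D_def algebra_simps)
    then have "\<i> * (D 1 + \<i> * D \<i>) = 0" by simp
    \<comment> \<open>A real-linear map with D \<i> = \<i> D 1 is multiplication by D 1, so the real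
      derivative is a complex one.\<close>
    then have Di: "D \<i> = \<i> * D 1" by (simp add: algebra_simps)
    have "D h = D 1 * h" for h
    proof -
      have "h = Re h *\<^sub>R 1 + Im h *\<^sub>R \<i>" by (simp add: complex_eq_iff)
      then have "D h = Re h *\<^sub>R D 1 + Im h *\<^sub>R D \<i>"
        by (metis lin linear_add linear_cmul)
      then show ?thesis unfolding Di by (simp add: complex_eq_iff algebra_simps)
    qed
    then have "(\<lambda>h. g' 0 \<zeta> h - B' \<zeta> h) = (*) (g' 0 \<zeta> 1 - B' \<zeta> 1)"
      unfolding D_def by (rule ext)
    from arg_cong[OF this, of "\<lambda>d. (G has_derivative d) (at \<zeta>)"] G[of \<zeta>]
    show ?thesis unfolding has_field_derivative_def by blast
  qed
  then have Gh: "G holomorphic_on UNIV" by (auto simp: holomorphic_on_open)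
  define a where "a k = (case k of 0 \<Rightarrow> G | Suc k \<Rightarrow> (\<lambda>\<zeta>. b k \<zeta> / of_nat (Suc k)))" for k
  show ?case
  proof (intro exI[of _ a] conjI allI impI)
    show "a k holomorphic_on UNIV" if "k < Suc m" for k
      using that Gh hol by (auto simp: a_def split: nat.split intro!: holomorphic_intros)
    fix \<zeta>
    have "(\<Sum>k<Suc m. cnj \<zeta> ^ k * a k \<zeta>) = G \<zeta> + B \<zeta>"
      unfolding sum.lessThan_Suc_shift by (simp add: a_def B_def)
    then show "g 0 \<zeta> = (\<Sum>k<Suc m. cnj \<zeta> ^ k * a k \<zeta>)" by (simp add: G_def)
  qed
qed simp

text \<open>Iterating \<open>dbar_along w\<close> iterates the conjugate derivative in \<zeta> along
  the line, whatever its base point, and the m-th iterate vanishes; so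
  \<open>polyanalytic_1d\<close> applies.\<close>

lemma m_analytic_slice:
  fixes f :: "complex^'n \<Rightarrow> complex"
  assumes f: "m_analytic m f"
  shows "\<exists>a. (\<forall>k<m. a k holomorphic_on UNIV) \<and> (\<forall>\<zeta>. f (z + \<zeta> *s w) = (\<Sum>k<m. cnj \<zeta> ^ k * a k \<zeta>))"
proof -
  have sm: "smooth f" using f by (simp add: m_analytic_def)
  define F where "F j = (dbar_along w ^^ j) f" for j
  have F: "smooth (F j)" for j unfolding F_def by (rule smooth_dbar_along_power[OF sm])
  define D where "D j \<zeta> = frechet_derivative (F j) (at (z + \<zeta> *s w))" for j \<zeta>
  have "\<exists>a. (\<forall>k<m. a k holomorphic_on UNIV) \<and> (\<forall>\<zeta>. F 0 (z + \<zeta> *s w) = (\<Sum>k<m. cnj \<zeta> ^ k * a k \<zeta>))"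
  proof (rule polyanalytic_1d[where g = "\<lambda>j \<zeta>. F j (z + \<zeta> *s w)" and g' = "\<lambda>j \<zeta> h. D j \<zeta> (h *s w)"])
    fix j \<zeta>
    have "bounded_linear (\<lambda>h. h *s w)"
      unfolding linear_conv_bounded_linear[symmetric]
      by (rule linearI) (auto simp: vec_eq_iff algebra_simps)
    then have "((\<lambda>\<zeta>. z + \<zeta> *s w) has_derivative (\<lambda>h. h *s w)) (at \<zeta>)"
      using has_derivative_add[OF has_derivative_const bounded_linear_imp_has_derivative] by fastforce
    from diff_chain_at[OF this smooth_has_derivative[OF F]]
    show "((\<lambda>\<zeta>. F j (z + \<zeta> *s w)) has_derivative (\<lambda>h. D j \<zeta> (h *s w))) (at \<zeta>)"
      by (simp add: o_def D_def)
    have "linear (D j \<zeta>)" unfolding D_def by (rule has_derivative_linear[OF smooth_has_derivative[OF F]])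
    from dbar_slice[OF this, of w]
    show "(D j \<zeta> (1 *s w) + \<i> * D j \<zeta> (\<i> *s w)) / 2 = F (Suc j) (z + \<zeta> *s w)"
      by (simp add: F_def dbar_along_def D_def dbar_def)
    show "F m (z + \<zeta> *s w) = 0"
      unfolding F_def using dbar_along_power_eq_0[OF sm m_analytic_foldr_dbar[OF f]] by simp
  qed
  then show ?thesis by (simp add: F_def)
qed

text \<open>A class of functions, polynomial of degree at most \<open>d\<close> in the conjugate variables,
  that is visibly closed under directional derivatives.\<close>

inductive conj_poly :: "nat \<Rightarrow> (complex^'n \<Rightarrow> complex) \<Rightarrow> bool" where
  const: "conj_poly 0 (\<lambda>_. c)"
| coord: "conj_poly 0 (\<lambda>z. z $ r)"
| cnj_coord: "conj_poly 1 (\<lambda>z. cnj (z $ r))"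
| exp: "conj_poly 0 f \<Longrightarrow> conj_poly 0 (\<lambda>z. exp (f z))"
| add: "conj_poly d f \<Longrightarrow> conj_poly d g \<Longrightarrow> conj_poly d (\<lambda>z. f z + g z)"
| mult: "conj_poly d f \<Longrightarrow> conj_poly e g \<Longrightarrow> conj_poly (d + e) (\<lambda>z. f z * g z)"
| mono: "conj_poly d f \<Longrightarrow> d \<le> e \<Longrightarrow> conj_poly e f"

lemma conj_poly_const: "conj_poly d (\<lambda>_. c)"
  using conj_poly.mono[OF conj_poly.const] by blast

lemma conj_poly_cmult: "conj_poly d f \<Longrightarrow> conj_poly d (\<lambda>z. c * f z)"
  using conj_poly.mult[OF conj_poly.const, of d f c] by simp

text \<open>Degree at most d - 1, with the zero function alone for d = 0. Truncated subtraction
  would give degree 0 there and lose that conjugate derivatives of holomorphic functions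
  vanish.\<close>

definition conj_poly_lower :: "nat \<Rightarrow> (complex^'n \<Rightarrow> complex) \<Rightarrow> bool" where
  "conj_poly_lower d f \<longleftrightarrow> (case d of 0 \<Rightarrow> f = (\<lambda>_. 0) | Suc e \<Rightarrow> conj_poly e f)"

lemma conj_poly_lower_zero: "conj_poly_lower d (\<lambda>_. 0)"
  by (simp add: conj_poly_lower_def conj_poly_const split: nat.split)

lemma conj_poly_lower_mono: "conj_poly_lower d f \<Longrightarrow> d \<le> e \<Longrightarrow> conj_poly_lower e f"
  by (auto simp: conj_poly_lower_def conj_poly_const split: nat.splits intro: conj_poly.mono)

lemma conj_poly_lower_add:
  "conj_poly_lower d f \<Longrightarrow> conj_poly_lower d g \<Longrightarrow> conj_poly_lower d (\<lambda>z. f z + g z)"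
  by (auto simp: conj_poly_lower_def split: nat.splits intro: conj_poly.add)

lemma conj_poly_lower_mult:
  assumes "conj_poly d f" "conj_poly_lower e g" shows "conj_poly_lower (d + e) (\<lambda>z. f z * g z)"
proof (cases e)
  case 0
  then have "g = (\<lambda>_. 0)" using assms(2) by (simp add: conj_poly_lower_def)
  then show ?thesis by (simp add: conj_poly_lower_zero)
qed (use assms in \<open>auto simp: conj_poly_lower_def intro: conj_poly.mult\<close>)

text \<open>Induction on the generation of f. By the product rule a conjugate derivative hits one
  factor at a time, and that factor loses a degree. Exponentials are formed in degree 0 only, so the
  derivative hitting them is zero.\<close>

lemma conj_poly_derivative:
  fixes f :: "complex^'n \<Rightarrow> complex"
  assumes "conj_poly d f"
  shows "\<exists>D. (\<forall>x. (f has_derivative D x) (at x)) \<and> (\<forall>h. conj_poly d (\<lambda>x. D x h)) \<and>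
    (\<forall>r. conj_poly_lower d (\<lambda>x. (D x (axis r 1) + \<i> * D x (axis r \<i>)) / 2))"
  using assms
proof induction
  case (const c)
  show ?case
    by (intro exI[of _ "\<lambda>_ _. 0"]) (auto simp: conj_poly_lower_zero conj_poly_const)
next
  case (coord r)
  have "(\<lambda>x. (axis s 1 $ r + \<i> * axis s \<i> $ r) / 2) = (\<lambda>_::complex^'n. 0)" for s
    by (auto simp: axis_def)
  moreover have "((\<lambda>z. z $ r) has_derivative (\<lambda>h. h $ r)) (at x)" for x :: "complex^'n"
    by (rule bounded_linear_imp_has_derivative[OF bounded_linear_vec_nth])
  ultimately show ?case
    by (intro exI[of _ "\<lambda>_ h. h $ r"]) (auto simp: conj_poly_lower_zero conj_poly_const)
next
  case (cnj_coord r)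
  have "((\<lambda>z. cnj (z $ r)) has_derivative (\<lambda>h. cnj (h $ r))) (at x)" for x :: "complex^'n"
    by (rule bounded_linear.has_derivative[OF bounded_linear_cnj
      bounded_linear_imp_has_derivative[OF bounded_linear_vec_nth]])
  then show ?case
    by (intro exI[of _ "\<lambda>_ h. cnj (h $ r)"]) (auto simp: conj_poly_lower_def conj_poly_const)
next
  case (exp f)
  then obtain D where D: "\<And>x. (f has_derivative D x) (at x)" "\<And>h. conj_poly 0 (\<lambda>x. D x h)"
    "\<And>r. conj_poly_lower 0 (\<lambda>x. (D x (axis r 1) + \<i> * D x (axis r \<i>)) / 2)" by blast
  have "((\<lambda>z. exp (f z)) has_derivative (\<lambda>h. exp (f x) * D x h)) (at x)" for x
    using has_derivative_compose[OF D(1) DERIV_exp[unfolded has_field_derivative_def]] by (simp add: o_def)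
  moreover have "conj_poly 0 (\<lambda>x. exp (f x) * D x h)" for h
    using conj_poly.mult[OF conj_poly.exp[OF exp.hyps] D(2)] by simp
  moreover have "conj_poly_lower 0 (\<lambda>x. (exp (f x) * D x (axis r 1) + \<i> * (exp (f x) * D x (axis r \<i>))) / 2)" for r
    using conj_poly_lower_mult[OF conj_poly.exp[OF exp.hyps] D(3)[of r]] by (simp add: algebra_simps)
  ultimately show ?case by (intro exI[of _ "\<lambda>x h. exp (f x) * D x h"]) blast
next
  case (add d f g)
  then obtain D E where D: "\<And>x. (f has_derivative D x) (at x)" "\<And>h. conj_poly d (\<lambda>x. D x h)"
    "\<And>r. conj_poly_lower d (\<lambda>x. (D x (axis r 1) + \<i> * D x (axis r \<i>)) / 2)"
    and E: "\<And>x. (g has_derivative E x) (at x)" "\<And>h. conj_poly d (\<lambda>x. E x h)"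
    "\<And>r. conj_poly_lower d (\<lambda>x. (E x (axis r 1) + \<i> * E x (axis r \<i>)) / 2)" by blast
  have "conj_poly_lower d (\<lambda>x. (D x (axis r 1) + E x (axis r 1) + \<i> * (D x (axis r \<i>) + E x (axis r \<i>))) / 2)" for r
    using conj_poly_lower_add[OF D(3) E(3), of r r] by (simp add: algebra_simps add_divide_distrib)
  then show ?case
    using has_derivative_add[OF D(1) E(1)] conj_poly.add[OF D(2) E(2)]
    by (intro exI[of _ "\<lambda>x h. D x h + E x h"]) blast
next
  case (mult d f e g)
  then obtain D E where D: "\<And>x. (f has_derivative D x) (at x)" "\<And>h. conj_poly d (\<lambda>x. D x h)"
    "\<And>r. conj_poly_lower d (\<lambda>x. (D x (axis r 1) + \<i> * D x (axis r \<i>)) / 2)"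
    and E: "\<And>x. (g has_derivative E x) (at x)" "\<And>h. conj_poly e (\<lambda>x. E x h)"
    "\<And>r. conj_poly_lower e (\<lambda>x. (E x (axis r 1) + \<i> * E x (axis r \<i>)) / 2)" by blast
  have "conj_poly_lower (d + e) (\<lambda>x. f x * ((E x (axis r 1) + \<i> * E x (axis r \<i>)) / 2)
      + g x * ((D x (axis r 1) + \<i> * D x (axis r \<i>)) / 2))" for r
    using conj_poly_lower_add[OF conj_poly_lower_mult[OF mult.hyps(1) E(3)[of r]]
        conj_poly_lower_mult[OF mult.hyps(2) D(3)[of r], unfolded add.commute[of e]]] .
  then have l: "conj_poly_lower (d + e) (\<lambda>x. (f x * E x (axis r 1) + D x (axis r 1) * g x
      + \<i> * (f x * E x (axis r \<i>) + D x (axis r \<i>) * g x)) / 2)" for r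
    by (simp add: algebra_simps add_divide_distrib)
  show ?case
    using has_derivative_mult[OF D(1) E(1)] conj_poly.add[OF conj_poly.mult[OF mult.hyps(1) E(2)]
      conj_poly.mult[OF D(2) mult.hyps(2)]] l
    by (intro exI[of _ "\<lambda>x h. f x * E x h + D x h * g x"]) blast
next
  case (mono d f e)
  then show ?case by (meson conj_poly.mono conj_poly_lower_mono)
qed

lemma conj_poly_frechet:
  assumes "conj_poly d f"
  shows "f differentiable (at x)" "conj_poly d (\<lambda>x. frechet_derivative f (at x) h)"
    "conj_poly_lower d (dbar r f)"
proof -
  obtain D where D: "\<And>x. (f has_derivative D x) (at x)" "\<And>h. conj_poly d (\<lambda>x. D x h)"
    "\<And>r. conj_poly_lower d (\<lambda>x. (D x (axis r 1) + \<i> * D x (axis r \<i>)) / 2)"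
    using conj_poly_derivative[OF assms] by blast
  have e: "frechet_derivative f (at x) = D x" for x using frechet_derivative_at[OF D(1)] by simp
  show "f differentiable (at x)" using D(1) by (auto simp: differentiable_def)
  show "conj_poly d (\<lambda>x. frechet_derivative f (at x) h)" "conj_poly_lower d (dbar r f)"
    using D by (simp_all add: e dbar_def[abs_def])
qed

lemma conj_poly_smooth: "conj_poly d f \<Longrightarrow> smooth f"
proof -
  assume "conj_poly d f"
  then have "Ck j f" for j
  proof (induction j arbitrary: f)
    case 0
    then show ?case
      using conj_poly_frechet(1) by (auto intro!: continuous_at_imp_continuous_on differentiable_imp_continuous_within)
  qed (auto simp: conj_poly_frechet)
  then show ?thesis by (simp add: smooth_def)
qed

lemma conj_poly_foldr_dbar:
  "conj_poly d f \<Longrightarrow> d < length rs \<Longrightarrow> foldr dbar rs f = (\<lambda>_. 0)"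
proof -
  assume f: "conj_poly d f" and d: "d < length rs"
  \<comment> \<open>The claim is strengthened by the remaining degree, which each application of
    \<open>dbar\<close> lowers until the function vanishes.\<close>
  have "(length rs \<le> d \<longrightarrow> conj_poly (d - length rs) (foldr dbar rs f)) \<and>
      (d < length rs \<longrightarrow> foldr dbar rs f = (\<lambda>_. 0))"
  proof (induction rs)
    case (Cons r rs)
    show ?case
    proof (cases "length rs \<le> d")
      case True
      then have "conj_poly_lower (d - length rs) (dbar r (foldr dbar rs f))"
        using Cons conj_poly_frechet(3) by blast
      then show ?thesis using True
        by (cases "d - length rs") (auto simp: conj_poly_lower_def Suc_le_eq diff_Suc split: nat.splits)
    qed (use Cons in \<open>auto simp: dbar_zero\<close>)
  qed (use f in auto)
  with d show ?thesis by blast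
qed

lemma conj_poly_m_analytic:
  assumes "conj_poly d f" "d < m" shows "m_analytic m f"
  unfolding m_analytic_def
proof (intro conjI allI impI)
  show "smooth f" by (rule conj_poly_smooth[OF assms(1)])
  fix k :: "nat ^ 'a" and z assume "mi_size k = m"
  moreover have "length (concat (map (\<lambda>r. replicate (k $ r) r) index_list)) = mi_size k"
    by (simp add: length_concat o_def mi_size_def sum_list_distinct_conv_sum_set index_list)
  ultimately show "Dbar k f z = 0"
    using conj_poly_foldr_dbar[OF assms(1)] assms(2) by (simp add: Dbar_foldr)
qed

lemma conj_poly_sum: "(\<And>i. i \<in> I \<Longrightarrow> conj_poly d (f i)) \<Longrightarrow> conj_poly d (\<lambda>z. \<Sum>i\<in>I. f i z)"
  by (induction I rule: infinite_finite_induct) (auto simp: conj_poly_const intro: conj_poly.add)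

lemma conj_poly_power: "conj_poly d f \<Longrightarrow> conj_poly (d * p) (\<lambda>z. f z ^ p)"
proof (induction p)
  case (Suc p)
  then show ?case using conj_poly.mult[of d f "d * p" "\<lambda>z. f z ^ p"] by simp
qed (auto simp: conj_poly_const)

section \<open>The Fourier transform of a Laguerre polynomial\<close>

text \<open>The probabilists' Hermite polynomials He_j. They are adapted to the Gaussian exp
  (-u^2/2): their three-term recurrence is the one that integration by parts produces below.\<close>

fun hermite_prob :: "nat \<Rightarrow> real \<Rightarrow> real" where
  "hermite_prob 0 x = 1"
| "hermite_prob (Suc 0) x = x"
| "hermite_prob (Suc (Suc j)) x = x * hermite_prob (Suc j) x - real (Suc j) * hermite_prob j x"

lemma hermite_prob_Suc: "hermite_prob (Suc j) x = x * hermite_prob j x - real j * hermite_prob (j - 1) x"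
  by (cases j) simp_all

lemma DERIV_hermite_prob: "(hermite_prob j has_real_derivative real j * hermite_prob (j - 1) x) (at x)"
proof (induction j x rule: hermite_prob.induct)
  case (3 j x)
  have "((\<lambda>x. x * hermite_prob (Suc j) x - real (Suc j) * hermite_prob j x) has_real_derivative
      real (Suc (Suc j)) * hermite_prob (Suc j) x) (at x)"
    by (rule derivative_eq_intros 3 refl)+ (simp add: hermite_prob_Suc[of j] algebra_simps)
  then show ?case by simp
qed simp_all

text \<open>Each differentiation in Rodrigues' formula raises the index by He_(j+1) = x He_j - j
  He_(j-1), in which the last term is the derivative of He_j.\<close>

lemma Hermite_eq_hermite_prob: "Hermite j t = sqrt 2 ^ j * hermite_prob j (sqrt 2 * t)"
proof -
  have "(deriv ^^ j) (\<lambda>s. exp (- s\<^sup>2)) = (\<lambda>s. (-1) ^ j * (sqrt 2 ^ j * hermite_prob j (sqrt 2 * s) * exp (- s\<^sup>2)))"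
  proof (induction j)
    case (Suc j)
    have "((\<lambda>s. (-1) ^ j * (sqrt 2 ^ j * hermite_prob j (sqrt 2 * s) * exp (- s\<^sup>2))) has_real_derivative
        (-1) ^ Suc j * (sqrt 2 ^ Suc j * hermite_prob (Suc j) (sqrt 2 * s) * exp (- s\<^sup>2))) (at s)" for s
    proof -
      have d: "((\<lambda>s. hermite_prob j (sqrt 2 * s)) has_real_derivative real j * hermite_prob (j - 1) (sqrt 2 * s) * sqrt 2) (at s)"
        by (rule DERIV_chain2[OF DERIV_hermite_prob]) (auto intro!: derivative_eq_intros)
      have two: "sqrt 2 * (sqrt 2 * z) = 2 * z" for z :: real by (simp flip: mult.assoc)
      show ?thesis
        by (rule derivative_eq_intros d refl)+ (simp add: hermite_prob_Suc algebra_simps two)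
    qed
    then show ?case by (simp add: Suc DERIV_imp_deriv fun_eq_iff)
  qed simp
  then have "Hermite j t = ((-1) ^ j * (-1) ^ j) * (exp (t\<^sup>2) * exp (- t\<^sup>2)) * (sqrt 2 ^ j * hermite_prob j (sqrt 2 * t))"
    by (simp only: Hermite_def mult_ac)
  moreover have "(-1) ^ j * (-1) ^ j = (1 :: real)" by (simp flip: power_mult_distrib)
  moreover have "exp (t\<^sup>2) * exp (- t\<^sup>2) = 1" by (simp flip: exp_add)
  ultimately show ?thesis by simp
qed

text \<open>For equal indices the two inverse square roots of the normalisation combine, and the 2^j
  in it cancels the two factors sqrt 2^j.\<close>

lemma hermite_fun_mult:
  "hermite_fun j a * hermite_fun j b
    = exp (- (a\<^sup>2 + b\<^sup>2) / 2) * hermite_prob j (sqrt 2 * a) * hermite_prob j (sqrt 2 * b) / (fact j * sqrt pi)"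
proof -
  define c where "c = 2 ^ j * fact j * sqrt pi"
  have "c > 0" by (simp add: c_def)
  then have "c powr (- 1 / 2) * c powr (- 1 / 2) = 1 / c"
    by (simp add: powr_add[symmetric] powr_minus_divide)
  moreover have "sqrt 2 ^ j * sqrt 2 ^ j = 2 ^ j" by (simp flip: power_mult_distrib)
  moreover have "exp (- a\<^sup>2 / 2) * exp (- b\<^sup>2 / 2) = exp (- (a\<^sup>2 + b\<^sup>2) / 2)"
    by (simp add: exp_add[symmetric] add_divide_distrib)
  moreover have "hermite_fun j a * hermite_fun j b = (c powr (- 1 / 2) * c powr (- 1 / 2)) *
      (exp (- a\<^sup>2 / 2) * exp (- b\<^sup>2 / 2)) * (sqrt 2 ^ j * sqrt 2 ^ j) * hermite_prob j (sqrt 2 * a) * hermite_prob j (sqrt 2 * b)"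
    by (simp only: hermite_fun_def Hermite_eq_hermite_prob c_def mult_ac)
  ultimately show ?thesis by (simp add: c_def)
qed

section \<open>Gaussian integrals with a Fourier phase\<close>

definition gauss_wave :: "real \<Rightarrow> real \<Rightarrow> complex" where
  "gauss_wave \<sigma> u = exp (of_real (- u\<^sup>2 / 2) - \<i> * of_real (u * \<sigma>))"

lemma norm_gauss_wave: "norm (gauss_wave \<sigma> u) = exp (- u\<^sup>2 / 2)"
  by (simp add: gauss_wave_def)

lemma continuous_gauss_wave: "continuous_on UNIV (gauss_wave \<sigma>)"
  unfolding gauss_wave_def by (intro continuous_intros) simp

lemma gauss_wave_power_limit:
  "((\<lambda>u. gauss_wave \<sigma> u * of_real u ^ p) \<longlongrightarrow> 0) at_top"
  "((\<lambda>u. gauss_wave \<sigma> u * of_real u ^ p) \<longlongrightarrow> 0) at_bot"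
proof -
  have sq: "filterlim (\<lambda>u::real. u\<^sup>2 / 2) at_top at_top"
    by real_asymp
  from filterlim_compose[OF tendsto_power_div_exp_0 this, of p]
  have "((\<lambda>u::real. 2 ^ p * ((u\<^sup>2 / 2) ^ p / exp (u\<^sup>2 / 2))) \<longlongrightarrow> 2 ^ p * 0) at_top"
    by (rule tendsto_mult_left)
  moreover have "2 ^ p * ((u\<^sup>2 / 2) ^ p / exp (u\<^sup>2 / 2)) = (u\<^sup>2) ^ p * exp (- u\<^sup>2 / 2)" for u :: real
  proof -
    have "exp (- u\<^sup>2 / 2) = 1 / exp (u\<^sup>2 / 2)" by (simp add: exp_minus inverse_eq_divide)
    then show ?thesis by (simp only: power_divide) simp
  qed
  ultimately have lim: "((\<lambda>u::real. (u\<^sup>2) ^ p * exp (- u\<^sup>2 / 2)) \<longlongrightarrow> 0) at_top"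
    by simp
  have "((\<lambda>u::real. \<bar>u\<bar> ^ p * exp (- u\<^sup>2 / 2)) \<longlongrightarrow> 0) at_top"
  proof (rule tendsto_sandwich[OF _ _ tendsto_const lim])
    show "\<forall>\<^sub>F u::real in at_top. \<bar>u\<bar> ^ p * exp (- u\<^sup>2 / 2) \<le> (u\<^sup>2) ^ p * exp (- u\<^sup>2 / 2)"
      using eventually_ge_at_top[of 1]
    proof eventually_elim
      case (elim u)
      then have "\<bar>u\<bar> \<le> u\<^sup>2" by (simp add: power2_eq_square)
      then show ?case by (intro mult_right_mono power_mono) auto
    qed
  qed simp
  then have n: "((\<lambda>u. norm (gauss_wave \<sigma> u * of_real u ^ p)) \<longlongrightarrow> 0) at_top" for \<sigma>
    by (simp add: norm_mult norm_gauss_wave norm_power mult.commute)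
  then show "((\<lambda>u. gauss_wave \<sigma> u * of_real u ^ p) \<longlongrightarrow> 0) at_top"
    by (rule tendsto_norm_zero_cancel)
  have "((\<lambda>u. norm (gauss_wave \<sigma> u * of_real u ^ p)) \<longlongrightarrow> 0) at_bot"
    unfolding filterlim_at_bot_mirror using n
    by (simp add: norm_mult norm_gauss_wave norm_power)
  then show "((\<lambda>u. gauss_wave \<sigma> u * of_real u ^ p) \<longlongrightarrow> 0) at_bot"
    by (rule tendsto_norm_zero_cancel)
qed

lemma gauss_wave_power_integrable: "integrable lborel (\<lambda>u. gauss_wave \<sigma> u * of_real u ^ p)"
proof -
  have "integrable lborel (\<lambda>x. sqrt (2 * pi) * (std_normal_density x * x ^ p))"
    by (intro integrable_mult_right) (rule integrable_std_normal_moment)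
  then have "integrable lborel (\<lambda>x::real. exp (- x\<^sup>2 / 2) * x ^ p)"
    by (simp add: std_normal_density_def)
  then show ?thesis
  proof (rule Bochner_Integration.integrable_bound)
    show "(\<lambda>u. gauss_wave \<sigma> u * of_real u ^ p) \<in> borel_measurable lborel"
      using borel_measurable_continuous_onI[OF continuous_gauss_wave] by measurable
  qed (simp add: norm_mult norm_gauss_wave norm_power abs_mult power_abs)
qed

text \<open>The exponents are kept independent, although the Laguerre transform uses j = k:
  integration by parts changes one of them at a time.\<close>

definition gauss_int :: "real \<Rightarrow> real \<Rightarrow> nat \<Rightarrow> nat \<Rightarrow> real \<Rightarrow> complex" where
  "gauss_int \<sigma> \<delta> j k u = gauss_wave \<sigma> u * ((\<i> * of_real u - of_real \<delta>) ^ j * (\<i> * of_real u + of_real \<delta>) ^ k)"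

lemma gauss_int_properties:
  "integrable lborel (gauss_int \<sigma> \<delta> j k)"
  "(gauss_int \<sigma> \<delta> j k \<longlongrightarrow> 0) at_top"
  "(gauss_int \<sigma> \<delta> j k \<longlongrightarrow> 0) at_bot"
proof -
  define Q where "Q g \<longleftrightarrow> integrable lborel g \<and> (g \<longlongrightarrow> 0) at_top \<and> (g \<longlongrightarrow> 0) at_bot"
    for g :: "real \<Rightarrow> complex"
  have lin: "Q (\<lambda>u. a * f u + b * g u)" if "Q f" "Q g" for f g a b
  proof -
    have "((\<lambda>u. a * f u + b * g u) \<longlongrightarrow> a * 0 + b * 0) at_top" "((\<lambda>u. a * f u + b * g u) \<longlongrightarrow> a * 0 + b * 0) at_bot"
      using that unfolding Q_def by (intro tendsto_intros; blast)+
    then show ?thesis using that unfolding Q_def by simp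
  qed
  \<comment> \<open>The additional power u^p makes the induction close: splitting off one linear
    factor leads to the same claim for p + 1 and for p.\<close>
  have "Q (\<lambda>u. gauss_wave \<sigma> u * of_real u ^ p * ((\<i> * of_real u - of_real \<delta>) ^ j * (\<i> * of_real u + of_real \<delta>) ^ k))" for p
  proof (induction j arbitrary: p)
    case 0
    show ?case
    proof (induction k arbitrary: p)
      case 0
      then show ?case
        using gauss_wave_power_integrable gauss_wave_power_limit by (simp add: Q_def)
    next
      case (Suc k)
      from lin[OF Suc[of "Suc p"] Suc[of p], of \<i> "of_real \<delta>"] show ?case
        by (simp add: algebra_simps)
    qed
  next
    case (Suc j)
    from lin[OF Suc[of "Suc p"] Suc[of p], of \<i> "- of_real \<delta>"] show ?case
      by (simp add: algebra_simps)
  qed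
  from this[of 0] show "integrable lborel (gauss_int \<sigma> \<delta> j k)"
    "(gauss_int \<sigma> \<delta> j k \<longlongrightarrow> 0) at_top" "(gauss_int \<sigma> \<delta> j k \<longlongrightarrow> 0) at_bot"
    by (simp_all add: Q_def gauss_int_def[abs_def])
qed

lemma integral_derivative_eq_0:
  fixes F f :: "real \<Rightarrow> complex"
  assumes "\<And>x. (F has_vector_derivative f x) (at x)" and "continuous_on UNIV f" and "integrable lborel f"
    and "(F \<longlongrightarrow> 0) at_top" and "(F \<longlongrightarrow> 0) at_bot"
  shows "(LINT x|lborel. f x) = 0"
proof -
  have "(LBINT x=-\<infinity>..\<infinity>. f x) = 0 - 0"
  proof (rule interval_integral_FTC_integrable)
    show "set_integrable lborel (einterval (-\<infinity>) \<infinity>) f"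
      using assms(3) by (simp add: set_integrable_def einterval_eq)
    show "isCont f x" for x using assms(2) by (simp add: continuous_on_eq_continuous_at)
  qed (use assms in \<open>auto simp: ereal_tendsto_simps\<close>)
  then show ?thesis
    by (simp add: interval_lebesgue_integral_def einterval_eq set_lebesgue_integral_def)
qed

definition gauss_mom :: "real \<Rightarrow> real \<Rightarrow> nat \<Rightarrow> nat \<Rightarrow> complex" where
  "gauss_mom \<sigma> \<delta> j k = (LINT u|lborel. gauss_int \<sigma> \<delta> j k u)"

text \<open>The derivative of \<open>gauss_int \<sigma> \<delta> j k\<close> integrates to 0. The
  Gaussian contributes -u - \<i>\<sigma> = \<i>((\<i>u - \<delta>) + (\<delta> - \<sigma>)), which
  raises j or keeps it; the power rule lowers j or k.\<close>

lemma gauss_mom_parts: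
  "gauss_mom \<sigma> \<delta> (Suc j) k + of_real (\<delta> - \<sigma>) * gauss_mom \<sigma> \<delta> j k
    + of_nat j * gauss_mom \<sigma> \<delta> (j - 1) k + of_nat k * gauss_mom \<sigma> \<delta> j (k - 1) = 0"
proof -
  let ?a = "\<lambda>u. \<i> * complex_of_real u - of_real \<delta>" and ?b = "\<lambda>u. \<i> * complex_of_real u + of_real \<delta>"
  define f where "f u = \<i> * (gauss_int \<sigma> \<delta> (Suc j) k u + of_real (\<delta> - \<sigma>) * gauss_int \<sigma> \<delta> j k u
    + of_nat j * gauss_int \<sigma> \<delta> (j - 1) k u + of_nat k * gauss_int \<sigma> \<delta> j (k - 1) u)" for u
  note int = gauss_int_properties(1)[of \<sigma> \<delta>]
  have "(LINT u|lborel. f u) = 0"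
  proof (rule integral_derivative_eq_0)
    fix u
    have "((\<lambda>z. exp (- z\<^sup>2 / 2 - \<i> * (z * of_real \<sigma>)) * ((\<i> * z - of_real \<delta>) ^ j * (\<i> * z + of_real \<delta>) ^ k))
       has_field_derivative (exp (- z\<^sup>2 / 2 - \<i> * (z * of_real \<sigma>)) * ((- z - \<i> * of_real \<sigma>) * ((\<i> * z - of_real \<delta>) ^ j * (\<i> * z + of_real \<delta>) ^ k)
         + (of_nat j * \<i> * (\<i> * z - of_real \<delta>) ^ (j - 1) * (\<i> * z + of_real \<delta>) ^ k
           + (\<i> * z - of_real \<delta>) ^ j * (of_nat k * \<i> * (\<i> * z + of_real \<delta>) ^ (k - 1)))))) (at z)" for z
      by (rule derivative_eq_intros refl | simp)+ (simp add: algebra_simps)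
    from has_vector_derivative_real_field[OF this, of u UNIV]
    show "(gauss_int \<sigma> \<delta> j k has_vector_derivative f u) (at u)"
      unfolding gauss_int_def[abs_def] gauss_wave_def f_def by (simp add: algebra_simps)
    show "continuous_on UNIV f"
      unfolding f_def gauss_int_def by (intro continuous_intros continuous_gauss_wave)
    show "integrable lborel f"
      unfolding f_def by (intro integrable_mult_right Bochner_Integration.integrable_add int)
  qed (rule gauss_int_properties)+
  then show ?thesis
    unfolding f_def gauss_mom_def by (simp add: int)
qed

lemma gauss_mom_Suc_left:
  "gauss_mom \<sigma> \<delta> (Suc j) k = of_real (\<sigma> - \<delta>) * gauss_mom \<sigma> \<delta> j k
    - of_nat j * gauss_mom \<sigma> \<delta> (j - 1) k - of_nat k * gauss_mom \<sigma> \<delta> j (k - 1)"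
proof -
  have "x = (s - d) * y - a - b" if "x + (d - s) * y + a + b = 0" for x y s d a b :: complex
    using that by (simp add: algebra_simps add_eq_0_iff)
  from this[OF gauss_mom_parts[of \<sigma> \<delta> j k, unfolded of_real_diff]] show ?thesis by simp
qed

lemma gauss_mom_flip: "gauss_mom \<sigma> \<delta> j k = gauss_mom \<sigma> (- \<delta>) k j"
  by (simp add: gauss_mom_def gauss_int_def mult.commute)

lemma gauss_mom_00: "gauss_mom \<sigma> \<delta> 0 0 = of_real (sqrt (2 * pi) * exp (- \<sigma>\<^sup>2 / 2))"
proof -
  have "of_real (exp (- \<sigma>\<^sup>2 / 2)) = char std_normal_distribution (- \<sigma>)"
    by (simp add: char_std_normal_distribution)
  also have "\<dots> = (CLBINT x. std_normal_density x *\<^sub>R iexp (- \<sigma> * x))"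
    unfolding char_def by (rule integral_density) auto
  also have "\<dots> = (CLBINT x. of_real (1 / sqrt (2 * pi)) * gauss_int \<sigma> \<delta> 0 0 x)"
  proof (intro Bochner_Integration.integral_cong refl)
    fix x :: real
    have "gauss_wave \<sigma> x = of_real (exp (- x\<^sup>2 / 2)) * exp (- (\<i> * of_real (x * \<sigma>)))"
      by (simp only: gauss_wave_def exp_of_real[symmetric] exp_add[symmetric] diff_conv_add_uminus)
    then show "std_normal_density x *\<^sub>R iexp (- \<sigma> * x) = of_real (1 / sqrt (2 * pi)) * gauss_int \<sigma> \<delta> 0 0 x"
      by (simp add: std_normal_density_def gauss_int_def scaleR_conv_of_real mult.commute[of x])
  qed
  also have "\<dots> = of_real (1 / sqrt (2 * pi)) * gauss_mom \<sigma> \<delta> 0 0"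
    by (simp add: gauss_mom_def)
  finally have "of_real (sqrt (2 * pi)) * of_real (exp (- \<sigma>\<^sup>2 / 2))
      = of_real (sqrt (2 * pi)) * (of_real (1 / sqrt (2 * pi)) * gauss_mom \<sigma> \<delta> 0 0)" by simp
  also have "\<dots> = gauss_mom \<sigma> \<delta> 0 0"
    unfolding mult.assoc[symmetric] of_real_mult[symmetric] by simp
  finally show ?thesis by simp
qed

text \<open>Up to a Gaussian factor this is the expansion of
  \<open>hermite_prob j (\<sigma> - \<delta>) * hermite_prob k (\<sigma> + \<delta>)\<close>; for \<open>j = k\<close> it is the transform of
  \<open>j!\<close> times a Laguerre polynomial, since \<open>(iu - \<delta>)(iu + \<delta>) = - (u\<^sup>2 + \<delta>\<^sup>2)\<close>.\<close>

definition linearised_product :: "real \<Rightarrow> real \<Rightarrow> nat \<Rightarrow> nat \<Rightarrow> complex" where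
  "linearised_product \<sigma> \<delta> j k = (\<Sum>i\<le>k. of_nat ((j choose i) * (k choose i) * fact i) * gauss_mom \<sigma> \<delta> (j - i) (k - i))"

text \<open>This is the recurrence of He_j(\<sigma> - \<delta>) in j. Pascal's rule splits the
  binomial coefficient over j + 1, and its shifted half cancels the terms that
  \<open>gauss_mom_Suc_left\<close> produces by lowering the second exponent.\<close>

lemma linearised_product_Suc:
  "linearised_product \<sigma> \<delta> (Suc j) k = of_real (\<sigma> - \<delta>) * linearised_product \<sigma> \<delta> j k - of_nat j * linearised_product \<sigma> \<delta> (j - 1) k"
proof -
  let ?A = "gauss_mom \<sigma> \<delta>"
  let ?c = "\<lambda>j i. complex_of_nat ((j choose i) * (k choose i) * fact i)"
  \<comment> \<open>The sum that occurs with both signs and cancels.\<close>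
  define X where "X = (\<Sum>i\<le>k. ?c j i * (of_nat (k - i) * ?A (j - i) (k - i - 1)))"
  have "linearised_product \<sigma> \<delta> (Suc j) k = (\<Sum>i\<le>k. ?c j i * ?A (Suc j - i) (k - i))
      + (\<Sum>i<k. of_nat ((j choose i) * (k choose Suc i) * fact (Suc i)) * ?A (j - i) (k - i - 1))"
  proof (cases k)
    case (Suc l)
    show ?thesis unfolding linearised_product_def Suc
      by (simp only: sum.atMost_Suc_shift lessThan_Suc_atMost) (simp add: sum.distrib algebra_simps)
  qed (simp add: linearised_product_def)
  also have "(\<Sum>i<k. of_nat ((j choose i) * (k choose Suc i) * fact (Suc i)) * ?A (j - i) (k - i - 1)) = X"
  proof -
    have "(k choose Suc i) * fact (Suc i) = (k choose i) * fact i * (k - i)" for i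
    proof -
      have "Suc i * (k choose Suc i) = (k - i) * (k choose i)"
        by (simp only: binomial_absorb_comp binomial_absorption)
      then have "fact i * (Suc i * (k choose Suc i)) = fact i * ((k - i) * (k choose i))" by (rule arg_cong)
      then show ?thesis by (simp only: fact_Suc of_nat_id mult_ac)
    qed
    then have "(j choose i) * (k choose Suc i) * fact (Suc i) = (j choose i) * (k choose i) * fact i * (k - i)" for i
      by (metis mult.assoc)
    then have "(\<Sum>i<k. of_nat ((j choose i) * (k choose Suc i) * fact (Suc i)) * ?A (j - i) (k - i - 1))
       = (\<Sum>i<k. ?c j i * (of_nat (k - i) * ?A (j - i) (k - i - 1)))"
      by (simp only: of_nat_mult mult.assoc)
    also have "\<dots> = X" unfolding X_def by (rule sum.mono_neutral_left) auto
    finally show ?thesis .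
  qed
  also have "(\<Sum>i\<le>k. ?c j i * ?A (Suc j - i) (k - i))
      = (\<Sum>i\<le>k. of_real (\<sigma> - \<delta>) * (?c j i * ?A (j - i) (k - i))
        - of_nat j * (?c (j - 1) i * ?A (j - 1 - i) (k - i))
        - ?c j i * (of_nat (k - i) * ?A (j - i) (k - i - 1)))"
  proof (intro sum.cong refl)
    fix i
    show "?c j i * ?A (Suc j - i) (k - i) = of_real (\<sigma> - \<delta>) * (?c j i * ?A (j - i) (k - i))
        - of_nat j * (?c (j - 1) i * ?A (j - 1 - i) (k - i))
        - ?c j i * (of_nat (k - i) * ?A (j - i) (k - i - 1))"
    \<comment> \<open>\<open>Suc j - i = Suc (j - i)\<close> fails for i > j, but there the binomial
      coefficients vanish.\<close>
    proof (cases "i \<le> j")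
      case True
      have "(j - i) * (j choose i) = j * ((j - 1) choose i)" by (rule binomial_absorb_comp)
      then have b: "of_nat (j - i) * ?c j i = of_nat j * ?c (j - 1) i"
        by (metis of_nat_mult mult.assoc)
      have "?A (Suc j - i) (k - i) = of_real (\<sigma> - \<delta>) * ?A (j - i) (k - i)
          - of_nat (j - i) * ?A (j - 1 - i) (k - i) - of_nat (k - i) * ?A (j - i) (k - i - 1)"
        using gauss_mom_Suc_left[of \<sigma> \<delta> "j - i" "k - i"] True by (simp add: Suc_diff_le diff_commute)
      then have "?c j i * ?A (Suc j - i) (k - i) = of_real (\<sigma> - \<delta>) * (?c j i * ?A (j - i) (k - i))
          - (of_nat (j - i) * ?c j i) * ?A (j - 1 - i) (k - i)
          - ?c j i * (of_nat (k - i) * ?A (j - i) (k - i - 1))"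
        by (simp only: right_diff_distrib mult_ac)
      then show ?thesis unfolding b by (simp only: mult.assoc)
    qed (simp add: binomial_eq_0)
  qed
  also have "\<dots> = of_real (\<sigma> - \<delta>) * linearised_product \<sigma> \<delta> j k - of_nat j * linearised_product \<sigma> \<delta> (j - 1) k - X"
    by (simp add: sum_subtractf sum_distrib_left linearised_product_def X_def)
  finally show ?thesis by simp
qed

text \<open>With second exponent 0, \<open>gauss_mom_Suc_left\<close> is the three-term recurrence
  of He_j; \<open>gauss_mom_flip\<close> carries the result to the other exponent.\<close>

lemma gauss_mom_0_left: "gauss_mom \<sigma> \<delta> 0 k = of_real (hermite_prob k (\<sigma> + \<delta>)) * gauss_mom \<sigma> \<delta> 0 0"
proof -
  have "gauss_mom \<sigma> \<delta> k 0 = of_real (hermite_prob k (\<sigma> - \<delta>)) * gauss_mom \<sigma> \<delta> 0 0" for \<delta>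
  proof (induction k "\<sigma> - \<delta>" rule: hermite_prob.induct)
    case (3 j)
    then show ?case
      using gauss_mom_Suc_left[of \<sigma> \<delta> "Suc j" 0] by (simp add: algebra_simps)
  qed (use gauss_mom_Suc_left[of \<sigma> \<delta> 0 0] in simp_all)
  from this[of "- \<delta>"] show ?thesis
    using gauss_mom_flip[of \<sigma> \<delta> 0 k] gauss_mom_flip[of \<sigma> \<delta> 0 0] by simp
qed

text \<open>Both sides obey the same recurrence in j and agree at j = 0. For \<delta> = 0 this is
  the classical linearisation formula for He_j He_k.\<close>

lemma linearised_product_eq:
  "linearised_product \<sigma> \<delta> j k = of_real (hermite_prob j (\<sigma> - \<delta>) * hermite_prob k (\<sigma> + \<delta>)) * gauss_mom \<sigma> \<delta> 0 0"
proof (induction j "\<sigma> - \<delta>" rule: hermite_prob.induct)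
  case 1
  have "linearised_product \<sigma> \<delta> 0 k = (\<Sum>i\<in>{0}. of_nat ((0 choose i) * (k choose i) * fact i) * gauss_mom \<sigma> \<delta> (0 - i) (k - i))"
    unfolding linearised_product_def by (rule sum.mono_neutral_right) auto
  then have "linearised_product \<sigma> \<delta> 0 k = gauss_mom \<sigma> \<delta> 0 k" by simp
  then show ?case by (simp add: gauss_mom_0_left[of \<sigma> \<delta> k])
next
  case 2
  have "linearised_product \<sigma> \<delta> 0 k = (\<Sum>i\<in>{0}. of_nat ((0 choose i) * (k choose i) * fact i) * gauss_mom \<sigma> \<delta> (0 - i) (k - i))"
    unfolding linearised_product_def by (rule sum.mono_neutral_right) auto
  then have "linearised_product \<sigma> \<delta> 0 k = gauss_mom \<sigma> \<delta> 0 k" by simp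
  then show ?case using linearised_product_Suc[of \<sigma> \<delta> 0 k] by (simp add: gauss_mom_0_left[of \<sigma> \<delta> k])
next
  case (3 j)
  then show ?case using linearised_product_Suc[of \<sigma> \<delta> "Suc j" k] by (simp add: algebra_simps)
qed

section \<open>The transform as a product of Hermite functions\<close>

text \<open>The Laguerre polynomial expands into the diagonal terms
  \<open>gauss_int \<sigma> \<delta> p p\<close>, and their integrals add up to a multiple of
  \<open>linearised_product\<close> at j = k.\<close>

lemma fourier_laguerre:
  "integrable lborel (\<lambda>u. gauss_wave \<sigma> u * of_real (laguerre 0 j (u\<^sup>2 + \<delta>\<^sup>2)))"
  "(LINT u|lborel. gauss_wave \<sigma> u * of_real (laguerre 0 j (u\<^sup>2 + \<delta>\<^sup>2)))
    = of_real (sqrt (2 * pi) * exp (- \<sigma>\<^sup>2 / 2) * hermite_prob j (\<sigma> - \<delta>) * hermite_prob j (\<sigma> + \<delta>) / fact j)"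
proof -
  have e: "gauss_wave \<sigma> u * of_real (laguerre 0 j (u\<^sup>2 + \<delta>\<^sup>2))
      = (\<Sum>p\<le>j. of_real (real (j choose p) / fact p) * gauss_int \<sigma> \<delta> p p u)" for u
  proof -
    have "complex_of_real (- (u\<^sup>2 + \<delta>\<^sup>2)) = (\<i> * of_real u - of_real \<delta>) * (\<i> * of_real u + of_real \<delta>)"
      by (simp add: algebra_simps power2_eq_square)
    then have p: "complex_of_real ((- (u\<^sup>2 + \<delta>\<^sup>2)) ^ p) = (\<i> * of_real u - of_real \<delta>) ^ p * (\<i> * of_real u + of_real \<delta>) ^ p" for p
      by (simp only: of_real_power power_mult_distrib)
    have "gauss_wave \<sigma> u * of_real (laguerre 0 j (u\<^sup>2 + \<delta>\<^sup>2))
      = (\<Sum>p\<le>j. of_real (real (j choose (j - p)) / fact p) * (gauss_wave \<sigma> u * of_real ((- (u\<^sup>2 + \<delta>\<^sup>2)) ^ p)))"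
      unfolding laguerre_def of_real_sum sum_distrib_left by (intro sum.cong refl) simp
    also have "\<dots> = (\<Sum>p\<le>j. of_real (real (j choose p) / fact p) * gauss_int \<sigma> \<delta> p p u)"
      unfolding p gauss_int_def by (intro sum.cong refl) (simp add: binomial_symmetric[symmetric])
    finally show ?thesis .
  qed
  show "integrable lborel (\<lambda>u. gauss_wave \<sigma> u * of_real (laguerre 0 j (u\<^sup>2 + \<delta>\<^sup>2)))"
    unfolding e by (intro Bochner_Integration.integrable_sum integrable_mult_right gauss_int_properties)
  have "(LINT u|lborel. gauss_wave \<sigma> u * of_real (laguerre 0 j (u\<^sup>2 + \<delta>\<^sup>2)))
      = (\<Sum>p\<le>j. of_real (real (j choose p) / fact p) * gauss_mom \<sigma> \<delta> p p)"
    unfolding e gauss_mom_def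
    by (subst Bochner_Integration.integral_sum)
      (intro integrable_mult_right gauss_int_properties, simp)
  \<comment> \<open>Reversal p = j - i; then (j choose i)/(j - i)! = (j choose i)^2 i!/j! matches
    the coefficients of \<open>linearised_product\<close>.\<close>
  also have "\<dots> = (\<Sum>i\<le>j. of_real (real (j choose (j - i)) / fact (j - i)) * gauss_mom \<sigma> \<delta> (j - i) (j - i))"
    by (rule sum.reindex_bij_witness[where i = "\<lambda>i. j - i" and j = "\<lambda>i. j - i"]) auto
  also have "\<dots> = (\<Sum>i\<le>j. of_real (1 / fact j) * (of_nat ((j choose i) * (j choose i) * fact i) * gauss_mom \<sigma> \<delta> (j - i) (j - i)))"
  proof (intro sum.cong refl)
    fix i assume "i \<in> {..j}"
    then have i: "i \<le> j" by simp
    have "real (fact i) * real (fact (j - i)) * real (j choose i) = real (fact j)"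
      using binomial_fact_lemma[OF i] by (metis of_nat_mult)
    then have "real (j choose i) / fact (j - i) = (1 / fact j) * real ((j choose i) * (j choose i) * fact i)"
      by (simp add: field_simps)
    then have "complex_of_real (real (j choose (j - i)) / fact (j - i))
      = of_real (1 / fact j) * of_real (real ((j choose i) * (j choose i) * fact i))"
      unfolding binomial_symmetric[OF i, symmetric] of_real_mult[symmetric] by (rule arg_cong)
    then show "of_real (real (j choose (j - i)) / fact (j - i)) * gauss_mom \<sigma> \<delta> (j - i) (j - i)
      = of_real (1 / fact j) * (of_nat ((j choose i) * (j choose i) * fact i) * gauss_mom \<sigma> \<delta> (j - i) (j - i))"
      by (simp only: of_real_of_nat_eq mult.assoc)
  qed
  also have "\<dots> = of_real (1 / fact j) * linearised_product \<sigma> \<delta> j j"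
    by (simp only: linearised_product_def sum_distrib_left)
  also have "\<dots> = of_real (sqrt (2 * pi) * exp (- \<sigma>\<^sup>2 / 2) * hermite_prob j (\<sigma> - \<delta>) * hermite_prob j (\<sigma> + \<delta>) / fact j)"
    unfolding linearised_product_eq gauss_mom_00 of_real_mult[symmetric] by simp
  finally show "(LINT u|lborel. gauss_wave \<sigma> u * of_real (laguerre 0 j (u\<^sup>2 + \<delta>\<^sup>2)))
    = of_real (sqrt (2 * pi) * exp (- \<sigma>\<^sup>2 / 2) * hermite_prob j (\<sigma> - \<delta>) * hermite_prob j (\<sigma> + \<delta>) / fact j)" .
qed

text \<open>\<sigma> = \<xi> + y + v and \<delta> = v - y are half the sum and half the difference
  of \<xi> + 2v and \<xi> + 2y, so \<sigma> - \<delta> and \<sigma> + \<delta> recover these two;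
  the parallelogram law matches the Gaussian factors.\<close>

lemma fourier_laguerre_hermite_fun:
  "of_real (exp (- (v - y)\<^sup>2 / 2)) * (LINT u|lborel. gauss_wave (\<xi> + y + v) u * of_real (laguerre 0 j (u\<^sup>2 + (v - y)\<^sup>2)))
    = complex_of_real (sqrt (2 * pi) * sqrt pi * (hermite_fun j ((\<xi> + 2 * y) / sqrt 2) * hermite_fun j ((\<xi> + 2 * v) / sqrt 2)))"
proof -
  define a b where "a = \<xi> + 2 * y" and "b = \<xi> + 2 * v"
  have "- ((a / sqrt 2)\<^sup>2 + (b / sqrt 2)\<^sup>2) / 2 = - (v - y)\<^sup>2 / 2 + - (\<xi> + y + v)\<^sup>2 / 2"
    by (simp add: power_divide a_def b_def) (simp add: power2_eq_square field_simps)
  then have E: "exp (- ((a / sqrt 2)\<^sup>2 + (b / sqrt 2)\<^sup>2) / 2)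
      = exp (- (v - y)\<^sup>2 / 2) * exp (- (\<xi> + y + v)\<^sup>2 / 2)"
    by (simp only: exp_add)
  have ab: "\<xi> + y + v - (v - y) = a" "\<xi> + y + v + (v - y) = b" by (simp_all add: a_def b_def)
  show ?thesis
    unfolding fourier_laguerre(2) hermite_fun_mult a_def[symmetric] b_def[symmetric] E ab of_real_mult[symmetric]
    by simp
qed

section \<open>The reproducing kernel\<close>

definition cvec :: "(real^'n) \<times> (real^'n) \<Rightarrow> complex^'n" where
  "cvec p = (\<chi> r. Complex (fst p $ r) (snd p $ r))"

definition hdot :: "complex^'n \<Rightarrow> complex^'n \<Rightarrow> complex" where
  "hdot w z = (\<Sum>r\<in>UNIV. w $ r * cnj (z $ r))"

lemma hdot_add_left: "hdot (u + w) z = hdot u z + hdot w z"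
  by (simp add: hdot_def distrib_right sum.distrib)

lemma hdot_scale_left: "hdot (\<zeta> *s w) z = \<zeta> * hdot w z"
  by (simp add: hdot_def sum_distrib_left mult.assoc)

lemma Re_hdot: "Re (hdot w z) = w \<bullet> z"
  by (simp add: hdot_def cvec_inner)

lemma hdot_self: "hdot z z = of_real ((norm z)\<^sup>2)"
proof (rule complex_eqI)
  show "Re (hdot z z) = Re (of_real ((norm z)\<^sup>2))" by (simp add: Re_hdot power2_norm_eq_inner)
  show "Im (hdot z z) = Im (of_real ((norm z)\<^sup>2))" by (simp add: hdot_def)
qed

lemma norm_cvec: "(norm (cvec (x, y)))\<^sup>2 = (norm x)\<^sup>2 + (norm y)\<^sup>2"
  by (simp add: power2_norm_eq_inner cvec_inner inner_vec_def cvec_def sum.distrib)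

lemma norm_diff_hdot: "(norm (w - z))\<^sup>2 = (norm w)\<^sup>2 + (norm z)\<^sup>2 - 2 * Re (hdot w z)"
  by (simp add: Re_hdot power2_norm_eq_inner inner_diff_left inner_diff_right inner_commute)

lemma norm_add_hdot: "(norm (z + w))\<^sup>2 = (norm w)\<^sup>2 + (norm z)\<^sup>2 + 2 * Re (hdot w z)"
  by (simp add: Re_hdot power2_norm_eq_inner inner_add_left inner_add_right inner_commute)

lemma continuous_hdot: "continuous_on UNIV (\<lambda>w. hdot w z)"
  unfolding hdot_def by (intro continuous_intros)

lemma continuous_laguerre: "continuous_on UNIV (laguerre a N)"
  unfolding laguerre_def by (intro continuous_intros) auto

lemma Hm_embed_cvec:
  "Hm_embed \<alpha> f (x, y) = of_real (2 powr (real CARD('n) / 2))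
     * exp (of_real (- (norm (cvec (x, y)))\<^sup>2 / 2) - \<i> * of_real (x \<bullet> y))
     * f ((1 / sqrt \<alpha>) *\<^sub>R cvec (x, y :: real^'n))"
proof -
  have "(\<chi> r. (complex_of_real (x $ r) + \<i> * complex_of_real (y $ r)) / complex_of_real (sqrt \<alpha>))
      = (1 / sqrt \<alpha>) *\<^sub>R cvec (x, y)"
    by (simp add: vec_eq_iff cvec_def Complex_eq) (simp add: scaleR_conv_of_real field_simps)
  moreover have "- (norm (cvec (x, y)))\<^sup>2 / 2 = - (norm x)\<^sup>2 / 2 - (norm y)\<^sup>2 / 2"
    unfolding norm_cvec by simp
  ultimately show ?thesis by (simp only: Hm_embed_def prod.case)
qed

section \<open>The candidate kernel and its membership in the space\<close>

text \<open>\<open>p\<close> is the index point and \<open>p'\<close> the variable. The constant 2^n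
  balances the factor (2 \<pi>)^(-n) of \<open>Hm_inner\<close> against the Gaussian integral
  \<pi>^n.\<close>

definition explicit_kernel ::
  "nat \<Rightarrow> (real ^ 'n) \<times> (real ^ 'n) \<Rightarrow> (real ^ 'n) \<times> (real ^ 'n) \<Rightarrow> complex" where
  "explicit_kernel m p p' = of_real (2 ^ CARD('n))
     * exp (of_real (- (norm (cvec p))\<^sup>2 / 2 - (norm (cvec p'))\<^sup>2 / 2)
          + \<i> * of_real (fst p \<bullet> snd p) - \<i> * of_real (fst p' \<bullet> snd p') + hdot (cvec p') (cvec p))
     * of_real (laguerre CARD('n) (m - 1) ((norm (cvec p' - cvec p))\<^sup>2))"

text \<open>The preimage of \<open>explicit_kernel\<close> under \<open>Hm_embed\<close>, with
  \<alpha> scaled out of the argument. It carries the square root of the constant 2^n;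
  \<open>Hm_embed\<close> supplies the other one.\<close>

definition Fock_kernel :: "nat \<Rightarrow> (real ^ 'n) \<times> (real ^ 'n) \<Rightarrow> complex ^ 'n \<Rightarrow> complex" where
  "Fock_kernel m p w = of_real (2 powr (real CARD('n) / 2))
     * exp (of_real (- (norm (cvec p))\<^sup>2 / 2) + \<i> * of_real (fst p \<bullet> snd p) + hdot w (cvec p))
     * of_real (laguerre CARD('n) (m - 1) ((norm (w - cvec p))\<^sup>2))"

lemma two_powr_half_square: "2 powr (real n / 2) * 2 powr (real n / 2) = 2 ^ n"
  by (simp add: powr_add[symmetric] powr_realpow)

lemma Hm_embed_Fock_kernel:
  fixes p :: "(real ^ 'n) \<times> (real ^ 'n)"
  assumes "\<alpha> > 0"
  shows "Hm_embed \<alpha> (\<lambda>w. Fock_kernel m p (sqrt \<alpha> *\<^sub>R w)) = explicit_kernel m p"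
proof
  fix p' :: "(real ^ 'n) \<times> (real ^ 'n)"
  obtain u v where p': "p' = (u, v)" by fastforce
  have t: "complex_of_real (2 ^ CARD('n)) = of_real (2 powr (real CARD('n) / 2)) * of_real (2 powr (real CARD('n) / 2))"
    unfolding of_real_mult[symmetric] two_powr_half_square ..
  have e: "exp (of_real (- (norm (cvec p))\<^sup>2 / 2 - (norm (cvec p'))\<^sup>2 / 2)
          + \<i> * of_real (fst p \<bullet> snd p) - \<i> * of_real (u \<bullet> v) + hdot (cvec p') (cvec p))
      = exp (of_real (- (norm (cvec p'))\<^sup>2 / 2) - \<i> * of_real (u \<bullet> v))
        * exp (of_real (- (norm (cvec p))\<^sup>2 / 2) + \<i> * of_real (fst p \<bullet> snd p) + hdot (cvec p') (cvec p))"
    unfolding exp_add[symmetric] by (rule arg_cong[where f = exp]) (simp add: algebra_simps)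
  have s: "sqrt \<alpha> *\<^sub>R (1 / sqrt \<alpha>) *\<^sub>R cvec p' = cvec p'" using assms by simp
  show "Hm_embed \<alpha> (\<lambda>w. Fock_kernel m p (sqrt \<alpha> *\<^sub>R w)) p' = explicit_kernel m p p'"
    unfolding p' Hm_embed_cvec unfolding p'[symmetric] s
    unfolding Fock_kernel_def explicit_kernel_def t unfolding p' fst_conv snd_conv unfolding p'[symmetric] e
    by (simp only: mult_ac)
qed

lemma norm_vec_sum_square: "complex_of_real ((norm (w :: complex^'n))\<^sup>2) = (\<Sum>r\<in>UNIV. w $ r * cnj (w $ r))"
  using hdot_self[of w] by (simp add: hdot_def)

text \<open>The Hermitian product is holomorphic in its first argument, and |w - z|^2 has degree 1
  in the conjugate variables, so the degree m - 1 of the Laguerre polynomial decides.\<close>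

lemma conj_poly_Fock_kernel:
  fixes p :: "(real ^ 'n) \<times> (real ^ 'n)"
  shows "conj_poly (m - 1) (\<lambda>w. Fock_kernel m p (s *\<^sub>R w))"
proof -
  have c: "conj_poly 0 (\<lambda>w. of_real s * (w $ r))" "conj_poly 1 (\<lambda>w. of_real s * cnj (w $ r))" for r :: 'n
    by (rule conj_poly_cmult[OF conj_poly.coord] conj_poly_cmult[OF conj_poly.cnj_coord])+
  have "conj_poly 0 (\<lambda>w::complex^'n. hdot (s *\<^sub>R w) z)" for z
  proof -
    have "conj_poly 0 (\<lambda>w::complex^'n. \<Sum>r\<in>UNIV. (of_real s * w $ r) * cnj (z $ r))"
      using conj_poly.mult[OF c(1) conj_poly.const] by (intro conj_poly_sum) simp
    then show ?thesis by (simp add: hdot_def scaleR_conv_of_real[of s "_ :: complex"])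
  qed
  then have "conj_poly 0 (\<lambda>w::complex^'n. exp ((a + hdot (s *\<^sub>R w) z)))" for a z
    by (intro conj_poly.exp conj_poly.add conj_poly.const)
  then have 1: "conj_poly 0 (\<lambda>w::complex^'n. C * exp ((a + hdot (s *\<^sub>R w) z)))" for a z C
    by (rule conj_poly_cmult)
  have n: "conj_poly 1 (\<lambda>w::complex^'n. of_real ((norm (s *\<^sub>R w - z))\<^sup>2))" for z
  proof -
    have "conj_poly (0 + 1) (\<lambda>w. (of_real s * w $ r + - (z $ r)) * (of_real s * cnj (w $ r) + - cnj (z $ r)))" for r
      by (intro conj_poly.mult conj_poly.add c conj_poly_const)
    then have "conj_poly 1 (\<lambda>w. \<Sum>r\<in>UNIV. (of_real s * w $ r + - (z $ r)) * (of_real s * cnj (w $ r) + - cnj (z $ r)))"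
      by (intro conj_poly_sum) simp
    then show ?thesis
      unfolding norm_vec_sum_square by (simp add: scaleR_conv_of_real[of s "_ :: complex"])
  qed
  have "conj_poly (m - 1) (\<lambda>w::complex^'n. of_real (laguerre CARD('n) (m - 1) ((norm (s *\<^sub>R w - z))\<^sup>2)))" for z
  proof -
    have "conj_poly (m - 1) (\<lambda>w::complex^'n. \<Sum>j\<le>m - 1. of_real (real ((m - 1 + CARD('n)) choose (m - 1 - j)) * (-1) ^ j / fact j)
        * of_real ((norm (s *\<^sub>R w - z))\<^sup>2) ^ j)"
    proof (intro conj_poly_sum conj_poly_cmult)
      fix j assume "j \<in> {..m - 1}"
      then show "conj_poly (m - 1) (\<lambda>w::complex^'n. of_real ((norm (s *\<^sub>R w - z))\<^sup>2) ^ j)"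
        using conj_poly.mono[OF conj_poly_power[OF n[of z], of j]] by simp
    qed
    moreover have "complex_of_real (laguerre CARD('n) (m - 1) x)
        = (\<Sum>j\<le>m - 1. of_real (real ((m - 1 + CARD('n)) choose (m - 1 - j)) * (-1) ^ j / fact j) * of_real x ^ j)" for x
      unfolding laguerre_def of_real_sum by (intro sum.cong refl, subst power_minus) simp
    ultimately show ?thesis by simp
  qed
  from conj_poly.mult[OF 1 this] show ?thesis
    unfolding Fock_kernel_def by simp
qed

lemma laguerre_square_gaussian_integrable:
  "integrable lborel (\<lambda>w::complex^'n. (laguerre a N ((norm w)\<^sup>2))\<^sup>2 * exp (- (norm w)\<^sup>2))"
proof -
  have "(laguerre a N ((norm w)\<^sup>2))\<^sup>2 * exp (- (norm w)\<^sup>2)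
      = (\<Sum>i\<le>N. \<Sum>j\<le>N. (real ((N + a) choose (N - i)) * (-1) ^ i / fact i * (real ((N + a) choose (N - j)) * (-1) ^ j / fact j))
        * (norm w ^ (2 * i + 2 * j) * exp (- (norm w)\<^sup>2)))" for w :: "complex^'n"
  proof -
    have l: "laguerre a N ((norm w)\<^sup>2) = (\<Sum>i\<le>N. real ((N + a) choose (N - i)) * (-1) ^ i / fact i * norm w ^ (2 * i))"
      unfolding laguerre_def power_mult[of _ 2] by (subst power_minus) (simp add: field_simps)
    show ?thesis
      unfolding l unfolding power2_eq_square[of "sum _ _"] sum_product unfolding sum_distrib_right power_add
      by (intro sum.cong refl) (simp only: mult_ac)
  qed
  then show ?thesis
    by (simp only:) (intro Bochner_Integration.integrable_sum integrable_mult_right gaussian_moments)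
qed

text \<open>Completing the square, -|z|^2 + 2 Re <w, z> - |w|^2 = -|w - z|^2. After scaling by sqrt
  \<alpha>, the weighted squared modulus is thus a translate of a polynomial times a
  Gaussian.\<close>

lemma Fock_kernel_in_Fock:
  fixes p :: "(real ^ 'n) \<times> (real ^ 'n)"
  assumes "\<alpha> > 0" "m \<ge> 1"
  shows "(\<lambda>w. Fock_kernel m p (sqrt \<alpha> *\<^sub>R w)) \<in> Fock \<alpha> m"
proof -
  let ?z = "cvec p"
  define C :: real where "C = 2 ^ CARD('n)"
  let ?G = "\<lambda>w::complex^'n. C * ((laguerre CARD('n) (m - 1) ((norm w)\<^sup>2))\<^sup>2 * exp (- (norm w)\<^sup>2))"
  have G: "integrable lborel ?G" by (intro integrable_mult_right laguerre_square_gaussian_integrable)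
  have "(cmod (Fock_kernel m p (sqrt \<alpha> *\<^sub>R w)))\<^sup>2 * exp (- \<alpha> * (norm w)\<^sup>2) = ?G (- ?z + sqrt \<alpha> *\<^sub>R w)" for w
  proof -
    let ?w = "sqrt \<alpha> *\<^sub>R w"
    have n: "cmod (Fock_kernel m p ?w) = 2 powr (real CARD('n) / 2)
        * exp (- (norm ?z)\<^sup>2 / 2 + Re (hdot ?w ?z)) * \<bar>laguerre CARD('n) (m - 1) ((norm (?w - ?z))\<^sup>2)\<bar>"
      by (simp add: Fock_kernel_def norm_mult)
    have "(norm ?w)\<^sup>2 = \<alpha> * (norm w)\<^sup>2" using assms(1) by (simp add: power_mult_distrib)
    then have "2 * (- (norm ?z)\<^sup>2 / 2 + Re (hdot ?w ?z)) + - \<alpha> * (norm w)\<^sup>2 = - (norm (?w - ?z))\<^sup>2"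
      by (simp add: norm_diff_hdot)
    then have 1: "(exp (- (norm ?z)\<^sup>2 / 2 + Re (hdot ?w ?z)))\<^sup>2 * exp (- \<alpha> * (norm w)\<^sup>2) = exp (- (norm (?w - ?z))\<^sup>2)"
      by (simp only: exp_double[symmetric] exp_add[symmetric])
    have 2: "(2 powr (real CARD('n) / 2))\<^sup>2 = C"
      unfolding C_def power2_eq_square by (rule two_powr_half_square)
    have 3: "- ?z + ?w = ?w - ?z" by simp
    have "(cmod (Fock_kernel m p ?w))\<^sup>2 * exp (- \<alpha> * (norm w)\<^sup>2)
        = (2 powr (real CARD('n) / 2))\<^sup>2 * ((laguerre CARD('n) (m - 1) ((norm (?w - ?z))\<^sup>2))\<^sup>2
          * ((exp (- (norm ?z)\<^sup>2 / 2 + Re (hdot ?w ?z)))\<^sup>2 * exp (- \<alpha> * (norm w)\<^sup>2)))"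
      unfolding n power_mult_distrib power2_abs by (simp only: mult_ac)
    then show ?thesis unfolding 1 2 3 .
  qed
  moreover have "integrable lborel (\<lambda>w. ?G (- ?z + sqrt \<alpha> *\<^sub>R w))"
    using lborel_integral_affine(2)[of ?G "sqrt \<alpha>" "- ?z"] G assms(1) borel_measurable_integrable[OF G] by simp
  moreover have "m_analytic m (\<lambda>w. Fock_kernel m p (sqrt \<alpha> *\<^sub>R w))"
    using assms(2) by (intro conj_poly_m_analytic[OF conj_poly_Fock_kernel]) simp
  ultimately show ?thesis by (simp only: Fock_def mem_Collect_eq)
qed

lemma explicit_kernel_in_Hm: "\<alpha> > 0 \<Longrightarrow> m \<ge> 1 \<Longrightarrow> explicit_kernel m p \<in> Hm \<alpha> m"
  unfolding Hm_def using Hm_embed_Fock_kernel Fock_kernel_in_Fock by (metis imageI)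

section \<open>Reproducing property and uniqueness\<close>

text \<open>\<open>F\<close> in the proof is the Weyl translate of f up to a constant. Its
  exponential factor is entire in w, so slices keep their order, and |w|^2 + 2 Re <w, z> = |z + w|^2
  - |z|^2 transfers square integrability.\<close>

lemma Fock_reproducing:
  fixes f :: "complex ^ 'n \<Rightarrow> complex"
  assumes \<alpha>: "\<alpha> > 0" and m: "m \<ge> 1" and f: "f \<in> Fock \<alpha> m"
  shows "(LINT w|lborel. f ((1 / sqrt \<alpha>) *\<^sub>R (z + w)) * exp (- hdot w z)
      * of_real (laguerre CARD('n) (m - 1) ((norm w)\<^sup>2) * exp (- (norm w)\<^sup>2)))
    = of_real (pi ^ CARD('n)) * f ((1 / sqrt \<alpha>) *\<^sub>R z)"
proof -
  have ma: "m_analytic m f" and int: "integrable lborel (\<lambda>z. (cmod (f z))\<^sup>2 * exp (- \<alpha> * (norm z)\<^sup>2))"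
    using f by (auto simp: Fock_def)
  have cf: "continuous_on UNIV f" using ma by (simp add: m_analytic_def smooth_imp_continuous)
  define F where "F w = f ((1 / sqrt \<alpha>) *\<^sub>R (z + w)) * exp (- hdot w z)" for w
  have cF: "continuous_on UNIV F"
    unfolding F_def by (intro continuous_intros continuous_hdot continuous_on_compose2[OF cf]) auto
  have sl: "polyanalytic_slices m F"
    unfolding polyanalytic_slices_def
  proof
    fix w
    obtain a where hol: "\<And>k. k < m \<Longrightarrow> a k holomorphic_on UNIV"
      and a: "\<And>\<zeta>. f ((1 / sqrt \<alpha>) *\<^sub>R z + \<zeta> *s ((1 / sqrt \<alpha>) *\<^sub>R w)) = (\<Sum>k<m. cnj \<zeta> ^ k * a k \<zeta>)"
      using m_analytic_slice[OF ma] by blast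
    have "F (\<zeta> *s w) = (\<Sum>k<m. cnj \<zeta> ^ k * (a k \<zeta> * exp (- (\<zeta> * hdot w z))))" for \<zeta>
    proof -
      have "(1 / sqrt \<alpha>) *\<^sub>R (z + \<zeta> *s w) = (1 / sqrt \<alpha>) *\<^sub>R z + \<zeta> *s ((1 / sqrt \<alpha>) *\<^sub>R w)"
        by (simp add: vec_eq_iff algebra_simps)
      then show ?thesis
        unfolding F_def by (simp only: a hdot_scale_left sum_distrib_right mult.assoc)
    qed
    then show "\<exists>a. (\<forall>k<m. a k holomorphic_on UNIV) \<and> (\<forall>\<zeta>. F (\<zeta> *s w) = (\<Sum>k<m. cnj \<zeta> ^ k * a k \<zeta>))"
      by (intro exI[of _ "\<lambda>k \<zeta>. a k \<zeta> * exp (- (\<zeta> * hdot w z))"] conjI allI impI)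
        (auto intro!: holomorphic_intros hol)
  qed
  let ?G = "\<lambda>w. exp ((norm z)\<^sup>2) * ((cmod (f w))\<^sup>2 * exp (- \<alpha> * (norm w)\<^sup>2))"
  have G: "integrable lborel ?G" by (intro integrable_mult_right int)
  have "(cmod (F w))\<^sup>2 * exp (- (norm w)\<^sup>2) = ?G ((1 / sqrt \<alpha>) *\<^sub>R z + (1 / sqrt \<alpha>) *\<^sub>R w)" for w
  proof -
    let ?v = "(1 / sqrt \<alpha>) *\<^sub>R (z + w)"
    have "\<alpha> * (norm ?v)\<^sup>2 = (norm (z + w))\<^sup>2"
      using \<alpha> by (simp add: power_mult_distrib power_divide)
    then have "2 * (- Re (hdot w z)) + - (norm w)\<^sup>2 = (norm z)\<^sup>2 + - \<alpha> * (norm ?v)\<^sup>2"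
      by (simp add: norm_add_hdot)
    then have 1: "(exp (- Re (hdot w z)))\<^sup>2 * exp (- (norm w)\<^sup>2) = exp ((norm z)\<^sup>2) * exp (- \<alpha> * (norm ?v)\<^sup>2)"
      by (simp only: exp_double[symmetric] exp_add[symmetric])
    have "cmod (F w) = cmod (f ?v) * exp (- Re (hdot w z))"
      by (simp add: F_def norm_mult)
    then have "(cmod (F w))\<^sup>2 * exp (- (norm w)\<^sup>2)
        = (cmod (f ?v))\<^sup>2 * ((exp (- Re (hdot w z)))\<^sup>2 * exp (- (norm w)\<^sup>2))"
      by (simp only: power_mult_distrib mult.assoc)
    then show ?thesis
      unfolding 1 scaleR_add_right[symmetric] by (simp only: mult.left_commute)
  qed
  moreover have "integrable lborel (\<lambda>w. ?G ((1 / sqrt \<alpha>) *\<^sub>R z + (1 / sqrt \<alpha>) *\<^sub>R w))"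
    using lborel_integral_affine(2)[of ?G "1 / sqrt \<alpha>" "(1 / sqrt \<alpha>) *\<^sub>R z"] G \<alpha> borel_measurable_integrable[OF G]
    by simp
  ultimately have "integrable lborel (\<lambda>w. (cmod (F w))\<^sup>2 * exp (- (norm w)\<^sup>2))" by (simp only:)
  from laguerre_reproduces_at_0[OF cF sl m this]
  show ?thesis by (simp add: F_def hdot_def)
qed

lemma explicit_kernel_reproducing:
  fixes p :: "(real ^ 'n) \<times> (real ^ 'n)"
  assumes \<alpha>: "\<alpha> > 0" and m: "m \<ge> 1" and g: "g \<in> Hm \<alpha> m"
  shows "Hm_inner g (explicit_kernel m p) = g p"
proof -
  obtain f where f: "f \<in> Fock \<alpha> m" and gf: "g = Hm_embed \<alpha> f" using g by (auto simp: Hm_def)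
  have cf: "continuous_on UNIV f"
    using f by (simp add: Fock_def m_analytic_def smooth_imp_continuous)
  let ?z = "cvec p" and ?Q = "laguerre CARD('n) (m - 1)"
  define E where "E = exp (of_real (- (norm ?z)\<^sup>2 / 2) - \<i> * of_real (fst p \<bullet> snd p))"
  define C where "C = of_real (2 powr (real CARD('n) / 2)) * of_real (2 ^ CARD('n)) * E"
  define \<Phi> where "\<Phi> w = C * (exp (of_real (- (norm w)\<^sup>2) + cnj (hdot w ?z))
      * f ((1 / sqrt \<alpha>) *\<^sub>R w) * of_real (?Q ((norm (w - ?z))\<^sup>2)))" for w
  \<comment> \<open>The phases belonging to \<open>p'\<close> cancel, so the integrand becomes a
    function on C^n; the phase of \<open>p\<close> stays in \<open>E\<close>.\<close>
  have "g p' * cnj (explicit_kernel m p p') = \<Phi> (cvec p')" for p'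
  proof -
    obtain u v where p': "p' = (u, v)" by fastforce
    let ?w = "cvec p'"
    have "exp (of_real (- (norm ?w)\<^sup>2 / 2) - \<i> * of_real (u \<bullet> v))
        * exp (of_real (- (norm ?z)\<^sup>2 / 2 - (norm ?w)\<^sup>2 / 2) - \<i> * of_real (fst p \<bullet> snd p) + \<i> * of_real (u \<bullet> v) + cnj (hdot ?w ?z))
      = E * exp (of_real (- (norm ?w)\<^sup>2) + cnj (hdot ?w ?z))"
      unfolding E_def exp_add[symmetric] by (rule arg_cong[where f = exp]) (simp add: field_simps)
    moreover have "cnj (explicit_kernel m p p') = of_real (2 ^ CARD('n))
        * exp (of_real (- (norm ?z)\<^sup>2 / 2 - (norm ?w)\<^sup>2 / 2) - \<i> * of_real (fst p \<bullet> snd p) + \<i> * of_real (u \<bullet> v) + cnj (hdot ?w ?z))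
        * of_real (?Q ((norm (?w - ?z))\<^sup>2))"
      by (simp add: explicit_kernel_def p' exp_cnj)
    moreover have "g p' = of_real (2 powr (real CARD('n) / 2))
        * exp (of_real (- (norm ?w)\<^sup>2 / 2) - \<i> * of_real (u \<bullet> v)) * f ((1 / sqrt \<alpha>) *\<^sub>R ?w)"
      unfolding gf p' by (rule Hm_embed_cvec)
    ultimately show ?thesis by (simp only: \<Phi>_def C_def mult_ac)
  qed
  then have "(LINT p'|lborel. g p' * cnj (explicit_kernel m p p')) = (LINT p'|lborel. \<Phi> (cvec p'))"
    by simp
  also have m\<Phi>: "\<Phi> \<in> borel_measurable borel"
    unfolding \<Phi>_def
    by (intro borel_measurable_continuous_onI continuous_intros continuous_hdot
        continuous_on_compose2[OF cf] continuous_on_compose2[OF continuous_laguerre]) auto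
  then have "(LINT p'|lborel. \<Phi> (cvec p')) = (LINT w|lborel. \<Phi> w)"
    unfolding cvec_def by (rule lborel_integral_cvec_of_pair(1))
  also have "\<dots> = (LINT w|lborel. \<Phi> (?z + w))"
    using lborel_integral_affine(1)[OF m\<Phi>, of 1 ?z] by simp
  also have "\<dots> = (LINT w|lborel. C * (f ((1 / sqrt \<alpha>) *\<^sub>R (?z + w)) * exp (- hdot w ?z)
      * of_real (?Q ((norm w)\<^sup>2) * exp (- (norm w)\<^sup>2))))"
  proof (intro Bochner_Integration.integral_cong refl)
    fix w
    \<comment> \<open>After the translation the exponent -|z + w|^2 + cnj <z + w, z> is -|w|^2 - <w,
      z>: the conjugate terms cancel, which leaves the weight of
      \<open>Fock_reproducing\<close>.\<close>
    have "of_real (2 * Re (hdot w ?z)) = hdot w ?z + cnj (hdot w ?z)"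
      by (simp add: complex_add_cnj)
    then have "of_real (- (norm (?z + w))\<^sup>2) + cnj (hdot (?z + w) ?z) = - hdot w ?z + of_real (- (norm w)\<^sup>2)"
      unfolding norm_add_hdot hdot_add_left complex_cnj_add hdot_self by simp
    then have "exp (of_real (- (norm (?z + w))\<^sup>2) + cnj (hdot (?z + w) ?z)) = exp (- hdot w ?z) * of_real (exp (- (norm w)\<^sup>2))"
      by (simp only: exp_add exp_of_real)
    moreover have "?z + w - ?z = w" by simp
    ultimately show "\<Phi> (?z + w) = C * (f ((1 / sqrt \<alpha>) *\<^sub>R (?z + w)) * exp (- hdot w ?z)
      * of_real (?Q ((norm w)\<^sup>2) * exp (- (norm w)\<^sup>2)))"
      by (simp only: \<Phi>_def of_real_mult mult_ac)
  qed
  also have "\<dots> = C * (of_real (pi ^ CARD('n)) * f ((1 / sqrt \<alpha>) *\<^sub>R ?z))"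
    using Fock_reproducing[OF \<alpha> m f, of ?z] by simp
  finally have I: "Hm_inner g (explicit_kernel m p)
      = of_real (1 / (2 * pi) ^ CARD('n)) * (C * (of_real (pi ^ CARD('n)) * f ((1 / sqrt \<alpha>) *\<^sub>R ?z)))"
    by (simp only: Hm_inner_def)
  have k: "complex_of_real (1 / (2 * pi) ^ CARD('n)) * (of_real (2 ^ CARD('n)) * of_real (pi ^ CARD('n))) = 1"
    unfolding of_real_mult[symmetric] by (simp add: power_mult_distrib)
  have "Hm_inner g (explicit_kernel m p)
      = (complex_of_real (1 / (2 * pi) ^ CARD('n)) * (of_real (2 ^ CARD('n)) * of_real (pi ^ CARD('n))))
        * (of_real (2 powr (real CARD('n) / 2)) * E * f ((1 / sqrt \<alpha>) *\<^sub>R ?z))"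
    unfolding I C_def by (simp only: mult_ac)
  also have "\<dots> = g p"
    unfolding k gf using Hm_embed_cvec[of \<alpha> f "fst p" "snd p"] by (simp add: E_def)
  finally show ?thesis .
qed

lemma Hm_inner_commute: "Hm_inner h g = cnj (Hm_inner g h)"
  unfolding Hm_inner_def by (simp add: Bochner_Integration.integral_cnj[symmetric] mult.commute)

text \<open>For uniqueness, write K for the explicit kernel. A reproducing h satisfies h(p') = <h,
  K_p'> = cnj <K_p', h> = cnj (K_p'(p)), which determines it, and K_p satisfies the same
  equation.\<close>

lemma Hm_kernel_explicit:
  assumes "\<alpha> > 0" "m \<ge> 1"
  shows "Hm_kernel \<alpha> m p = explicit_kernel m p"
  unfolding Hm_kernel_def
proof (rule the_equality)
  note in_Hm = explicit_kernel_in_Hm[OF assms] and rep = explicit_kernel_reproducing[OF assms]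
  show "explicit_kernel m p \<in> Hm \<alpha> m \<and> (\<forall>g\<in>Hm \<alpha> m. g p = Hm_inner g (explicit_kernel m p))"
    by (intro conjI ballI in_Hm rep[symmetric])
  fix h assume h: "h \<in> Hm \<alpha> m \<and> (\<forall>g\<in>Hm \<alpha> m. g p = Hm_inner g h)"
  show "h = explicit_kernel m p"
  proof
    fix p'
    have "h' p' = cnj (explicit_kernel m p' p)"
      if "h' \<in> Hm \<alpha> m" "\<forall>g\<in>Hm \<alpha> m. g p = Hm_inner g h'" for h'
    proof -
      have "h' p' = Hm_inner h' (explicit_kernel m p')" by (rule rep[OF that(1), symmetric])
      also have "\<dots> = cnj (Hm_inner (explicit_kernel m p') h')" by (rule Hm_inner_commute)
      also have "Hm_inner (explicit_kernel m p') h' = explicit_kernel m p' p"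
        by (rule that(2)[rule_format, OF in_Hm, symmetric])
      finally show ?thesis .
    qed
    note eq = this
    have "explicit_kernel m p p' = cnj (explicit_kernel m p' p)"
      by (rule eq) (intro ballI in_Hm rep[symmetric])+
    then show "h p' = explicit_kernel m p p'"
      using eq[OF conjunct1[OF h] conjunct2[OF h]] by (rule trans[OF _ sym, rotated])
  qed
qed

section \<open>Factorisation over coordinates and the final integral\<close>

text \<open>At the index point (0, y) the exponent is a sum over coordinates. Its real part is
  -u^2/2 - (v - y)^2/2 in each; the frequency \<xi> + y + v collects \<xi> from the transform, v
  from the phase at (u, v) and y from the Hermitian product. The squared distance splits likewise,
  so the addition theorem applies.\<close>

lemma explicit_kernel_product:
  fixes y u v \<xi> :: "real ^ 'n"
  shows "explicit_kernel m (0, y) (u, v) * exp (- \<i> * of_real (u \<bullet> \<xi>))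
    = of_real (2 ^ CARD('n)) * (\<Sum>k\<in>J m. \<Prod>r\<in>UNIV. of_real (exp (- (v $ r - y $ r)\<^sup>2 / 2))
        * (gauss_wave (\<xi> $ r + y $ r + v $ r) (u $ r) * of_real (laguerre 0 (k $ r) ((u $ r)\<^sup>2 + (v $ r - y $ r)\<^sup>2))))"
proof -
  let ?z = "cvec (0, y)" and ?w = "cvec (u, v)"
  define T where "T r = (u $ r)\<^sup>2 + (v $ r - y $ r)\<^sup>2" for r
  have n: "(norm (cvec (a, b :: real ^ 'n)))\<^sup>2 = (\<Sum>r\<in>UNIV. (a $ r)\<^sup>2 + (b $ r)\<^sup>2)" for a b
    unfolding norm_cvec unfolding power2_norm_eq_inner inner_vec_def
    by (simp add: power2_eq_square sum.distrib)
  have "?w - ?z = cvec (u, v - y)" by (simp add: cvec_def vec_eq_iff complex_eq_iff)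
  then have nT: "(norm (?w - ?z))\<^sup>2 = (\<Sum>r\<in>UNIV. T r)" by (simp add: n T_def)
  have "of_real (- (norm ?z)\<^sup>2 / 2 - (norm ?w)\<^sup>2 / 2) + \<i> * of_real (0 \<bullet> y) - \<i> * of_real (u \<bullet> v) + hdot ?w ?z
      + - \<i> * of_real (u \<bullet> \<xi>)
    = (\<Sum>r\<in>UNIV. of_real (- (v $ r - y $ r)\<^sup>2 / 2) + (of_real (- (u $ r)\<^sup>2 / 2) - \<i> * of_real (u $ r * (\<xi> $ r + y $ r + v $ r))))"
    (is "?l = ?r")
  proof (rule complex_eqI)
    have hd: "Re (hdot ?w ?z) = (\<Sum>r\<in>UNIV. v $ r * y $ r)"
      by (simp add: hdot_def cvec_def)
    have "Re ?l = - (norm ?z)\<^sup>2 / 2 - (norm ?w)\<^sup>2 / 2 + Re (hdot ?w ?z)" by simp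
    also have "\<dots> = (\<Sum>r\<in>UNIV. - ((0 $ r)\<^sup>2 + (y $ r)\<^sup>2) / 2 - ((u $ r)\<^sup>2 + (v $ r)\<^sup>2) / 2 + v $ r * y $ r)"
      unfolding n hd sum_negf[symmetric] sum_divide_distrib sum_subtractf[symmetric] sum.distrib[symmetric] ..
    also have "\<dots> = (\<Sum>r\<in>UNIV. - (u $ r)\<^sup>2 / 2 - (v $ r - y $ r)\<^sup>2 / 2)"
      by (intro sum.cong refl) (simp add: power2_eq_square field_simps)
    also have "\<dots> = Re ?r" by simp
    finally show "Re ?l = Re ?r" .
    show "Im ?l = Im ?r"
      by (simp add: n hdot_def cvec_def inner_vec_def sum.distrib[symmetric] sum_subtractf[symmetric]
          sum_negf[symmetric] algebra_simps)
        (auto intro!: sum.cong)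
  qed
  then have e: "exp (of_real (- (norm ?z)\<^sup>2 / 2 - (norm ?w)\<^sup>2 / 2) + \<i> * of_real (0 \<bullet> y) - \<i> * of_real (u \<bullet> v) + hdot ?w ?z)
      * exp (- \<i> * of_real (u \<bullet> \<xi>))
    = (\<Prod>r\<in>UNIV. of_real (exp (- (v $ r - y $ r)\<^sup>2 / 2)) * gauss_wave (\<xi> $ r + y $ r + v $ r) (u $ r))"
    unfolding exp_add[symmetric] by (simp only: exp_sum[OF finite] exp_add gauss_wave_def exp_of_real)
  have l: "complex_of_real (laguerre CARD('n) (m - 1) (\<Sum>r\<in>UNIV. T r))
      = (\<Sum>k\<in>(J m :: (nat ^ 'n) set). \<Prod>r\<in>UNIV. of_real (laguerre 0 (k $ r) (T r)))"
    unfolding laguerre_addition by simp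
  have "explicit_kernel m (0, y) (u, v) * exp (- \<i> * of_real (u \<bullet> \<xi>))
      = of_real (2 ^ CARD('n)) * (exp (of_real (- (norm ?z)\<^sup>2 / 2 - (norm ?w)\<^sup>2 / 2) + \<i> * of_real (0 \<bullet> y) - \<i> * of_real (u \<bullet> v) + hdot ?w ?z)
      * exp (- \<i> * of_real (u \<bullet> \<xi>))) * of_real (laguerre CARD('n) (m - 1) (\<Sum>r\<in>UNIV. T r))"
    unfolding explicit_kernel_def fst_conv snd_conv nT by (simp only: mult_ac)
  also have "\<dots> = of_real (2 ^ CARD('n)) * (\<Sum>k\<in>J m. \<Prod>r\<in>UNIV. of_real (exp (- (v $ r - y $ r)\<^sup>2 / 2))
        * (gauss_wave (\<xi> $ r + y $ r + v $ r) (u $ r) * of_real (laguerre 0 (k $ r) (T r))))"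
    unfolding e l by (simp only: mult.assoc sum_distrib_left prod.distrib)
  finally show ?thesis unfolding T_def .
qed

lemma q_mult:
  fixes k :: "nat ^ 'n"
  shows "q k \<xi> y * q k \<xi> v = of_real (2 ^ CARD('n) * sqrt pi ^ CARD('n)
    * (\<Prod>r\<in>UNIV. hermite_fun (k $ r) ((\<xi> $ r + 2 * y $ r) / sqrt 2) * hermite_fun (k $ r) ((\<xi> $ r + 2 * v $ r) / sqrt 2)))"
proof -
  have "pi powr (real CARD('n) / 4) * pi powr (real CARD('n) / 4) = (pi powr (1 / 2)) powr real CARD('n)"
    by (simp add: powr_add[symmetric] powr_powr)
  then have "pi powr (real CARD('n) / 4) * pi powr (real CARD('n) / 4) = sqrt pi ^ CARD('n)"
    by (simp add: powr_half_sqrt powr_realpow)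
  then have c: "2 ^ CARD('n) * sqrt pi ^ CARD('n) = (2 powr (real CARD('n) / 2) * 2 powr (real CARD('n) / 2))
      * (pi powr (real CARD('n) / 4) * pi powr (real CARD('n) / 4))"
    by (simp only: two_powr_half_square)
  show ?thesis
    unfolding q_def of_real_mult[symmetric] c prod.distrib by (rule arg_cong[where f = of_real]) (simp only: mult_ac)
qed

theorem theorem8p1:
  fixes \<alpha> :: real and m :: nat and \<xi> y v :: "real ^ 'n"
  assumes "\<alpha> > 0" and "m \<ge> 1"
  shows "L \<alpha> m \<xi> y v = (\<Sum>k\<in>J m. cnj (q k \<xi> y) * q k \<xi> v)
       \<and> (\<Sum>k\<in>J m. cnj (q k \<xi> y) * q k \<xi> v) = (\<Sum>k\<in>J m. q k \<xi> y * q k \<xi> v)"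
proof
  have cnj_q: "cnj (q k \<xi> y) = q k \<xi> y" for k unfolding q_def by (rule complex_cnj_complex_of_real)
  then show real: "(\<Sum>k\<in>J m. cnj (q k \<xi> y) * q k \<xi> v) = (\<Sum>k\<in>J m. q k \<xi> y * q k \<xi> v)" by simp
  define f where "f k r t = of_real (exp (- (v $ r - y $ r)\<^sup>2 / 2))
      * (gauss_wave (\<xi> $ r + y $ r + v $ r) t * of_real (laguerre 0 (k $ r) (t\<^sup>2 + (v $ r - y $ r)\<^sup>2)))"
    for k :: "nat ^ 'n" and r t
  define h where "h k r = hermite_fun (k $ r) ((\<xi> $ r + 2 * y $ r) / sqrt 2) * hermite_fun (k $ r) ((\<xi> $ r + 2 * v $ r) / sqrt 2)"
    for k :: "nat ^ 'n" and r
  have fi: "integrable lborel (f k r)" for k r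
    unfolding f_def by (intro integrable_mult_right fourier_laguerre(1))
  have If: "(LINT t|lborel. f k r t) = of_real (sqrt (2 * pi) * sqrt pi * h k r)" for k r
    unfolding f_def h_def integral_mult_right_zero by (rule fourier_laguerre_hermite_fun)
  \<comment> \<open>The n factors sqrt (2 \<pi>) from \<open>If\<close> cancel the normalisation of
    \<open>L\<close>; the remaining 2^n sqrt \<pi>^n is the square of the constant in
    \<open>q\<close>.\<close>
  have s: "(2 * pi) powr (real CARD('n) / 2) = sqrt (2 * pi) ^ CARD('n)"
    by (simp add: powr_half_sqrt[symmetric] powr_powr powr_realpow[symmetric])
  have "(LINT u|lborel. Hm_kernel \<alpha> m (0, y) (u, v) * exp (- \<i> * of_real (u \<bullet> \<xi>)))
      = (LINT u|lborel. of_real (2 ^ CARD('n)) * (\<Sum>k\<in>J m. \<Prod>r\<in>UNIV. f k r (u $ r)))"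
    unfolding Hm_kernel_explicit[OF assms] explicit_kernel_product f_def ..
  also have "\<dots> = of_real (2 ^ CARD('n)) * (\<Sum>k\<in>J m. \<Prod>r\<in>UNIV. LINT t|lborel. f k r t)"
    using lborel_integral_prod_vec[of "f _", OF fi]
    by (simp add: Bochner_Integration.integral_sum)
  also have "\<dots> = (\<Sum>k\<in>J m. of_real (2 ^ CARD('n) * (sqrt (2 * pi) ^ CARD('n) * sqrt pi ^ CARD('n) * (\<Prod>r\<in>UNIV. h k r))))"
    unfolding If by (simp add: sum_distrib_left prod.distrib power_mult_distrib del: real_sqrt_mult)
  finally have "L \<alpha> m \<xi> y v = (\<Sum>k\<in>J m. of_real (1 / sqrt (2 * pi) ^ CARD('n))
      * of_real (2 ^ CARD('n) * (sqrt (2 * pi) ^ CARD('n) * sqrt pi ^ CARD('n) * (\<Prod>r\<in>UNIV. h k r))))"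
    unfolding L_def s by (simp only: sum_distrib_left)
  also have "\<dots> = (\<Sum>k\<in>J m. q k \<xi> y * q k \<xi> v)"
    unfolding q_mult h_def[symmetric] of_real_mult[symmetric]
    by (intro sum.cong refl arg_cong[where f = of_real]) (simp del: real_sqrt_mult)
  finally show "L \<alpha> m \<xi> y v = (\<Sum>k\<in>J m. cnj (q k \<xi> y) * q k \<xi> v)" using real by simp
qed

end
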